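(* Let the assumptions (T), (S1), (S2), (P1) spelled out in the context hold and let $\Phi^{n-1}\in\mathbb R^{\dim U_h^\Omega}$ be given. Then there exists at least one vector $\Phi^n\in\mathbb R^{\dim U_h^\Omega}$ solving $$\Phi^n+\tau m\,\mathbf M_\Omega^{-1}\mathbf L_\Omega\,P^n=\Phi^{n-1},$$ where $P^n=P^n(\Phi^n,\Phi^{n-1})$ is the vector defined in the context.
   Context: $\Omega\subset\mathbb R^d$, $d\in\{2,3\}$, is a bounded convex polygonal (polyhedral) domain with boundary $\Gamma$; $\nabla_\Gamma$ is the surface gradient on $\Gamma$; $m,m_\Gamma>0$, $\kappa\ge0$ are constants (and $\sigma=\delta=\delta_\Gamma=1$). (T) The time interval $[0,T)$ is divided into $N$ subintervals of equal length $\tau=T/N>0$. (S1) $\{\mathcal T_h\}_{h>0}$ is a quasiuniform family of (conforming) partitions of $\Omega$ into disjoint open simplices $K$ with $\overline\Omega=\bigcup_{K\in\mathcal T_h}\overline K$ and $\max_K\operatorname{diam}(K)\le h$. (S2) $\{\mathcal T_h^\Gamma\}_{h>0}$ is a quasiuniform family of partitions of $\Gamma$ into disjoint open simplices $K^\Gamma$ such that for every $K^\Gamma\in\mathcal T_h^\Gamma$ there is exactly one $K\in\mathcal T_h$ with $\overline{K^\Gamma}=\overline K\cap\Gamma$, and $\Gamma=\bigcup\overline{K^\Gamma}$, $\max\operatorname{diam}(K^\Gamma)\le h$. (P1) $F,G\in C^1(\mathbb R)$ are bounded from below; there are convex, non-negative $F_+,G_+\in C^1(\mathbb R)$ and concave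 $F_-,G_-\in C^1(\mathbb R)$ with $F=F_++F_-$, $G=G_++G_-$. $U_h^\Omega$ and $U_h^\Gamma$ are the spaces of continuous, piecewise linear finite element functions on $\mathcal T_h$ and $\mathcal T_h^\Gamma$, with nodal bases $\{\chi_{h,k}\}$ and $\{\chi^\Gamma_{h,k}\}$ dual to the vertices; the first $\dim U_h^\Gamma$ vertices of $\mathcal T_h$ are those on $\Gamma$, in the same order as the vertices of $\mathcal T_h^\Gamma$. $\mathcal I_h$, $\mathcal I_h^\Gamma$ are the nodal interpolation operators. Matrices: $(\mathbf M_\Omega)_{ij}=\int_\Omega\mathcal I_h\{\chi_{h,j}\chi_{h,i}\}$, $(\mathbf M_\Gamma)_{ij}=\int_\Gamma\mathcal I_h^\Gamma\{\chi^\Gamma_{h,j}\chi^\Gamma_{h,i}\}$ (both diagonal with positive entries), $(\mathbf L_\Omega)_{ij}=\int_\Omega\nabla\chi_{h,j}\cdot\nabla\chi_{h,i}$, $(\mathbf L_\Gamma)_{ij}=\int_\Gamma\nabla_\Gamma\chi^\Gamma_{h,j}\cdot\nabla_\Gamma\chi^\Gamma_{h,i}$. For a matrix $\mathbf A$ of size $\dim U_h^\Omega$, subscripts denote blocks: $\Gamma$ = the first $\dim U_h^\Gamma$ indices, $\circ$ = the remaining (interior) indices, $\Omega$ = all indices (first subscript rows, second columns). For a vector $A$, $A|_\Gamma$ and $A|_\circ$ are the corresponding subvectors; scalar functions are applied to vectors componentwise. Define $$R_\Gamma(\Phi^n)=(\mathbf L_\Omega)_{\Gamma\Omega}\Phi^n+(\mathbf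 M_\Omega)_{\Gamma\Omega}\big(F_+'(\Phi^n)+F_-'(\Phi^{n-1})\big)+\kappa\mathbf L_\Gamma\Phi^n|_\Gamma+\mathbf M_\Gamma\big(G_+'(\Phi^n|_\Gamma)+G_-'(\Phi^{n-1}|_\Gamma)\big),$$ $$R_\circ(\Phi^n)=(\mathbf L_\Omega)_{\circ\Omega}\Phi^n+(\mathbf M_\Omega)_{\circ\Omega}\big(F_+'(\Phi^n)+F_-'(\Phi^{n-1})\big),$$ $$\mathbf S=m(\mathbf L_\Omega)_{\Gamma\Gamma}+m_\Gamma(\mathbf M_\Omega)_{\Gamma\Gamma}\mathbf M_\Gamma^{-1}\mathbf L_\Gamma\mathbf M_\Gamma^{-1}(\mathbf M_\Omega)_{\Gamma\Gamma}$$ ($\mathbf S$ is symmetric positive definite). The vector $P^n$ is defined by $$P^n|_\circ=(\mathbf M_\Omega)_{\circ\circ}^{-1}R_\circ(\Phi^n),$$ $$P^n|_\Gamma=\mathbf S^{-1}\Big(-m(\mathbf L_\Omega)_{\Gamma\circ}(\mathbf M_\Omega)_{\circ\circ}^{-1}R_\circ(\Phi^n)+m_\Gamma(\mathbf M_\Omega)_{\Gamma\Gamma}\mathbf M_\Gamma^{-1}\mathbf L_\Gamma\mathbf M_\Gamma^{-1}R_\Gamma(\Phi^n)\Big).$$ *)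

theory Defs
  imports
    "HOL-Analysis.Analysis"
    "Jordan_Normal_Form.Gauss_Jordan_Elimination"
begin

hide_const (open) Finite_Cartesian_Product.vec Finite_Cartesian_Product.mat Matrix.orthogonal
no_notation Matrix.scalar_prod  (infix \<open>\<bullet>\<close> 70)
no_notation Matrix.vec_index (infixl \<open>$\<close> 100)


section \<open>Meshes\<close>

text \<open>A mesh is the set of its open cells; an open \<open>k\<close>-simplex is the relative interior of a
  closed one.\<close>

definition simplicial_partition :: "int \<Rightarrow> 'a::euclidean_space set set \<Rightarrow> 'a set \<Rightarrow> bool" where
  "simplicial_partition k \<T> D \<longleftrightarrow>
     finite \<T> \<and> (\<forall>K\<in>\<T>. \<exists>S. k simplex S \<and> K = rel_interior S) \<and>
     pairwise disjnt \<T> \<and> D = (\<Union>K\<in>\<T>. closure K)"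

definition conforming :: "'a::euclidean_space set set \<Rightarrow> bool" where
  "conforming \<T> \<longleftrightarrow>
     (\<forall>K\<in>\<T>. \<forall>L\<in>\<T>. closure K \<inter> closure L face_of closure K \<and>
                   closure K \<inter> closure L face_of closure L)"

text \<open>Quasiuniformity (shape regularity included): the inradius of every cell is bounded below by a
  fixed multiple of the largest cell diameter of the same mesh. The comparison is with the actual
  diameters and not with \<open>h\<close>, which is only an upper bound for them and ranges over all positive
  reals. Balls are taken inside the affine hull of the cell, so that the definition also covers
  meshes of a boundary.\<close>

definition quasiuniform :: "(real \<Rightarrow> 'a::euclidean_space set set) \<Rightarrow> bool" where
  "quasiuniform \<T> \<longleftrightarrow>
     (\<exists>\<rho>>0. \<forall>h>0. \<forall>K\<in>\<T> h. \<forall>K'\<in>\<T> h. \<exists>c\<in>K. ball c (\<rho> * diameter K') \<inter> affine hull K \<subseteq> K)"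


section \<open>Continuous piecewise linear finite elements\<close>

definition mesh_vertices :: "'a::euclidean_space set set \<Rightarrow> 'a set" where
  "mesh_vertices \<T> = {p. \<exists>K\<in>\<T>. p extreme_point_of closure K}"

text \<open>A function on the meshed set is represented by its extension by zero. The dimension of the
  space is the number of vertices of the mesh.\<close>

definition P1 :: "'a::euclidean_space set set \<Rightarrow> ('a \<Rightarrow> real) set" where
  "P1 \<T> = {v. continuous_on (\<Union>K\<in>\<T>. closure K) v \<and>
               (\<forall>K\<in>\<T>. \<exists>a b. \<forall>x\<in>K. v x = a \<bullet> x + b) \<and>
               (\<forall>x. x \<notin> (\<Union>K\<in>\<T>. closure K) \<longrightarrow> v x = 0)}"

definition nodal_basis :: "'a::euclidean_space set set \<Rightarrow> 'a \<Rightarrow> 'a \<Rightarrow> real" where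
  "nodal_basis \<T> p =
     (THE v. v \<in> P1 \<T> \<and> (\<forall>q\<in>mesh_vertices \<T>. v q = (if q = p then 1 else 0)))"

definition interpolant :: "'a::euclidean_space set set \<Rightarrow> ('a \<Rightarrow> real) \<Rightarrow> 'a \<Rightarrow> real" where
  "interpolant \<T> f = (\<lambda>x. \<Sum>p\<in>mesh_vertices \<T>. f p * nodal_basis \<T> p x)"


section \<open>Integration and differentiation on a polyhedral boundary\<close>

text \<open>The Lebesgue measure of the affine hull of \<open>S\<close>, as a (complete) measure on the ambient space:
  the image of the product Lebesgue measure under an isometric parametrization
  \<open>t \<mapsto> a + (\<Sum>b\<in>B. t b *\<^sub>R b)\<close> with \<open>B\<close> orthonormal. The result does not depend on the
  choice of \<open>a\<close> and \<open>B\<close>; for \<open>S = UNIV\<close> it is \<^term>\<open>lebesgue\<close>.\<close>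

definition flat_lebesgue :: "'a::euclidean_space set \<Rightarrow> 'a measure" where
  "flat_lebesgue S =
     (let (a, B) = (SOME (a, B). pairwise orthogonal B \<and> (\<forall>b\<in>B. norm b = 1) \<and>
                                 affine hull S = (\<lambda>y. a + y) ` span B)
      in completion
           (distr (\<Pi>\<^sub>M b\<in>B. (lborel :: real measure)) borel (\<lambda>t. a + (\<Sum>b\<in>B. t b *\<^sub>R b))))"

text \<open>The surface integral over the boundary of a convex polytope; distinct facets overlap in null
  sets only.\<close>

definition boundary_integral :: "'a::euclidean_space set \<Rightarrow> ('a \<Rightarrow> real) \<Rightarrow> real" where
  "boundary_integral \<Omega> f = (\<Sum>F | F facet_of closure \<Omega>. LINT x:F|flat_lebesgue F. f x)"

text \<open>The gradients of finite element functions exist almost everywhere only; on the remaining null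
  set the values below are irrelevant.\<close>

definition grad :: "('a::euclidean_space \<Rightarrow> real) \<Rightarrow> 'a \<Rightarrow> 'a" where
  "grad v x = (THE g. GDERIV v x :> g)"

text \<open>Away from the relative boundaries of the facets, the surface gradient is the tangential vector
  representing the derivative along the boundary.\<close>

definition surface_grad :: "'a::euclidean_space set \<Rightarrow> ('a \<Rightarrow> real) \<Rightarrow> 'a \<Rightarrow> 'a" where
  "surface_grad \<Omega> v x =
     (THE g. \<exists>F. F facet_of closure \<Omega> \<and> x \<in> rel_interior F \<and>
                 g \<in> span {y - z | y z. y \<in> F \<and> z \<in> F} \<and>
                 (v has_derivative (\<lambda>k. k \<bullet> g)) (at x within frontier \<Omega>))"


section \<open>Lumped mass and stiffness matrices\<close>

text \<open>The vertices of the mesh are numbered by \<open>p 0, p 1, \<dots>\<close>.\<close>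

definition bulk_mass ::
  "'a::euclidean_space set \<Rightarrow> 'a set set \<Rightarrow> (nat \<Rightarrow> 'a) \<Rightarrow> real mat" where
  "bulk_mass \<Omega> \<T> p =
     (let n = card (mesh_vertices \<T>); \<phi> = (\<lambda>i. nodal_basis \<T> (p i)) in
      mat n n (\<lambda>(i, j). LINT x:\<Omega>|lebesgue. interpolant \<T> (\<lambda>y. \<phi> j y * \<phi> i y) x))"

definition bulk_stiffness ::
  "'a::euclidean_space set \<Rightarrow> 'a set set \<Rightarrow> (nat \<Rightarrow> 'a) \<Rightarrow> real mat" where
  "bulk_stiffness \<Omega> \<T> p =
     (let n = card (mesh_vertices \<T>); \<phi> = (\<lambda>i. nodal_basis \<T> (p i)) in
      mat n n (\<lambda>(i, j). LINT x:\<Omega>|lebesgue. grad (\<phi> j) x \<bullet> grad (\<phi> i) x))"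

definition surface_mass ::
  "'a::euclidean_space set \<Rightarrow> 'a set set \<Rightarrow> (nat \<Rightarrow> 'a) \<Rightarrow> real mat" where
  "surface_mass \<Omega> \<T> p =
     (let n = card (mesh_vertices \<T>); \<phi> = (\<lambda>i. nodal_basis \<T> (p i)) in
      mat n n (\<lambda>(i, j). boundary_integral \<Omega> (interpolant \<T> (\<lambda>y. \<phi> j y * \<phi> i y))))"

definition surface_stiffness ::
  "'a::euclidean_space set \<Rightarrow> 'a set set \<Rightarrow> (nat \<Rightarrow> 'a) \<Rightarrow> real mat" where
  "surface_stiffness \<Omega> \<T> p =
     (let n = card (mesh_vertices \<T>); \<phi> = (\<lambda>i. nodal_basis \<T> (p i)) in
      mat n n (\<lambda>(i, j). boundary_integral \<Omega>
        (\<lambda>x. surface_grad \<Omega> (\<phi> j) x \<bullet> surface_grad \<Omega> (\<phi> i) x)))"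


section \<open>The discrete scheme\<close>

text \<open>Only ever applied to invertible matrices, where \<^term>\<open>mat_inverse A\<close> is not \<open>None\<close>.\<close>

abbreviation minv :: "real mat \<Rightarrow> real mat" where
  "minv A \<equiv> the (mat_inverse A)"

text \<open>Rows \<open>r\<^sub>1, \<dots>, r\<^sub>2 - 1\<close> and columns \<open>c\<^sub>1, \<dots>, c\<^sub>2 - 1\<close> of a matrix.\<close>

definition block :: "'b mat \<Rightarrow> nat \<Rightarrow> nat \<Rightarrow> nat \<Rightarrow> nat \<Rightarrow> 'b mat" where
  "block A r\<^sub>1 r\<^sub>2 c\<^sub>1 c\<^sub>2 = mat (r\<^sub>2 - r\<^sub>1) (c\<^sub>2 - c\<^sub>1) (\<lambda>(i, j). A $$ (r\<^sub>1 + i, c\<^sub>1 + j))"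

text \<open>In the following, \<open>L\<close>, \<open>M\<close> are the bulk matrices, of size \<open>n\<close>, and \<open>L\<^sub>\<Gamma>\<close>, \<open>M\<^sub>\<Gamma>\<close> the surface
  matrices, of size \<open>n\<^sub>\<Gamma> \<le> n\<close>. The first \<open>n\<^sub>\<Gamma>\<close> bulk indices are those of the boundary vertices.\<close>

definition R_boundary ::
  "real mat \<Rightarrow> real mat \<Rightarrow> real mat \<Rightarrow> real mat \<Rightarrow> real \<Rightarrow>
   (real \<Rightarrow> real) \<Rightarrow> (real \<Rightarrow> real) \<Rightarrow> (real \<Rightarrow> real) \<Rightarrow> (real \<Rightarrow> real) \<Rightarrow>
   real Matrix.vec \<Rightarrow> real Matrix.vec \<Rightarrow> real Matrix.vec" where
  "R_boundary L M L\<^sub>\<Gamma> M\<^sub>\<Gamma> \<kappa> Fp Fm Gp Gm \<Phi>old \<Phi> =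
     (let n = dim_row M; n\<^sub>\<Gamma> = dim_row M\<^sub>\<Gamma> in
      block L 0 n\<^sub>\<Gamma> 0 n *\<^sub>v \<Phi>
      + block M 0 n\<^sub>\<Gamma> 0 n *\<^sub>v (map_vec (deriv Fp) \<Phi> + map_vec (deriv Fm) \<Phi>old)
      + \<kappa> \<cdot>\<^sub>v (L\<^sub>\<Gamma> *\<^sub>v vec_first \<Phi> n\<^sub>\<Gamma>)
      + M\<^sub>\<Gamma> *\<^sub>v (map_vec (deriv Gp) (vec_first \<Phi> n\<^sub>\<Gamma>) + map_vec (deriv Gm) (vec_first \<Phi>old n\<^sub>\<Gamma>)))"

definition R_interior ::
  "real mat \<Rightarrow> real mat \<Rightarrow> nat \<Rightarrow> (real \<Rightarrow> real) \<Rightarrow> (real \<Rightarrow> real) \<Rightarrow>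
   real Matrix.vec \<Rightarrow> real Matrix.vec \<Rightarrow> real Matrix.vec" where
  "R_interior L M n\<^sub>\<Gamma> Fp Fm \<Phi>old \<Phi> =
     (let n = dim_row M in
      block L n\<^sub>\<Gamma> n 0 n *\<^sub>v \<Phi>
      + block M n\<^sub>\<Gamma> n 0 n *\<^sub>v (map_vec (deriv Fp) \<Phi> + map_vec (deriv Fm) \<Phi>old))"

definition S_matrix ::
  "real mat \<Rightarrow> real mat \<Rightarrow> real mat \<Rightarrow> real mat \<Rightarrow> real \<Rightarrow> real \<Rightarrow> real mat" where
  "S_matrix L M L\<^sub>\<Gamma> M\<^sub>\<Gamma> m m\<^sub>\<Gamma> =
     (let n\<^sub>\<Gamma> = dim_row M\<^sub>\<Gamma>; M\<^sub>\<Gamma>\<^sub>\<Gamma> = block M 0 n\<^sub>\<Gamma> 0 n\<^sub>\<Gamma> in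
      m \<cdot>\<^sub>m block L 0 n\<^sub>\<Gamma> 0 n\<^sub>\<Gamma> + m\<^sub>\<Gamma> \<cdot>\<^sub>m (M\<^sub>\<Gamma>\<^sub>\<Gamma> * minv M\<^sub>\<Gamma> * L\<^sub>\<Gamma> * minv M\<^sub>\<Gamma> * M\<^sub>\<Gamma>\<^sub>\<Gamma>))"

definition P_vector ::
  "real mat \<Rightarrow> real mat \<Rightarrow> real mat \<Rightarrow> real mat \<Rightarrow> real \<Rightarrow> real \<Rightarrow> real \<Rightarrow>
   (real \<Rightarrow> real) \<Rightarrow> (real \<Rightarrow> real) \<Rightarrow> (real \<Rightarrow> real) \<Rightarrow> (real \<Rightarrow> real) \<Rightarrow>
   real Matrix.vec \<Rightarrow> real Matrix.vec \<Rightarrow> real Matrix.vec" where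
  "P_vector L M L\<^sub>\<Gamma> M\<^sub>\<Gamma> m m\<^sub>\<Gamma> \<kappa> Fp Fm Gp Gm \<Phi>old \<Phi> =
     (let n = dim_row M; n\<^sub>\<Gamma> = dim_row M\<^sub>\<Gamma>;
          M\<^sub>\<Gamma>\<^sub>\<Gamma> = block M 0 n\<^sub>\<Gamma> 0 n\<^sub>\<Gamma>;
          P\<^sub>i = minv (block M n\<^sub>\<Gamma> n n\<^sub>\<Gamma> n) *\<^sub>v R_interior L M n\<^sub>\<Gamma> Fp Fm \<Phi>old \<Phi>;
          P\<^sub>\<Gamma> = minv (S_matrix L M L\<^sub>\<Gamma> M\<^sub>\<Gamma> m m\<^sub>\<Gamma>) *\<^sub>v
                 (- (m \<cdot>\<^sub>v (block L 0 n\<^sub>\<Gamma> n\<^sub>\<Gamma> n *\<^sub>v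
                      (minv (block M n\<^sub>\<Gamma> n n\<^sub>\<Gamma> n) *\<^sub>v R_interior L M n\<^sub>\<Gamma> Fp Fm \<Phi>old \<Phi>)))
                  + m\<^sub>\<Gamma> \<cdot>\<^sub>v ((M\<^sub>\<Gamma>\<^sub>\<Gamma> * minv M\<^sub>\<Gamma> * L\<^sub>\<Gamma> * minv M\<^sub>\<Gamma>) *\<^sub>v
                      R_boundary L M L\<^sub>\<Gamma> M\<^sub>\<Gamma> \<kappa> Fp Fm Gp Gm \<Phi>old \<Phi>))
      in P\<^sub>\<Gamma> @\<^sub>v P\<^sub>i)"

end

theory Submission
  imports Defs "Jordan_Normal_Form.Determinant"
begin

text \<open>Write \<open>E\<close> for the energy whose gradient is \<open>R\<close>, that is, \<open>R\<^sub>\<Gamma>\<close> on the boundary vertices and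
  \<open>R\<^sub>\<circ>\<close> on the interior ones. The potential \<open>P\<close> depends linearly on \<open>R\<close>, and the map
  \<open>q : R \<mapsto> \<tau> m M\<^sup>-\<^sup>1 L P\<close> turns out to be symmetric and positive semidefinite: with the boundary
  potential \<open>\<theta> = M\<^sub>\<Gamma>\<^sup>-\<^sup>1 (R - M P)\<close>, the definition of \<open>P\<close> on \<open>\<Gamma>\<close> says exactly that \<open>m L P\<close> and
  \<open>m\<^sub>\<Gamma> M M\<^sub>\<Gamma>\<^sup>-\<^sup>1 L\<^sub>\<Gamma> \<theta>\<close> agree there, so that \<open>R \<bullet> q R = \<tau> (m P \<bullet> L P + m\<^sub>\<Gamma> \<theta> \<bullet> L\<^sub>\<Gamma> \<theta>)\<close>. The scheme is
  thus an equation \<open>x + q (\<nabla>E x) = b\<close>, and \<open>x = b - q z\<close> solves it when \<open>z\<close> minimizes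
  \<open>z \<bullet> q z / 2 + E (b - q z)\<close>; a minimizer exists because \<open>F\<^sub>+, G\<^sub>+ \<ge> 0\<close> bound \<open>E\<close> from below by a
  linear function.

  The inverses in the scheme are genuine: the hat functions are nonnegative, so the lumped masses
  are positive, and \<open>S\<close> is positive definite because the trace condition in (S2) makes every boundary
  cell a proper face of its bulk cell, so that there is an interior vertex, while a finite element
  function with zero gradient is constant.\<close>

(* Merging Defs with the second import makes visible again what Defs hides. *)
hide_const (open) Finite_Cartesian_Product.vec Finite_Cartesian_Product.mat Matrix.orthogonal
no_notation Matrix.scalar_prod (infix \<open>\<bullet>\<close> 70)
no_notation Matrix.vec_index (infixl \<open>$\<close> 100)

section \<open>Minimization\<close>

text \<open>The obstacle is that \<open>q\<close> is singular: it vanishes on those \<open>R\<close>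
  for which \<open>P\<close> and the boundary potential are constant. So the energy cannot be
  balanced against an inverse of \<open>q\<close>, which is why the unknown of the minimization is
  \<open>z\<close> and not \<open>x\<close>; at the minimizer \<open>z\<close> agrees with the
  gradient of \<open>E\<close> at \<open>x\<close> only up to the kernel of \<open>q\<close>. The
  functional is invariant under that kernel, so minimizing over its orthogonal complement loses
  nothing. There the quadratic part is coercive and beats any linear lower bound of
  \<open>E\<close>. By symmetry the complement contains the range of \<open>q\<close>, and that
  range supplies the only variation needed to read off the equation. The concave parts enter
  \<open>E\<close> linearly, because their derivatives are frozen at the old time step; this is
  where the linear lower bound comes from. On the finite element side everything aims at one fact:
  both stiffness matrices are Gram matrices of cellwise constant gradients. Gradients are definite
  descriptions with no control on cell boundaries, so completeness of the measures and nullity of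
  these boundaries carry the argument.\<close>

lemma compact_coordinate_box:
  "compact {z :: nat \<Rightarrow> real. (\<forall>i<n. \<bar>z i\<bar> \<le> s) \<and> (\<forall>i\<ge>n. z i = 0)}"
proof -
  \<comment> \<open>The coordinates from \<open>n\<close> on are pinned to a single point, so that
    the box is a full product of compact sets and Tychonoff's theorem applies.\<close>
  define S :: "nat \<Rightarrow> real set" where "S = (\<lambda>i. if i < n then {-s..s} else {0})"
  have "compactin (product_topology (\<lambda>i. euclidean) UNIV) (Pi\<^sub>E UNIV S)"
    by (subst compactin_PiE) (auto simp: S_def)
  then have "compact (Pi\<^sub>E UNIV S)"
    by (simp add: euclidean_product_topology)
  moreover have "Pi\<^sub>E UNIV S = {z. (\<forall>i<n. \<bar>z i\<bar> \<le> s) \<and> (\<forall>i\<ge>n. z i = 0)}"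
  proof -
    have "z i \<in> S i \<longleftrightarrow> (i < n \<longrightarrow> \<bar>z i\<bar> \<le> s) \<and> (n \<le> i \<longrightarrow> z i = 0)" for z i
      by (auto simp: S_def)
    then show ?thesis by (auto simp: PiE_UNIV_domain Pi_iff)
  qed
  ultimately show ?thesis by simp
qed

text \<open>Vectors are functions on all of \<open>nat\<close> of which the first \<open>n\<close>
  values count; this gives them a topology without a dimension in the type. \<open>R\<close> is the
  gradient of \<open>E\<close>, required only through derivatives along lines, which is all that a
  first-order condition at a minimizer uses.\<close>

lemma psd_gradient_equation_solvable:
  fixes E :: "(nat \<Rightarrow> real) \<Rightarrow> real" and q :: "(nat \<Rightarrow> real) \<Rightarrow> nat \<Rightarrow> real"
    and R :: "(nat \<Rightarrow> real) \<Rightarrow> nat \<Rightarrow> real" and b l :: "nat \<Rightarrow> real"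
  assumes q_lin: "\<And>x y s i. q (\<lambda>j. x j + s * y j) i = q x i + s * q y i"
    and q_cont: "\<And>i. continuous_on UNIV (\<lambda>x. q x i)"
    and q_sym: "\<And>x y. (\<Sum>i<n. x i * q y i) = (\<Sum>i<n. y i * q x i)"
    and q_psd: "\<And>x. 0 \<le> (\<Sum>i<n. x i * q x i)"
    and q_supp: "\<And>x i. n \<le> i \<Longrightarrow> q x i = 0"
    and E_cont: "continuous_on UNIV E"
    and E_below: "\<And>x. c + (\<Sum>i<n. l i * x i) \<le> E x"
    and E_deriv: "\<And>x y. ((\<lambda>t. E (\<lambda>i. x i + t * y i)) has_field_derivative (\<Sum>i<n. R x i * y i)) (at 0)"
  shows "\<exists>x. \<forall>i<n. x i + q (R x) i = b i"
proof -
  define ip where "ip x y = (\<Sum>i<n. x i * y i)" for x y :: "nat \<Rightarrow> real"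
  have ip_add: "ip (\<lambda>j. x j + s * y j) z = ip x z + s * ip y z"
    and ip_add': "ip z (\<lambda>j. x j + s * y j) = ip z x + s * ip z y" for x y z s
    by (simp_all add: ip_def sum.distrib sum_distrib_left algebra_simps)
  have ip_commute: "ip x y = ip y x" for x y
    by (simp add: ip_def mult.commute)
  have ip_nonneg: "0 \<le> ip x x" for x
    by (simp add: ip_def sum_nonneg)
  have ip_zero: "x i = 0" if "ip x x = 0" "i < n" for x i
  proof -
    have "\<forall>i\<in>{..<n}. x i * x i = 0"
      using that(1) unfolding ip_def by (subst (asm) sum_nonneg_eq_0_iff) auto
    then show ?thesis using that(2) by simp
  qed
  have sym: "ip x (q y) = ip y (q x)" for x y
    unfolding ip_def by (rule q_sym)
  have psd: "0 \<le> ip x (q x)" for x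
    unfolding ip_def by (rule q_psd)
  have q_fun: "q (\<lambda>j. x j + s * y j) = (\<lambda>i. q x i + s * q y i)" for x y s
    using q_lin by blast
  have expand: "ip (\<lambda>j. x j + s * y j) (q (\<lambda>j. x j + s * y j))
      = ip x (q x) + 2 * s * ip y (q x) + s\<^sup>2 * ip y (q y)" for x y s
    using sym[of x y] by (simp add: q_fun ip_add ip_add' power2_eq_square algebra_simps)
  \<comment> \<open>Perturbing \<open>x\<close> along \<open>q x\<close>, the form has no constant
    term and linear coefficient \<open>2 * A\<close>, where \<open>A\<close> is the squared norm of
    \<open>q x\<close>. It would become negative for small negative \<open>s\<close> unless
    \<open>A = 0\<close>.\<close>
  have ker: "q x i = 0" if "ip x (q x) = 0" "i < n" for x i
  proof -
    define A B where "A = ip (q x) (q x)" and "B = ip (q x) (q (q x))"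
    have *: "0 \<le> 2 * s * A + s\<^sup>2 * B" for s
      using psd[of "\<lambda>j. x j + s * q x j"] unfolding expand that(1) A_def B_def by simp
    have "0 \<le> A" "0 \<le> B" by (auto simp: A_def B_def ip_nonneg psd)
    have "A = 0"
    proof (rule ccontr)
      assume "A \<noteq> 0"
      then have "A > 0" using \<open>0 \<le> A\<close> by simp
      \<comment> \<open>With \<open>A = u * (B + 1)\<close> the perturbed form at \<open>- u\<close>
        is exactly minus \<open>u\<^sup>2 * (B + 2)\<close>; the added 1 covers
        \<open>B = 0\<close>.\<close>
      define u where "u = A / (B + 1)"
      have "u > 0" "A = u * (B + 1)" using \<open>A > 0\<close> \<open>0 \<le> B\<close> by (auto simp: u_def)
      then have "2 * (- u) * A + (- u)\<^sup>2 * B = - (u\<^sup>2 * (B + 2))"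
        by (simp add: power2_eq_square algebra_simps)
      also have "\<dots> < 0" using \<open>0 \<le> B\<close> \<open>u > 0\<close> by simp
      finally show False using *[of "- u"] by linarith
    qed
    then show ?thesis using ip_zero that(2) by (auto simp: A_def)
  qed
  have ip_cont: "continuous_on UNIV (\<lambda>z. ip (f z) (g z))"
    if "\<And>i. continuous_on UNIV (\<lambda>z. f z i)" "\<And>i. continuous_on UNIV (\<lambda>z. g z i)"
    for f g :: "(nat \<Rightarrow> real) \<Rightarrow> nat \<Rightarrow> real"
    unfolding ip_def by (intro continuous_intros that)
  have coord_cont: "continuous_on UNIV (\<lambda>z::nat \<Rightarrow> real. z i)" for i
    by simp
  define box where "box s = {z :: nat \<Rightarrow> real. (\<forall>i<n. \<bar>z i\<bar> \<le> s) \<and> (\<forall>i\<ge>n. z i = 0)}" for s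
  have box: "compact (box s)" for s
    unfolding box_def by (rule compact_coordinate_box)
  \<comment> \<open>The orthogonal complement of the kernel of \<open>q\<close>, on which the functional is coercive.\<close>
  define X where "X = {z. (\<forall>i\<ge>n. z i = 0) \<and> (\<forall>k. (\<forall>i<n. q k i = 0) \<longrightarrow> ip z k = 0)}"
  have X_closed: "closed X"
    unfolding X_def
    by (intro closed_Collect_conj closed_Collect_all closed_Collect_imp open_Collect_const
        closed_Collect_eq ip_cont continuous_on_const coord_cont)
  have X_add: "(\<lambda>j. x j + s * y j) \<in> X" if "x \<in> X" "y \<in> X" for x y s
    using that by (auto simp: X_def ip_add)
  have X_zero: "(\<lambda>j. 0) \<in> X"
    by (auto simp: X_def ip_def)
  \<comment> \<open>Moving \<open>q\<close> to the other factor by symmetry lets it act on the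
    kernel element.\<close>
  have X_range: "q x \<in> X" for x
  proof -
    have "ip (q x) k = 0" if "\<forall>i<n. q k i = 0" for k
      using that ip_commute[of "q x" k] sym[of k x] by (simp add: ip_def[of x])
    then show ?thesis using q_supp by (auto simp: X_def)
  qed
  \<comment> \<open>The coercivity constant is the minimum of the form on the unit sphere of
    \<open>X\<close>, attained by compactness. It is positive because a zero of the form lies in the
    kernel and would then be orthogonal to itself. If \<open>X\<close> is trivial, the sphere is
    empty and any constant serves.\<close>
  obtain c0 where c0: "c0 > 0" "\<And>z. z \<in> X \<Longrightarrow> c0 * ip z z \<le> ip z (q z)"
  proof -
    define Sp where "Sp = X \<inter> {z. ip z z = 1} \<inter> box 1"
    have Sp_box: "z \<in> Sp" if "z \<in> X" "ip z z = 1" for z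
    proof -
      have "\<bar>z i\<bar> \<le> 1" if "i < n" for i
      proof -
        have "z i * z i \<le> ip z z" unfolding ip_def
          by (rule member_le_sum) (use that in auto)
        then have "(z i)\<^sup>2 \<le> 1" using \<open>ip z z = 1\<close> by (simp add: power2_eq_square)
        then show ?thesis by (simp add: abs_square_le_1)
      qed
      then show ?thesis using that by (auto simp: Sp_def box_def X_def)
    qed
    have "compact Sp"
      unfolding Sp_def
      by (intro closed_Int_compact closed_Int X_closed box closed_Collect_eq ip_cont continuous_on_const coord_cont)
    have scale: "c1 * ip z z \<le> ip z (q z)" if c1: "\<And>z. z \<in> Sp \<Longrightarrow> c1 \<le> ip z (q z)" and "z \<in> X" for c1 z
    proof (cases "ip z z = 0")
      case True
      then show ?thesis using psd by simp
    next
      case False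
      define s where "s = 1 / sqrt (ip z z)"
      have s2: "s\<^sup>2 * ip z z = 1"
        using False ip_nonneg[of z] by (simp add: s_def power_divide)
      \<comment> \<open>The leading 0 puts the scaled vector into the shape of \<open>X_add\<close>
        and \<open>expand\<close>, with the origin as base point.\<close>
      let ?w = "\<lambda>j. 0 + s * z j"
      have q0: "q (\<lambda>j. 0) = (\<lambda>i. 0)"
        using q_fun[of "\<lambda>j. 0" 1 "\<lambda>j. 0"] by (auto simp: fun_eq_iff)
      have "?w \<in> X" by (rule X_add[OF X_zero that(2)])
      moreover have "ip ?w ?w = s\<^sup>2 * ip z z"
        by (simp add: ip_def sum_distrib_left power2_eq_square algebra_simps)
      ultimately have "c1 \<le> ip ?w (q ?w)" using s2 by (intro c1 Sp_box) auto
      also have "\<dots> = s\<^sup>2 * ip z (q z)"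
        unfolding expand by (simp add: q0) (simp add: ip_def)
      finally have "c1 * ip z z \<le> s\<^sup>2 * ip z (q z) * ip z z"
        using ip_nonneg[of z] by (rule mult_right_mono)
      also have "\<dots> = ip z (q z)" using s2 by (metis mult.commute mult.left_commute mult_1)
      finally show ?thesis .
    qed
    show thesis
    proof (cases "Sp = {}")
      case True
      then show thesis using scale[of 1] that[of 1] by auto
    next
      case False
      have "continuous_on Sp (\<lambda>z. ip z (q z))"
        by (rule continuous_on_subset[OF ip_cont[OF coord_cont q_cont] subset_UNIV])
      then obtain z0 where z0: "z0 \<in> Sp" "\<And>z. z \<in> Sp \<Longrightarrow> ip z0 (q z0) \<le> ip z (q z)"
        using continuous_attains_inf[OF \<open>compact Sp\<close> False] by blast
      have "ip z0 (q z0) \<noteq> 0"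
      proof
        assume "ip z0 (q z0) = 0"
        then have "\<forall>i<n. q z0 i = 0" using ker by blast
        then have "ip z0 z0 = 0" using z0(1) by (auto simp: Sp_def X_def)
        then show False using z0(1) by (simp add: Sp_def)
      qed
      then have "ip z0 (q z0) > 0" using psd[of z0] by simp
      then show thesis using scale[OF z0(2)] that by blast
    qed
  qed
  define g where "g z = ip z (q z) / 2 + E (\<lambda>i. b i - q z i)" for z
  have g_cont: "continuous_on UNIV g"
  proof -
    have "continuous_on UNIV (\<lambda>z. E (\<lambda>i. b i - q z i))"
      by (rule continuous_on_compose2[OF E_cont])
        (auto intro!: continuous_on_coordinatewise_then_product continuous_intros q_cont)
    then show ?thesis unfolding g_def
      by (intro continuous_intros ip_cont q_cont coord_cont) auto
  qed
  \<comment> \<open>What remains after Young's inequality: the term \<open>ip l (q z)\<close>, equal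
    to \<open>ip z (q l)\<close> by symmetry, uses up half of the coercive term
    \<open>c0 / 2 * ip z z\<close>.\<close>
  define K where "K = ip (q l) (q l) / c0 - c - ip l b"
  have g_below: "c0 / 4 * ip z z - K \<le> g z" if "z \<in> X" for z
  proof -
    have "ip z (q l) \<le> c0 / 4 * ip z z + ip (q l) (q l) / c0"
    proof -
      have "x * y \<le> c0 / 4 * (x * x) + y * y / c0" for x y
      proof -
        have "0 \<le> (c0 * x / 2 - y)\<^sup>2 / c0" using c0 by simp
        also have "\<dots> = c0 / 4 * (x * x) + y * y / c0 - x * y"
          using c0 by (simp add: field_simps power2_eq_square)
        finally show ?thesis by simp
      qed
      then show ?thesis
        unfolding ip_def sum_distrib_left sum_divide_distrib sum.distrib[symmetric]
        by (intro sum_mono) blast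
    qed
    moreover have "c + (ip l b - ip l (q z)) \<le> E (\<lambda>i. b i - q z i)"
      using E_below[of "\<lambda>i. b i - q z i"]
      by (simp add: ip_def algebra_simps sum_subtractf)
    moreover have "ip l (q z) = ip z (q l)" by (rule sym)
    ultimately show ?thesis using c0(2)[OF that] by (simp add: g_def K_def)
  qed
  \<comment> \<open>Outside the box some coordinate exceeds \<open>s \<ge> 1\<close>, so
    \<open>ip y y\<close> exceeds \<open>s\<close>, and \<open>g_below\<close> then puts
    \<open>g y\<close> above the value of \<open>g\<close> at the origin. The minimizer over the box
    is therefore global on \<open>X\<close>.\<close>
  define s where "s = 1 + 4 * \<bar>K + g (\<lambda>j. 0)\<bar> / c0"
  have "s \<ge> 1" using c0 by (simp add: s_def)
  obtain z where z: "z \<in> X" "\<And>y. y \<in> X \<Longrightarrow> g z \<le> g y"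
  proof -
    have cpt: "compact (X \<inter> box s)" by (intro closed_Int_compact X_closed box)
    have zero: "(\<lambda>j. 0) \<in> X \<inter> box s" using X_zero \<open>s \<ge> 1\<close> by (auto simp: box_def)
    then obtain z where z: "z \<in> X \<inter> box s" "\<And>y. y \<in> X \<inter> box s \<Longrightarrow> g z \<le> g y"
      using continuous_attains_inf[OF cpt _ continuous_on_subset[OF g_cont]] by blast
    have "g z \<le> g y" if y: "y \<in> X" for y
    proof (cases "y \<in> box s")
      case True
      then show ?thesis using z y by blast
    next
      case False
      then obtain i where i: "i < n" "\<bar>y i\<bar> > s" using y by (auto simp: box_def X_def not_le)
      have "s * 1 \<le> \<bar>y i\<bar> * \<bar>y i\<bar>" using i \<open>s \<ge> 1\<close> by (intro mult_mono) auto
      also have "\<dots> = y i * y i" by simp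
      also have "\<dots> \<le> ip y y" unfolding ip_def
        by (rule member_le_sum) (use i in auto)
      finally have "c0 / 4 * s \<le> c0 / 4 * ip y y" using c0 by simp
      then have "c0 / 4 * s - K \<le> g y" using g_below[OF y] by linarith
      moreover have "c0 / 4 * s = c0 / 4 + \<bar>K + g (\<lambda>j. 0)\<bar>"
        using c0 by (simp add: s_def field_simps)
      moreover have "g z \<le> g (\<lambda>j. 0)" using z(2) zero by blast
      ultimately show ?thesis using c0 by linarith
    qed
    then show thesis using that z by blast
  qed
  define x where "x = (\<lambda>i. b i - q z i)"
  \<comment> \<open>The direction is the residual of the wanted identity
    \<open>q z = q (R x)\<close>. It belongs to the range of \<open>q\<close>, hence to
    \<open>X\<close>, and the derivative of \<open>g\<close> at \<open>z\<close> along it is its own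
    squared norm; stationarity makes it vanish.\<close>
  define e where "e = q (\<lambda>j. z j + (- 1) * R x j)"
  have e_eq: "e = (\<lambda>i. q z i + (- 1) * q (R x) i)"
    unfolding e_def by (rule q_fun)
  have "e \<in> X" by (simp add: e_def X_range)
  have "((\<lambda>t. ip z (q z) / 2 + t * ip e (q z) + t\<^sup>2 * (ip e (q e) / 2))
      has_field_derivative ip e (q z)) (at 0)"
    by (auto intro!: derivative_eq_intros)
  from DERIV_add[OF this E_deriv[of x "\<lambda>i. - q e i"]]
  have "((\<lambda>t. ip z (q z) / 2 + t * ip e (q z) + t\<^sup>2 * (ip e (q e) / 2)
          + E (\<lambda>i. x i + t * (- q e i))) has_field_derivative
      ip e (q z) + (\<Sum>i<n. R x i * (- q e i))) (at 0)" .
  moreover have "(\<lambda>t. ip z (q z) / 2 + t * ip e (q z) + t\<^sup>2 * (ip e (q e) / 2)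
          + E (\<lambda>i. x i + t * (- q e i))) = (\<lambda>t. g (\<lambda>j. z j + t * e j))"
    unfolding g_def expand by (simp add: q_fun x_def add_divide_distrib algebra_simps)
  ultimately have "((\<lambda>t. g (\<lambda>j. z j + t * e j)) has_field_derivative
      ip e (q z) + (\<Sum>i<n. R x i * (- q e i))) (at 0)" by simp
  then have "ip e (q z) + (\<Sum>i<n. R x i * (- q e i)) = 0"
    by (rule DERIV_local_min[where d = 1]) (use z X_add \<open>e \<in> X\<close> in auto)
  moreover have "(\<Sum>i<n. R x i * (- q e i)) = - ip e (q (R x))"
    using sym[of "R x" e] by (simp add: ip_def sum_negf)
  moreover have "ip e e = ip e (q z) + (- 1) * ip e (q (R x))"
    by (subst (2) e_eq) (rule ip_add')
  ultimately have "ip e e = 0" by simp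
  then have "\<forall>i<n. q z i = q (R x) i"
    using ip_zero[of e] by (auto simp: e_eq)
  then show ?thesis by (auto simp: x_def intro!: exI[of _ x])
qed


section \<open>Nodal bases on simplicial meshes\<close>

text \<open>Differences from one point of an affinely independent set are linearly independent, so
  increments of \<open>f\<close> extend to a linear functional; \<open>adjoint g 1\<close> is the
  vector representing it.\<close>

lemma affine_interpolation:
  fixes C :: "'a::euclidean_space set" and f :: "'a \<Rightarrow> real"
  assumes "\<not> affine_dependent C"
  obtains a b where "\<And>c. c \<in> C \<Longrightarrow> a \<bullet> c + b = f c"
proof (cases "C = {}")
  case True
  then show thesis using that by blast
next
  case False
  then obtain c0 where c0: "c0 \<in> C" by blast
  have "independent ((\<lambda>x. - c0 + x) ` (C - {c0}))"
    using assms affine_dependent_iff_dependent2[OF c0] by simp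
  then obtain g where g: "linear g" "\<And>x. x \<in> (\<lambda>x. - c0 + x) ` (C - {c0}) \<Longrightarrow> g x = f (c0 + x) - f c0"
    using linear_independent_extend[of _ "\<lambda>x. f (c0 + x) - f c0"] by blast
  define a where "a = adjoint g 1"
  have a: "a \<bullet> x = g x" for x
    using adjoint_works[OF g(1), of x 1] by (simp add: a_def inner_commute)
  have "a \<bullet> c + (f c0 - a \<bullet> c0) = f c" if "c \<in> C" for c
  proof (cases "c = c0")
    case False
    then have "g (- c0 + c) = f c - f c0" using that g(2) by force
    then show ?thesis by (simp add: a[symmetric] inner_diff_right)
  qed simp
  then show thesis using that by blast
qed

lemma affine_eq_on_convex_hull:
  fixes a a' :: "'a::euclidean_space"
  assumes "\<And>c. c \<in> C \<Longrightarrow> a \<bullet> c + b = a' \<bullet> c + b'" and "x \<in> convex hull C"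
  shows "a \<bullet> x + b = a' \<bullet> x + b'"
proof -
  have "convex {x. (a - a') \<bullet> x = b' - b}" by (rule convex_hyperplane)
  moreover have "C \<subseteq> {x. (a - a') \<bullet> x = b' - b}"
    using assms(1) by (auto simp: inner_diff_left algebra_simps)
  ultimately have "convex hull C \<subseteq> {x. (a - a') \<bullet> x = b' - b}" by (rule hull_minimal[rotated])
  then show ?thesis using assms(2) by (auto simp: inner_diff_left algebra_simps)
qed

lemma affine_nonneg_on_convex_hull:
  fixes a :: "'a::euclidean_space"
  assumes "\<And>c. c \<in> C \<Longrightarrow> 0 \<le> a \<bullet> c + b" and "x \<in> convex hull C"
  shows "0 \<le> a \<bullet> x + b"
proof -
  have "convex {x. a \<bullet> x \<ge> - b}" by (rule convex_halfspace_ge)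
  moreover have "C \<subseteq> {x. a \<bullet> x \<ge> - b}" using assms(1) by force
  ultimately have "convex hull C \<subseteq> {x. a \<bullet> x \<ge> - b}" by (rule hull_minimal[rotated])
  then show ?thesis using assms(2) by force
qed

lemma closure_rel_interior_simplex:
  "k simplex S \<Longrightarrow> closure (rel_interior S) = S"
  by (metis closed_simplex closure_closed convex_closure_rel_interior convex_simplex)

text \<open>The dimension \<open>k\<close> of the cells is kept free so that the same theory serves
  the bulk mesh and the boundary mesh.\<close>

locale simplicial_mesh =
  fixes k :: int and \<T> :: "'a::euclidean_space set set" and D :: "'a set"
  assumes partition: "simplicial_partition k \<T> D" and conforming: "conforming \<T>"
begin

definition corners :: "'a set \<Rightarrow> 'a set" where
  "corners K = {x. x extreme_point_of closure K}"

lemma finite_mesh: "finite \<T>"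
  and domain_eq: "D = (\<Union>K\<in>\<T>. closure K)"
  and cells_disjoint: "pairwise disjnt \<T>"
  using partition by (auto simp: simplicial_partition_def)

lemma
  assumes "K \<in> \<T>"
  shows cell_simplex: "k simplex closure K"
    and cell_rel_interior: "K = rel_interior (closure K)"
    and cell_corners_independent: "\<not> affine_dependent (corners K)"
    and cell_hull: "closure K = convex hull corners K"
proof -
  obtain S where S: "k simplex S" "K = rel_interior S"
    using partition assms by (auto simp: simplicial_partition_def)
  then have cl: "closure K = S" by (simp add: closure_rel_interior_simplex)
  obtain C where C: "\<not> affine_dependent C" "S = convex hull C"
    using S(1) by (auto simp: simplex_def)
  have "corners K = C"
    using C extreme_point_of_convex_hull_affine_independent by (auto simp: corners_def cl)
  then show "k simplex closure K" "K = rel_interior (closure K)"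
    "\<not> affine_dependent (corners K)" "closure K = convex hull corners K"
    using S C cl by auto
qed

lemma compact_cell: "K \<in> \<T> \<Longrightarrow> compact (closure K)"
  using cell_simplex compact_simplex by blast

lemma compact_domain: "compact D"
  unfolding domain_eq using finite_mesh compact_cell by (intro compact_UN) auto

lemma finite_corners: "K \<in> \<T> \<Longrightarrow> finite (corners K)"
  using cell_corners_independent aff_independent_finite by blast

lemma corners_subset: "K \<in> \<T> \<Longrightarrow> corners K \<subseteq> closure K"
  by (auto simp: corners_def extreme_point_of_def)

lemma vertices_eq: "mesh_vertices \<T> = (\<Union>K\<in>\<T>. corners K)"
  by (auto simp: mesh_vertices_def corners_def)

lemma finite_vertices: "finite (mesh_vertices \<T>)"
  using finite_mesh finite_corners by (auto simp: vertices_eq)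

lemma vertices_subset: "mesh_vertices \<T> \<subseteq> D"
  using corners_subset by (auto simp: vertices_eq domain_eq)

text \<open>The intersection of the two closed cells is a face of both. Being extreme passes from
  the second cell down to a face containing the point, and from that face up to the first
  cell.\<close>

lemma corner_in_cell:
  assumes "K \<in> \<T>" "L \<in> \<T>" "q \<in> corners L" "q \<in> closure K"
  shows "q \<in> corners K"
proof -
  have "closure K \<inter> closure L face_of closure K" "closure K \<inter> closure L face_of closure L"
    using conforming assms by (auto simp: conforming_def)
  then show ?thesis
    using assms(3,4) corners_subset[OF assms(2)] extreme_point_of_face unfolding corners_def
    by (metis Int_iff mem_Collect_eq subsetD)
qed

text \<open>A face of a simplex is spanned by some of its corners. This is what makes affine
  functions that match at common corners match on the whole interface.\<close>

lemma cell_Int_hull: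
  assumes "K \<in> \<T>" "L \<in> \<T>"
  shows "closure K \<inter> closure L = convex hull (corners K \<inter> corners L)"
proof
  have face: "closure K \<inter> closure L face_of closure K"
    using conforming assms by (auto simp: conforming_def)
  then obtain C where C: "C \<subseteq> corners K" "closure K \<inter> closure L = convex hull C"
    using face_of_convex_hull_affine_independent[OF cell_corners_independent[OF assms(1)]]
      cell_hull[OF assms(1)] by metis
  have "C \<subseteq> closure L" using C(2) hull_subset[of C convex] by blast
  then have "C \<subseteq> corners L" using C(1) corner_in_cell[OF assms(2,1)] by blast
  then show "closure K \<inter> closure L \<subseteq> convex hull (corners K \<inter> corners L)"
    using C by (simp add: hull_mono)
  show "convex hull (corners K \<inter> corners L) \<subseteq> closure K \<inter> closure L"
    using cell_hull assms by (simp add: hull_mono)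
qed

section \<open>Piecewise linear functions and their vertex values\<close>

lemma P1_affine_on_closure:
  assumes "v \<in> P1 \<T>" "K \<in> \<T>"
  obtains a b where "\<And>x. x \<in> closure K \<Longrightarrow> v x = a \<bullet> x + b"
proof -
  obtain a b where ab: "\<And>x. x \<in> K \<Longrightarrow> v x = a \<bullet> x + b"
    using assms by (auto simp: P1_def)
  have "continuous_on (closure K) v"
    using assms by (auto simp: P1_def intro: continuous_on_subset)
  then have "continuous_on (closure K) (\<lambda>x. v x - (a \<bullet> x + b))"
    by (intro continuous_intros)
  then have "v x - (a \<bullet> x + b) = 0" if "x \<in> closure K" for x
    using continuous_constant_on_closure[of K "\<lambda>x. v x - (a \<bullet> x + b)" 0 x] ab that by auto
  then show thesis using that[of a b] by simp
qed

lemma P1_outside: "v \<in> P1 \<T> \<Longrightarrow> x \<notin> D \<Longrightarrow> v x = 0"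
  and P1_continuous: "v \<in> P1 \<T> \<Longrightarrow> continuous_on D v"
  by (auto simp: P1_def domain_eq)

lemma P1_eqI:
  assumes v: "v \<in> P1 \<T>" and w: "w \<in> P1 \<T>" and eq: "\<And>q. q \<in> mesh_vertices \<T> \<Longrightarrow> v q = w q"
  shows "v = w"
proof
  fix x
  show "v x = w x"
  proof (cases "x \<in> D")
    case True
    then obtain K where K: "K \<in> \<T>" "x \<in> closure K" by (auto simp: domain_eq)
    obtain a b where ab: "\<And>x. x \<in> closure K \<Longrightarrow> v x = a \<bullet> x + b"
      using P1_affine_on_closure[OF v K(1)] by blast
    obtain a' b' where ab': "\<And>x. x \<in> closure K \<Longrightarrow> w x = a' \<bullet> x + b'"
      using P1_affine_on_closure[OF w K(1)] by blast
    have "a \<bullet> x + b = a' \<bullet> x + b'"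
    proof (rule affine_eq_on_convex_hull[where C = "corners K"])
      show "a \<bullet> c + b = a' \<bullet> c + b'" if "c \<in> corners K" for c
      proof -
        have "c \<in> closure K" "c \<in> mesh_vertices \<T>"
          using that K(1) corners_subset by (auto simp: vertices_eq)
        then show ?thesis using eq ab ab' by metis
      qed
      show "x \<in> convex hull corners K" using K cell_hull by blast
    qed
    then show ?thesis using ab[OF K(2)] ab'[OF K(2)] by simp
  qed (simp add: P1_outside[OF v] P1_outside[OF w])
qed

text \<open>The affine interpolants of the single cells agree on common faces by
  \<open>cell_Int_hull\<close>, so they glue to a function that is continuous on a finite union of
  closed sets.\<close>

lemma P1_exists:
  obtains v where "v \<in> P1 \<T>" "\<And>q. q \<in> mesh_vertices \<T> \<Longrightarrow> v q = f q"
proof -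
  have "\<forall>K. \<exists>a b. K \<in> \<T> \<longrightarrow> (\<forall>c\<in>corners K. a \<bullet> c + b = f c)"
    using affine_interpolation[OF cell_corners_independent] by metis
  then obtain a b where ab: "\<And>K c. K \<in> \<T> \<Longrightarrow> c \<in> corners K \<Longrightarrow> a K \<bullet> c + b K = f c"
    by metis
  \<comment> \<open>A point on an interface belongs to several closed cells; the arbitrary choice is
    harmless by the next fact.\<close>
  define v where "v x = (if x \<in> D then let K = (SOME K. K \<in> \<T> \<and> x \<in> closure K) in a K \<bullet> x + b K else 0)" for x
  have v: "v x = a K \<bullet> x + b K" if "K \<in> \<T>" "x \<in> closure K" for K x
  proof -
    define L where "L = (SOME K. K \<in> \<T> \<and> x \<in> closure K)"
    have L: "L \<in> \<T>" "x \<in> closure L"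
      using someI[of "\<lambda>K. K \<in> \<T> \<and> x \<in> closure K" K] that by (auto simp: L_def)
    have "a L \<bullet> x + b L = a K \<bullet> x + b K"
      by (rule affine_eq_on_convex_hull[where C = "corners L \<inter> corners K"])
        (use ab L that cell_Int_hull[of L K] in auto)
    moreover have "x \<in> D" using that by (auto simp: domain_eq)
    ultimately show ?thesis by (simp add: v_def L_def[symmetric] Let_def)
  qed
  have "continuous_on D v"
    unfolding domain_eq
  proof (rule continuous_on_closed_Union[OF finite_mesh])
    fix K assume K: "K \<in> \<T>"
    have "continuous_on (closure K) (\<lambda>x. a K \<bullet> x + b K)" by (intro continuous_intros)
    then show "continuous_on (closure K) v" using v[OF K] by (simp cong: continuous_on_cong)
  qed simp
  then have "v \<in> P1 \<T>"
  proof -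
    have "\<forall>K\<in>\<T>. \<forall>x\<in>K. v x = a K \<bullet> x + b K" using v closure_subset by blast
    moreover have "\<forall>x. x \<notin> D \<longrightarrow> v x = 0" by (simp add: v_def)
    ultimately show ?thesis
      using \<open>continuous_on D v\<close> unfolding P1_def domain_eq[symmetric] by blast
  qed
  moreover have "v q = f q" if q: "q \<in> mesh_vertices \<T>" for q
  proof -
    obtain K where "K \<in> \<T>" "q \<in> corners K" using q by (auto simp: vertices_eq)
    then show ?thesis using v[of K q] ab[of K q] corners_subset[of K] by auto
  qed
  ultimately show thesis using that by blast
qed

text \<open>Existence by \<open>P1_exists\<close> and uniqueness by \<open>P1_eqI\<close> give the
  definite description in \<open>nodal_basis\<close> its meaning.\<close>

lemma
  shows nodal_basis_P1: "nodal_basis \<T> p \<in> P1 \<T>"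
    and nodal_basis_vertex: "q \<in> mesh_vertices \<T> \<Longrightarrow> nodal_basis \<T> p q = (if q = p then 1 else 0)"
proof -
  obtain v where v: "v \<in> P1 \<T>" "\<And>q. q \<in> mesh_vertices \<T> \<Longrightarrow> v q = (if q = p then 1 else 0)"
    using P1_exists[of "\<lambda>q. if q = p then 1 else 0"] by blast
  have "\<exists>!v. v \<in> P1 \<T> \<and> (\<forall>q\<in>mesh_vertices \<T>. v q = (if q = p then 1 else 0))"
    using v P1_eqI by (intro ex1I[of _ v]) auto
  from theI'[OF this] show "nodal_basis \<T> p \<in> P1 \<T>"
    "q \<in> mesh_vertices \<T> \<Longrightarrow> nodal_basis \<T> p q = (if q = p then 1 else 0)"
    by (auto simp: nodal_basis_def)
qed

lemma P1_nonneg: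
  assumes v: "v \<in> P1 \<T>" and nonneg: "\<And>q. q \<in> mesh_vertices \<T> \<Longrightarrow> 0 \<le> v q"
  shows "0 \<le> v x"
proof (cases "x \<in> D")
  case True
  then obtain K where K: "K \<in> \<T>" "x \<in> closure K" by (auto simp: domain_eq)
  obtain a b where ab: "\<And>x. x \<in> closure K \<Longrightarrow> v x = a \<bullet> x + b"
    using P1_affine_on_closure[OF v K(1)] by blast
  have "0 \<le> a \<bullet> x + b"
  proof (rule affine_nonneg_on_convex_hull[where C = "corners K"])
    show "0 \<le> a \<bullet> c + b" if "c \<in> corners K" for c
    proof -
      have "c \<in> closure K" "c \<in> mesh_vertices \<T>"
        using that K(1) corners_subset by (auto simp: vertices_eq)
      then show ?thesis using nonneg ab by metis
    qed
    show "x \<in> convex hull corners K" using K cell_hull by blast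
  qed
  then show ?thesis using ab[OF K(2)] by simp
qed (simp add: P1_outside[OF v])

lemma nodal_basis_nonneg: "0 \<le> nodal_basis \<T> p x"
  by (rule P1_nonneg[OF nodal_basis_P1]) (simp add: nodal_basis_vertex)

text \<open>Interpolation sees only vertex values, and there a product of hat functions is 0 or 1.
  This is mass lumping: the matrices are diagonal, with integrals of single hat functions on the
  diagonal.\<close>

lemma interpolant_nodal_product:
  assumes "p \<in> mesh_vertices \<T>" "q \<in> mesh_vertices \<T>"
  shows "interpolant \<T> (\<lambda>y. nodal_basis \<T> p y * nodal_basis \<T> q y)
    = (if p = q then nodal_basis \<T> p else (\<lambda>_. 0))"
proof
  fix x
  have "interpolant \<T> (\<lambda>y. nodal_basis \<T> p y * nodal_basis \<T> q y) x
      = (\<Sum>r\<in>mesh_vertices \<T>. if r = p then (if p = q then nodal_basis \<T> p x else 0) else 0)"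
    unfolding interpolant_def by (rule sum.cong) (auto simp: nodal_basis_vertex)
  also have "\<dots> = (if p = q then nodal_basis \<T> p x else 0)"
    using finite_vertices assms by (simp add: sum.delta)
  finally show "interpolant \<T> (\<lambda>y. nodal_basis \<T> p y * nodal_basis \<T> q y) x
    = (if p = q then nodal_basis \<T> p else (\<lambda>_. 0)) x" by simp
qed

end


section \<open>Integration over pieces of affine subspaces\<close>

text \<open>Nothing is known about \<open>g\<close> off the cells, not even measurability, since
  gradients there are undetermined descriptions. Completeness repairs this: a function that is
  almost everywhere equal to a step function is measurable.\<close>

lemma (in complete_measure) set_integral_piecewise_constant:
  fixes g :: "'a \<Rightarrow> real"
  assumes "finite \<K>" and disj: "pairwise disjnt \<K>"
    and meas: "\<And>K. K \<in> \<K> \<Longrightarrow> K \<in> fmeasurable M" and sub: "\<And>K. K \<in> \<K> \<Longrightarrow> K \<subseteq> D"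
    and null: "D - \<Union>\<K> \<in> null_sets M"
    and const: "\<And>K x. K \<in> \<K> \<Longrightarrow> x \<in> K \<Longrightarrow> g x = c K"
  shows "(LINT x:D|M. g x) = (\<Sum>K\<in>\<K>. measure M K * c K)"
proof -
  define s where "s x = (\<Sum>K\<in>\<K>. c K * indicator K x)" for x :: 'a
  define f where "f x = indicator D x *\<^sub>R g x" for x
  have eq: "f x = s x" if x: "x \<notin> D - \<Union>\<K>" for x
  proof (cases "x \<in> D")
    case True
    then obtain K where K: "K \<in> \<K>" "x \<in> K" using x by auto
    then have "x \<notin> L" if "L \<in> \<K>" "L \<noteq> K" for L
      using disj that by (auto simp: pairwise_def disjnt_iff)
    then have "s x = (\<Sum>L\<in>\<K>. if L = K then c K else 0)"
      unfolding s_def by (intro sum.cong) (use K in \<open>auto simp: indicator_def\<close>)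
    then show ?thesis using True K \<open>finite \<K>\<close> const by (simp add: f_def sum.delta)
  next
    case False
    then have "x \<notin> L" if "L \<in> \<K>" for L using sub that by auto
    then show ?thesis using False by (simp add: f_def s_def)
  qed
  have AE: "AE x in M. f x = s x"
    using AE_not_in[OF null] by eventually_elim (rule eq)
  have [measurable]: "s \<in> borel_measurable M"
    unfolding s_def by (intro borel_measurable_sum borel_measurable_times borel_measurable_const
        borel_measurable_indicator) (use meas in auto)
  have "f \<in> borel_measurable M"
  proof (rule measurableI)
    fix A :: "real set" assume "A \<in> sets borel"
    show "f -` A \<inter> space M \<in> sets M"
    proof (rule in_sets_AE)
      show "AE x in M. x \<in> s -` A \<inter> space M \<longleftrightarrow> x \<in> f -` A \<inter> space M"
        using AE by eventually_elim simp
      show "s -` A \<inter> space M \<in> sets M"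
        using \<open>A \<in> sets borel\<close> by measurable
    qed auto
  qed simp
  then have "(\<integral>x. f x \<partial>M) = (\<integral>x. s x \<partial>M)"
    by (intro integral_cong_AE AE) auto
  also have "\<dots> = (\<Sum>K\<in>\<K>. \<integral>x. c K * indicator K x \<partial>M)"
    unfolding s_def using meas by (intro Bochner_Integration.integral_sum integrable_mult_right
        integrable_real_indicator) (auto simp: fmeasurable_def)
  also have "\<dots> = (\<Sum>K\<in>\<K>. measure M K * c K)"
  proof (rule sum.cong)
    fix K assume "K \<in> \<K>"
    then have "K \<inter> space M = K" using meas sets.sets_into_space by (force simp: fmeasurable_def)
    then show "(\<integral>x. c K * indicator K x \<partial>M) = measure M K * c K" by simp
  qed simp
  finally show ?thesis by (simp add: set_lebesgue_integral_def f_def)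
qed

lemma set_integral_pos:
  fixes f :: "'a \<Rightarrow> real"
  assumes int: "set_integrable M D f" and nonneg: "\<And>x. x \<in> D \<Longrightarrow> 0 \<le> f x"
    and A: "A \<in> sets M" "A \<subseteq> D" "emeasure M A > 0" and pos: "\<And>x. x \<in> A \<Longrightarrow> 0 < f x"
  shows "0 < (LINT x:D|M. f x)"
proof -
  let ?g = "\<lambda>x. indicator D x *\<^sub>R f x"
  have g0: "0 \<le> ?g x" for x using nonneg by (simp add: indicator_def)
  have "(\<integral>x. ?g x \<partial>M) \<noteq> 0"
  proof
    assume "(\<integral>x. ?g x \<partial>M) = 0"
    then have "AE x in M. ?g x = 0"
      using integral_nonneg_eq_0_iff_AE[of M ?g] int g0 by (simp add: set_integrable_def)
    moreover have "x \<notin> A" if "?g x = 0" for x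
      using that A(2) pos[of x] by (auto simp: indicator_def)
    ultimately have "AE x in M. x \<notin> A" by (auto elim: eventually_mono)
    then have "A \<in> null_sets M" using A(1) by (simp add: AE_iff_null_sets)
    then show False using A(3) by (simp add: null_setsD1)
  qed
  moreover have "0 \<le> (\<integral>x. ?g x \<partial>M)" using g0 by (simp add: integral_nonneg)
  ultimately show ?thesis by (simp add: set_lebesgue_integral_def)
qed

text \<open>\<open>flat_lebesgue\<close> takes its frame from a choice operator, so its properties
  are proved for an arbitrary frame. The frame may be empty, in which case the flat is a
  point.\<close>

locale orthonormal_frame =
  fixes a :: "'a::euclidean_space" and B :: "'a set"
  assumes orthogonal: "pairwise orthogonal B" and unit: "\<And>b. b \<in> B \<Longrightarrow> norm b = 1"
begin

definition param :: "('a \<Rightarrow> real) \<Rightarrow> 'a" where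
  "param t = a + (\<Sum>b\<in>B. t b *\<^sub>R b)"

definition flat_measure :: "'a measure" where
  "flat_measure = distr (\<Pi>\<^sub>M b\<in>B. (lborel :: real measure)) borel param"

sublocale lborel: product_sigma_finite "\<lambda>_. lborel :: real measure"
  by standard

lemma finite_frame: "finite B"
  using pairwise_orthogonal_independent[OF orthogonal] unit independent_imp_finite by force

lemma measurable_param [measurable]: "param \<in> borel_measurable (\<Pi>\<^sub>M b\<in>B. lborel)"
  unfolding param_def[abs_def] by measurable

lemma sets_flat [simp]: "sets flat_measure = sets borel"
  and space_flat [simp]: "space flat_measure = UNIV"
  by (simp_all add: flat_measure_def)

lemma space_frame: "space (\<Pi>\<^sub>M b\<in>B. (lborel :: real measure)) = Pi\<^sub>E B (\<lambda>_. UNIV)"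
  by (simp add: space_PiM)

lemma emeasure_flat:
  "A \<in> sets borel \<Longrightarrow> emeasure flat_measure A = emeasure (\<Pi>\<^sub>M b\<in>B. lborel) (param -` A \<inter> Pi\<^sub>E B (\<lambda>_. UNIV))"
  by (simp add: flat_measure_def emeasure_distr space_frame)

lemma coordinate: "c \<in> B \<Longrightarrow> (param t - a) \<bullet> c = t c"
proof -
  assume c: "c \<in> B"
  have "(\<Sum>b\<in>B. t b *\<^sub>R b) \<bullet> c = (\<Sum>b\<in>B. if b = c then t c else 0)"
    unfolding inner_sum_left
  proof (rule sum.cong)
    fix b assume "b \<in> B"
    then show "(t b *\<^sub>R b) \<bullet> c = (if b = c then t c else 0)"
      using orthogonal unit[OF c] c by (auto simp: pairwise_def real_inner_class.orthogonal_def dot_square_norm)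
  qed simp
  then show ?thesis using c finite_frame by (simp add: param_def)
qed

lemma param_in: "param t \<in> (\<lambda>y. a + y) ` span B"
  unfolding param_def by (intro imageI span_sum span_scale span_base)

lemma param_surj: "x \<in> (\<lambda>y. a + y) ` span B \<Longrightarrow> \<exists>t\<in>Pi\<^sub>E B (\<lambda>_. UNIV). param t = x"
proof -
  assume "x \<in> (\<lambda>y. a + y) ` span B"
  then obtain u where "x = a + (\<Sum>b\<in>B. u b *\<^sub>R b)"
    using span_finite[OF finite_frame] by auto
  then have "param (restrict u B) = x" by (simp add: param_def)
  then show ?thesis by (intro bexI[of _ "restrict u B"]) auto
qed

text \<open>Coordinates are inner products with unit vectors, so a bounded set pulls back into a
  cube.\<close>

lemma emeasure_flat_bounded:
  assumes "A \<in> sets borel" "bounded A"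
  shows "emeasure flat_measure A < \<infinity>"
proof -
  have "\<exists>r. \<forall>x\<in>A. dist a x \<le> r" using assms(2) bounded_any_center by blast
  then obtain r where "\<forall>x\<in>A. dist a x \<le> r" ..
  then have r: "norm (x - a) \<le> r" if "x \<in> A" for x
    using that by (metis dist_norm dist_commute)
  have "param -` A \<inter> Pi\<^sub>E B (\<lambda>_. UNIV) \<subseteq> Pi\<^sub>E B (\<lambda>_. {-r..r})"
  proof
    fix t assume t: "t \<in> param -` A \<inter> Pi\<^sub>E B (\<lambda>_. UNIV)"
    have "\<bar>t c\<bar> \<le> r" if "c \<in> B" for c
    proof -
      have "\<bar>t c\<bar> \<le> norm (param t - a) * norm c"
        unfolding coordinate[OF that, of t, symmetric] by (rule Cauchy_Schwarz_ineq2)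
      also have "\<dots> \<le> r" using r[of "param t"] t unit[OF that] by simp
      finally show ?thesis .
    qed
    then show "t \<in> Pi\<^sub>E B (\<lambda>_. {-r..r})" using t by (force simp: PiE_iff abs_le_iff)
  qed
  then have "emeasure flat_measure A \<le> emeasure (\<Pi>\<^sub>M b\<in>B. lborel) (Pi\<^sub>E B (\<lambda>_. {-r..r}))"
    unfolding emeasure_flat[OF assms(1)]
    by (rule emeasure_mono) (auto intro!: sets_PiM_I_finite finite_frame)
  also have "\<dots> = (\<Prod>b\<in>B. emeasure lborel {-r..r})"
    by (rule lborel.emeasure_PiM[OF finite_frame]) simp
  also have "\<dots> = ennreal (max 0 (2 * r) ^ card B)"
    by (simp add: emeasure_lborel_Icc_eq ennreal_power)
  also have "\<dots> < \<infinity>" by simp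
  finally show ?thesis .
qed

lemma emeasure_flat_pos:
  assumes "A \<in> sets borel" "x \<in> (\<lambda>y. a + y) ` span B" "e > 0"
    and sub: "ball x e \<inter> (\<lambda>y. a + y) ` span B \<subseteq> A"
  shows "0 < emeasure flat_measure A"
proof -
  obtain t0 where t0: "param t0 = x" using param_surj assms(2) by blast
  \<comment> \<open>By the triangle inequality, coordinates within \<open>d\<close> of those of
    \<open>x\<close> move the point by at most \<open>card B\<close> times \<open>d\<close>, which
    is below \<open>e\<close>; the added 1 covers the empty frame.\<close>
  define d where "d = e / (real (card B) + 1)"
  have "d > 0" using \<open>e > 0\<close> by (simp add: d_def)
  have "Pi\<^sub>E B (\<lambda>b. {t0 b - d<..<t0 b + d}) \<subseteq> param -` A \<inter> Pi\<^sub>E B (\<lambda>_. UNIV)"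
  proof
    fix t assume t: "t \<in> Pi\<^sub>E B (\<lambda>b. {t0 b - d<..<t0 b + d})"
    have "norm (param t - x) = norm (\<Sum>b\<in>B. (t b - t0 b) *\<^sub>R b)"
      by (simp add: t0[symmetric] param_def sum_subtractf scaleR_diff_left)
    also have "\<dots> \<le> (\<Sum>b\<in>B. \<bar>t b - t0 b\<bar>)"
      by (rule order_trans[OF norm_sum]) (auto intro!: sum_mono simp: unit)
    also have "\<dots> \<le> (\<Sum>b\<in>B. d)"
      by (rule sum_mono) (use t in \<open>force simp: PiE_iff\<close>)
    also have "\<dots> < e"
      using \<open>e > 0\<close> by (simp add: d_def field_simps)
    finally have "param t \<in> ball x e" by (simp add: dist_norm norm_minus_commute)
    then show "t \<in> param -` A \<inter> Pi\<^sub>E B (\<lambda>_. UNIV)"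
      using sub param_in t by (auto simp: PiE_iff)
  qed
  moreover have "param -` A \<inter> Pi\<^sub>E B (\<lambda>_. UNIV) \<in> sets (\<Pi>\<^sub>M b\<in>B. (lborel::real measure))"
    using measurable_sets[OF measurable_param assms(1)] by (simp add: space_frame)
  ultimately have "emeasure (\<Pi>\<^sub>M b\<in>B. lborel) (Pi\<^sub>E B (\<lambda>b. {t0 b - d<..<t0 b + d})) \<le> emeasure flat_measure A"
    unfolding emeasure_flat[OF assms(1)] by (rule emeasure_mono)
  moreover have "emeasure (\<Pi>\<^sub>M b\<in>B. lborel) (Pi\<^sub>E B (\<lambda>b. {t0 b - d<..<t0 b + d}))
      = (\<Prod>b\<in>B. emeasure lborel {t0 b - d<..<t0 b + d})"
    by (rule lborel.emeasure_PiM[OF finite_frame]) simp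
  moreover have "\<dots> = ennreal (\<Prod>b\<in>B. 2 * d)"
    using \<open>d > 0\<close> by (simp add: prod_ennreal[symmetric] ennreal_power)
  moreover have "0 < ennreal (\<Prod>b\<in>B. 2 * d)" using \<open>d > 0\<close> by (simp add: prod_pos)
  ultimately show ?thesis by (metis order.strict_trans2)
qed

lemma null_sets_flat_hyperplane:
  assumes "\<not> (\<lambda>y. a + y) ` span B \<subseteq> {x. n \<bullet> x = c}"
    and "x0 \<in> (\<lambda>y. a + y) ` span B" "n \<bullet> x0 = c"
  shows "{x. n \<bullet> x = c} \<in> null_sets flat_measure"
proof -
  define H where "H = {x. n \<bullet> x = c}"
  have H: "H \<in> sets borel" by (simp add: H_def closed_hyperplane)
  \<comment> \<open>A normal orthogonal to the whole frame would be constant along the flat, with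
    value \<open>c\<close> attained at \<open>x0\<close>, so that the flat would lie in the
    hyperplane.\<close>
  have "\<exists>b\<in>B. n \<bullet> b \<noteq> 0"
  proof (rule ccontr)
    assume "\<not> (\<exists>b\<in>B. n \<bullet> b \<noteq> 0)"
    then have zero: "n \<bullet> b = 0" if "b \<in> B" for b using that by blast
    have "n \<bullet> y = 0" if "y \<in> span B" for y
      using that by (induction rule: span_induct_alt) (simp_all add: inner_add_right zero)
    then show False using assms by (auto simp: inner_add_right)
  qed
  then obtain b where b: "b \<in> B" "n \<bullet> b \<noteq> 0" by blast
  \<comment> \<open>By Fubini: every line in direction \<open>b\<close> meets the hyperplane in a single point.\<close>
  define B' where "B' = B - {b}"
  have B': "B = insert b B'" "b \<notin> B'" "finite B'" using b finite_frame by (auto simp: B'_def)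
  have "emeasure flat_measure H = (\<integral>\<^sup>+ x. indicator H x \<partial>flat_measure)"
    using H by simp
  also have "\<dots> = (\<integral>\<^sup>+ t. indicator H (param t) \<partial>(\<Pi>\<^sub>M b\<in>B. lborel))"
    unfolding flat_measure_def using H by (intro nn_integral_distr) auto
  also have "\<dots> = (\<integral>\<^sup>+ t. (\<integral>\<^sup>+ y. indicator H (param (t(b := y))) \<partial>lborel) \<partial>(\<Pi>\<^sub>M b\<in>B'. lborel))"
  proof -
    have "(\<lambda>t. indicator H (param t) :: ennreal) \<in> borel_measurable (\<Pi>\<^sub>M b\<in>B. lborel)"
      using H measurable_param by (intro measurable_compose[OF measurable_param]) auto
    then show ?thesis
      using lborel.product_nn_integral_insert[OF B'(3,2)] by (simp add: B'(1)[symmetric])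
  qed
  also have "\<dots> = (\<integral>\<^sup>+ t. 0 \<partial>(\<Pi>\<^sub>M b\<in>B'. (lborel :: real measure)))"
  proof (rule nn_integral_cong)
    fix t :: "'a \<Rightarrow> real"
    define y0 where "y0 = (c - n \<bullet> a - (\<Sum>d\<in>B'. t d * (n \<bullet> d))) / (n \<bullet> b)"
    have "param (t(b := y)) \<in> H \<longleftrightarrow> y = y0" for y
    proof -
      have "(\<Sum>d\<in>B'. (t(b := y)) d *\<^sub>R d) = (\<Sum>d\<in>B'. t d *\<^sub>R d)"
        using B'(2) by (intro sum.cong) auto
      then have "param (t(b := y)) = a + (y *\<^sub>R b + (\<Sum>d\<in>B'. t d *\<^sub>R d))"
        unfolding param_def using B'(2,3) by (subst B'(1)) simp
      then have "n \<bullet> param (t(b := y)) = n \<bullet> a + (y * (n \<bullet> b) + (\<Sum>d\<in>B'. t d * (n \<bullet> d)))"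
        by (simp add: inner_add_right inner_sum_right)
      then show ?thesis using b(2) by (auto simp: H_def y0_def field_simps)
    qed
    then have "(\<lambda>y. indicator H (param (t(b := y)))) = (indicator {y0} :: real \<Rightarrow> ennreal)"
      by (simp add: indicator_def fun_eq_iff)
    then show "(\<integral>\<^sup>+ y. indicator H (param (t(b := y))) \<partial>lborel) = 0" by simp
  qed
  finally have "emeasure flat_measure H = 0" by simp
  then show ?thesis using H by (simp add: H_def null_setsI)
qed

end

text \<open>An orthonormal basis of the space of directions shows that the choice in
  \<open>flat_lebesgue\<close> is made from a nonempty set, hence returns a genuine frame.\<close>

lemma flat_lebesgue_frame:
  fixes S :: "'a::euclidean_space set"
  assumes "S \<noteq> {}"
  obtains a B where "orthonormal_frame B" "affine hull S = (\<lambda>y. a + y) ` span B"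
    "flat_lebesgue S = completion (orthonormal_frame.flat_measure a B)"
proof -
  define P where "P = (\<lambda>(a, B). pairwise orthogonal B \<and> (\<forall>b\<in>B. norm b = 1) \<and>
    affine hull S = (\<lambda>y. a + y) ` span B)"
  obtain s where s: "s \<in> S" using assms by blast
  let ?V = "span {x - s | x. x \<in> S - {s}}"
  obtain B where B: "pairwise orthogonal B" "\<And>x. x \<in> B \<Longrightarrow> norm x = 1" "span B = ?V"
    by (rule orthonormal_basis_subspace[OF subspace_span[of "{x - s | x. x \<in> S - {s}}"]]) blast
  have "affine hull S = (\<lambda>y. s + y) ` span B"
    using affine_hull_span[OF s] by (auto simp: B(3))
  then have "P (s, B)" using B by (simp add: P_def)
  then have "P (SOME p. P p)" by (rule someI)
  then obtain a B where p: "(SOME p. P p) = (a, B)" "P (a, B)" by (metis surj_pair)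
  have frame: "orthonormal_frame B" using p(2) by unfold_locales (auto simp: P_def)
  show thesis
  proof (rule that[OF frame])
    show "affine hull S = (\<lambda>y. a + y) ` span B" using p(2) by (simp add: P_def)
    show "flat_lebesgue S = completion (orthonormal_frame.flat_measure a B)"
      unfolding flat_lebesgue_def using p(1)
      by (simp add: P_def Let_def orthonormal_frame.flat_measure_def[OF frame]
          orthonormal_frame.param_def[OF frame, abs_def])
  qed
qed

text \<open>The interface to \<open>flat_lebesgue\<close> used from here on, with the chosen frame
  eliminated from all statements.\<close>

lemma
  fixes S :: "'a::euclidean_space set"
  assumes "S \<noteq> {}"
  shows sets_flat_lebesgue: "A \<in> sets borel \<Longrightarrow> A \<in> sets (flat_lebesgue S)"
    and fmeasurable_flat_lebesgue: "A \<in> sets borel \<Longrightarrow> bounded A \<Longrightarrow> A \<in> fmeasurable (flat_lebesgue S)"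
    and flat_lebesgue_pos: "A \<in> sets borel \<Longrightarrow> x \<in> affine hull S \<Longrightarrow> e > 0 \<Longrightarrow>
      ball x e \<inter> affine hull S \<subseteq> A \<Longrightarrow> 0 < emeasure (flat_lebesgue S) A"
    and flat_lebesgue_hyperplane: "\<not> affine hull S \<subseteq> {x. n \<bullet> x = c} \<Longrightarrow> x0 \<in> affine hull S \<Longrightarrow>
      n \<bullet> x0 = c \<Longrightarrow> {x. n \<bullet> x = c} \<in> null_sets (flat_lebesgue S)"
    and complete_flat_lebesgue: "complete_measure (flat_lebesgue S)"
    and borel_measurable_flat_lebesgue: "f \<in> borel_measurable borel \<Longrightarrow> f \<in> borel_measurable (flat_lebesgue S)"
proof -
  obtain a B where *: "orthonormal_frame B" "affine hull S = (\<lambda>y. a + y) ` span B"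
    "flat_lebesgue S = completion (orthonormal_frame.flat_measure a B)"
    by (rule flat_lebesgue_frame[OF assms])
  interpret orthonormal_frame a B by fact
  show sets: "A \<in> sets borel \<Longrightarrow> A \<in> sets (flat_lebesgue S)" for A
    by (simp add: *)
  show "A \<in> sets borel \<Longrightarrow> bounded A \<Longrightarrow> A \<in> fmeasurable (flat_lebesgue S)"
    using emeasure_flat_bounded[of A] by (simp add: * fmeasurable_def)
  show "A \<in> sets borel \<Longrightarrow> x \<in> affine hull S \<Longrightarrow> e > 0 \<Longrightarrow>
      ball x e \<inter> affine hull S \<subseteq> A \<Longrightarrow> 0 < emeasure (flat_lebesgue S) A"
    using emeasure_flat_pos[of A x e] by (simp add: *)
  show "\<not> affine hull S \<subseteq> {x. n \<bullet> x = c} \<Longrightarrow> x0 \<in> affine hull S \<Longrightarrow>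
      n \<bullet> x0 = c \<Longrightarrow> {x. n \<bullet> x = c} \<in> null_sets (flat_lebesgue S)"
    using null_sets_flat_hyperplane[of n c x0] unfolding * by (rule null_sets_completionI)
  show "complete_measure (flat_lebesgue S)" unfolding * by (rule completion.complete_measure_axioms)
  show "f \<in> borel_measurable borel \<Longrightarrow> f \<in> borel_measurable (flat_lebesgue S)"
    unfolding * by (rule measurable_completion) (simp add: measurable_def)
qed


section \<open>The bulk mesh\<close>

lemma set_integrable_continuous_compact:
  fixes f :: "'a::euclidean_space \<Rightarrow> real"
  assumes C: "compact C" "C \<in> fmeasurable M" and f: "continuous_on C f"
    and borel: "\<And>g :: 'a \<Rightarrow> real. g \<in> borel_measurable borel \<Longrightarrow> g \<in> borel_measurable M"
  shows "set_integrable M C f"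
proof -
  obtain B where B: "\<And>x. x \<in> C \<Longrightarrow> norm (f x) \<le> B"
    using compact_imp_bounded[OF compact_continuous_image[OF f C(1)]] by (auto simp: bounded_iff)
  have "(\<lambda>x. indicator C x *\<^sub>R f x) \<in> borel_measurable M"
    by (rule borel[OF borel_measurable_continuous_on_indicator[OF _ f]])
      (use C(1) compact_imp_closed in \<open>blast intro: borel_closed\<close>)
  then show ?thesis
    unfolding set_integrable_def using C(2) B
    by (intro integrableI_bounded_set[where A = C and B = B]) (auto simp: fmeasurable_def indicator_def)
qed

text \<open>Derivatives within a thin set such as a facet are not unique in general. Here the set
  contains a segment through \<open>x\<close> in the direction \<open>g - g'\<close>; along it the
  difference of the two derivatives must vanish, which says that the squared norm of
  \<open>g - g'\<close> is 0.\<close>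

lemma has_derivative_within_affine_unique:
  fixes v :: "'a::euclidean_space \<Rightarrow> real"
  assumes "(v has_derivative (\<lambda>k. k \<bullet> g)) (at x within S)" "(v has_derivative (\<lambda>k. k \<bullet> g')) (at x within S)"
    and "e > 0" "\<And>t. \<bar>t\<bar> < e \<Longrightarrow> x + t *\<^sub>R (g - g') \<in> S"
  shows "g = g'"
proof -
  define w where "w = g - g'"
  have "((\<lambda>y. v y - v y) has_derivative (\<lambda>k. k \<bullet> g - k \<bullet> g')) (at x within S)"
    using assms(1,2) by (rule has_derivative_diff)
  then have zero: "((\<lambda>y. 0 :: real) has_derivative (\<lambda>k. k \<bullet> w)) (at x within S)"
    by (simp add: w_def inner_diff_right)
  have path: "((\<lambda>t. x + t *\<^sub>R w) has_derivative (\<lambda>t. t *\<^sub>R w)) (at 0 within {-e<..<e})"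
    by (auto intro!: derivative_eq_intros)
  have "((\<lambda>y. 0 :: real) has_derivative (\<lambda>k. k \<bullet> w)) (at (x + 0 *\<^sub>R w) within (\<lambda>t. x + t *\<^sub>R w) ` {-e<..<e})"
    by (simp, rule has_derivative_subset[OF zero]) (use assms(4) in \<open>auto simp: w_def\<close>)
  from diff_chain_within[OF path this]
  have "((\<lambda>t. 0 :: real) has_derivative (\<lambda>t. (t *\<^sub>R w) \<bullet> w)) (at 0 within {-e<..<e})"
    by (simp add: o_def)
  then have "((\<lambda>t. 0 :: real) has_derivative (\<lambda>t. (t *\<^sub>R w) \<bullet> w)) (at 0)"
    using assms(3) by (subst (asm) at_within_open) auto
  then have "(\<lambda>t. (t *\<^sub>R w) \<bullet> w) = (\<lambda>t::real. 0 :: real)"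
    by (rule has_derivative_unique[OF _ has_derivative_const])
  from fun_cong[OF this, of 1] show ?thesis by (simp add: w_def)
qed

lemma emeasure_lebesgue_open_pos:
  assumes "open U" "U \<noteq> {}"
  shows "0 < emeasure lebesgue (U :: 'a::euclidean_space set)"
proof -
  have "U \<notin> null_sets lebesgue"
    using open_not_negligible[OF assms] by (simp add: negligible_iff_null_sets)
  then have "emeasure lebesgue U \<noteq> 0" using assms(1) by (auto simp: null_sets_def)
  then show ?thesis by (simp add: zero_less_iff_neq_zero)
qed

lemma rel_interior_eq_affine_Int_open:
  fixes S :: "'a::euclidean_space set"
  obtains U where "open U" "rel_interior S = affine hull S \<inter> U"
  using openin_rel_interior[of S] unfolding openin_open by metis

lemma borel_rel_interior: "rel_interior (S :: 'a::euclidean_space set) \<in> sets borel"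
proof -
  obtain U where "open U" "rel_interior S = affine hull S \<inter> U"
    by (rule rel_interior_eq_affine_Int_open)
  then show ?thesis by (simp add: borel_open borel_closed closed_affine_hull sets.Int)
qed

locale bulk_mesh = simplicial_mesh "int DIM('a)" \<T> "closure \<Omega>"
  for \<T> :: "'a::euclidean_space set set" and \<Omega> :: "'a set" +
  assumes domain: "open \<Omega>" "\<Omega> \<noteq> {}" "bounded \<Omega>" "convex \<Omega>"
begin

lemma cell_interior: "K \<in> \<T> \<Longrightarrow> K = interior (closure K)"
  by (metis cell_rel_interior interior_rel_interior aff_dim_simplex cell_simplex)

lemma open_cell: "K \<in> \<T> \<Longrightarrow> open K"
  using cell_interior open_interior by metis

lemma interior_closure_domain: "interior (closure \<Omega>) = \<Omega>"
  using domain by (simp add: convex_interior_closure interior_open)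

lemma cell_subset: "K \<in> \<T> \<Longrightarrow> K \<subseteq> \<Omega>"
proof -
  assume K: "K \<in> \<T>"
  then have "K \<subseteq> closure \<Omega>" using closure_subset domain_eq by blast
  then have "K \<subseteq> interior (closure \<Omega>)" using open_cell[OF K] by (simp add: interior_maximal)
  then show ?thesis by (simp add: interior_closure_domain)
qed

lemma cell_nonempty: "K \<in> \<T> \<Longrightarrow> K \<noteq> {}"
proof
  assume "K \<in> \<T>" "K = {}"
  then show False using aff_dim_simplex[OF cell_simplex[of K]] by simp
qed

lemma cell_fmeasurable: "K \<in> \<T> \<Longrightarrow> K \<in> fmeasurable lebesgue"
  using cell_subset domain(3) open_cell by (meson bounded_subset lmeasurable_open)

text \<open>Points missed by the open cells lie on the boundary of some closed cell, and boundaries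
  of convex sets are negligible.\<close>

lemma null_complement: "\<Omega> - \<Union>\<T> \<in> null_sets lebesgue"
proof -
  have "\<Omega> - \<Union>\<T> \<subseteq> (\<Union>K\<in>\<T>. frontier (closure K))"
  proof
    fix x assume x: "x \<in> \<Omega> - \<Union>\<T>"
    then obtain K where "K \<in> \<T>" "x \<in> closure K"
      using closure_subset domain_eq by blast
    moreover have "x \<notin> interior (closure K)"
      using x \<open>K \<in> \<T>\<close> cell_interior by blast
    ultimately show "x \<in> (\<Union>K\<in>\<T>. frontier (closure K))" by (auto simp: frontier_def)
  qed
  moreover have "negligible (\<Union>K\<in>\<T>. frontier (closure K))"
    using finite_mesh cell_simplex convex_simplex
    by (intro negligible_Union) (auto intro!: negligible_convex_frontier)
  ultimately show ?thesis using negligible_subset negligible_iff_null_sets by blast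
qed

text \<open>The gradient of a hat function on one cell; the Gram structure of the stiffness matrix
  is expressed through these vectors.\<close>

definition slope :: "'a set \<Rightarrow> 'a \<Rightarrow> 'a" where
  "slope K p = (SOME a. \<exists>b. \<forall>x\<in>closure K. nodal_basis \<T> p x = a \<bullet> x + b)"

lemma slope:
  assumes "K \<in> \<T>"
  obtains b where "\<And>x. x \<in> closure K \<Longrightarrow> nodal_basis \<T> p x = slope K p \<bullet> x + b"
proof -
  have "\<exists>a b. \<forall>x\<in>closure K. nodal_basis \<T> p x = a \<bullet> x + b"
    using P1_affine_on_closure[OF nodal_basis_P1 assms] by metis
  then have "\<exists>b. \<forall>x\<in>closure K. nodal_basis \<T> p x = slope K p \<bullet> x + b"
    unfolding slope_def by (rule someI_ex)
  then show thesis using that by blast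
qed

lemma grad_nodal_basis:
  assumes "K \<in> \<T>" "x \<in> K"
  shows "grad (nodal_basis \<T> p) x = slope K p"
proof -
  obtain b where b: "\<And>x. x \<in> closure K \<Longrightarrow> nodal_basis \<T> p x = slope K p \<bullet> x + b"
    using slope[OF assms(1)] by blast
  have "((\<lambda>x. slope K p \<bullet> x + b) has_derivative (\<lambda>h. h \<bullet> slope K p)) (at x)"
    by (auto intro!: derivative_eq_intros simp: inner_commute)
  then have "(nodal_basis \<T> p has_derivative (\<lambda>h. h \<bullet> slope K p)) (at x)"
    by (rule has_derivative_transform_within_open[OF _ open_cell[OF assms(1)] assms(2)])
      (use b closure_subset in fastforce)
  then have *: "GDERIV (nodal_basis \<T> p) x :> slope K p" by (simp add: gderiv_def)
  show ?thesis unfolding grad_def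
  proof (rule the_equality)
    show "GDERIV (nodal_basis \<T> p) x :> slope K p" by (rule *)
    fix g assume "GDERIV (nodal_basis \<T> p) x :> g"
    then show "g = slope K p"
      using * by (intro has_derivative_within_affine_unique[where S = UNIV and e = 1]) (auto simp: gderiv_def)
  qed
qed

text \<open>A diagonal entry is the integral of a nonnegative hat function. Near its vertex this
  function differs from 1 by less than 1, and although the vertex may lie on the boundary, every
  ball around it meets the open domain in a set of positive measure.\<close>

lemma bulk_mass_entry:
  assumes "p \<in> mesh_vertices \<T>" "q \<in> mesh_vertices \<T>"
  shows "p \<noteq> q \<Longrightarrow> (LINT x:\<Omega>|lebesgue. interpolant \<T> (\<lambda>y. nodal_basis \<T> p y * nodal_basis \<T> q y) x) = 0"
    and "0 < (LINT x:\<Omega>|lebesgue. interpolant \<T> (\<lambda>y. nodal_basis \<T> p y * nodal_basis \<T> p y) x)"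
proof -
  show "p \<noteq> q \<Longrightarrow> (LINT x:\<Omega>|lebesgue. interpolant \<T> (\<lambda>y. nodal_basis \<T> p y * nodal_basis \<T> q y) x) = 0"
    by (simp add: interpolant_nodal_product[OF assms] set_lebesgue_integral_def)
  let ?v = "nodal_basis \<T> p"
  have cont: "continuous_on (closure \<Omega>) ?v" by (rule P1_continuous[OF nodal_basis_P1])
  have "set_integrable lebesgue (closure \<Omega>) ?v"
    by (rule set_integrable_continuous_compact[OF compact_domain _ cont])
      (auto intro: lmeasurable_compact compact_domain measurable_completion)
  then have int: "set_integrable lebesgue \<Omega> ?v"
    by (rule set_integrable_subset) (use domain(1) closure_subset in auto)
  have p: "p \<in> closure \<Omega>" using assms(1) vertices_subset by blast
  have "\<exists>d>0. \<forall>y\<in>closure \<Omega>. dist y p < d \<longrightarrow> dist (?v y) (?v p) < 1"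
    using bspec[OF cont[unfolded continuous_on_iff] p, rule_format, of 1] by simp
  then obtain d where d: "d > 0" "\<And>y. y \<in> closure \<Omega> \<Longrightarrow> dist y p < d \<Longrightarrow> dist (?v y) (?v p) < 1"
    by blast
  have vp: "?v p = 1" using nodal_basis_vertex[OF assms(1)] by simp
  have "0 < (LINT x:\<Omega>|lebesgue. ?v x)"
  proof (rule set_integral_pos[OF int])
    have "open (ball p d \<inter> \<Omega>)" by (rule open_Int[OF open_ball domain(1)])
    moreover have "ball p d \<inter> \<Omega> \<noteq> {}"
    proof -
      obtain y where "y \<in> \<Omega>" "dist y p < d" using p d(1) closure_approachable by metis
      then have "y \<in> ball p d \<inter> \<Omega>" by (simp add: dist_commute)
      then show ?thesis by blast
    qed
    ultimately show "0 < emeasure lebesgue (ball p d \<inter> \<Omega>)"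
      using emeasure_lebesgue_open_pos by blast
    show "ball p d \<inter> \<Omega> \<in> sets lebesgue" using \<open>open (ball p d \<inter> \<Omega>)\<close> by simp
    show "0 < ?v x" if "x \<in> ball p d \<inter> \<Omega>" for x
    proof -
      have "x \<in> closure \<Omega>" "dist x p < d"
        using that closure_subset by (auto simp: dist_commute)
      from d(2)[OF this] show ?thesis by (simp add: vp dist_real_def)
    qed
  qed (auto simp: nodal_basis_nonneg)
  then show "0 < (LINT x:\<Omega>|lebesgue. interpolant \<T> (\<lambda>y. nodal_basis \<T> p y * nodal_basis \<T> p y) x)"
    by (simp add: interpolant_nodal_product[OF assms(1,1)])
qed

lemma bulk_stiffness_entry:
  "(LINT x:\<Omega>|lebesgue. grad (nodal_basis \<T> p) x \<bullet> grad (nodal_basis \<T> q) x)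
    = (\<Sum>K\<in>\<T>. measure lebesgue K * (slope K p \<bullet> slope K q))"
  by (rule completion.set_integral_piecewise_constant[OF finite_mesh cells_disjoint])
    (auto simp: cell_fmeasurable null_complement grad_nodal_basis dest: cell_subset)

lemma measure_cell_pos: "K \<in> \<T> \<Longrightarrow> 0 < measure lebesgue K"
  using emeasure_lebesgue_open_pos[OF open_cell cell_nonempty, of K] cell_fmeasurable[of K]
  by (simp add: emeasure_eq_measure2)

lemma zero_energy_constant:
  assumes zero: "\<And>K. K \<in> \<T> \<Longrightarrow> (\<Sum>i\<in>I. c i *\<^sub>R slope K (p i)) = 0"
    and xy: "x \<in> closure \<Omega>" "y \<in> closure \<Omega>"
  shows "(\<Sum>i\<in>I. c i * nodal_basis \<T> (p i) x) = (\<Sum>i\<in>I. c i * nodal_basis \<T> (p i) y)"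
proof -
  define v where "v x = (\<Sum>i\<in>I. c i * nodal_basis \<T> (p i) x)" for x
  have "\<exists>d. \<forall>x\<in>closure K. v x = d" if "K \<in> \<T>" for K
  proof -
    have "\<forall>i. \<exists>b. \<forall>x\<in>closure K. nodal_basis \<T> (p i) x = slope K (p i) \<bullet> x + b"
      using slope[OF that] by metis
    then obtain b where b: "\<And>i x. x \<in> closure K \<Longrightarrow> nodal_basis \<T> (p i) x = slope K (p i) \<bullet> x + b i"
      by metis
    have "v x = (\<Sum>i\<in>I. c i * b i)" if "x \<in> closure K" for x
    proof -
      have "v x = (\<Sum>i\<in>I. c i *\<^sub>R slope K (p i)) \<bullet> x + (\<Sum>i\<in>I. c i * b i)"
        by (simp add: v_def b[OF that] inner_sum_left sum.distrib algebra_simps)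
      then show ?thesis using zero[OF \<open>K \<in> \<T>\<close>] by simp
    qed
    then show ?thesis by blast
  qed
  then obtain d where d: "\<And>K x. K \<in> \<T> \<Longrightarrow> x \<in> closure K \<Longrightarrow> v x = d K" by metis
  \<comment> \<open>A continuous function with finitely many values on a connected set is constant.\<close>
  then have "v ` closure \<Omega> \<subseteq> d ` \<T>" by (auto simp: domain_eq)
  then have "finite (v ` closure \<Omega>)" using finite_mesh finite_surj by blast
  moreover have "connected (v ` closure \<Omega>)"
  proof (rule connected_continuous_image)
    show "continuous_on (closure \<Omega>) v"
      unfolding v_def[abs_def] by (intro continuous_intros P1_continuous nodal_basis_P1)
    show "connected (closure \<Omega>)" using domain by (simp add: convex_connected convex_closure)
  qed
  ultimately have "v ` closure \<Omega> = {} \<or> (\<exists>z. v ` closure \<Omega> = {z})"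
    by (simp add: connected_finite_iff_sing)
  then obtain z where "v ` closure \<Omega> = {z}" using xy(1) by (metis empty_iff image_is_empty)
  then have "v x = z" "v y = z" using xy by blast+
  then show ?thesis by (simp add: v_def)
qed

end


section \<open>The surface mesh\<close>

text \<open>The facet \<open>C\<close> spans a supporting hyperplane that does not contain the
  affine hull of \<open>A\<close>, as otherwise \<open>A\<close> would lie in \<open>C\<close>.
  Applied both to two different facets of the domain and to a boundary cell with one of its own
  facets.\<close>

lemma facet_null_set:
  fixes S :: "'a::euclidean_space set"
  assumes P: "polyhedron P" "C facet_of P" and A: "A \<subseteq> P" "\<not> A \<subseteq> C" "affine hull A = affine hull S"
    and "A \<inter> C \<in> sets borel"
  shows "A \<inter> C \<in> null_sets (flat_lebesgue S)"
proof (cases "A \<inter> C = {}")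
  case False
  then obtain x0 where x0: "x0 \<in> A" "x0 \<in> C" by blast
  then have "x0 \<in> affine hull S" using A(3) hull_inc by metis
  then have S: "S \<noteq> {}" by auto
  interpret complete_measure "flat_lebesgue S" by (rule complete_flat_lebesgue[OF S])
  obtain n c where nc: "P \<subseteq> {x. n \<bullet> x \<le> c}" "C = P \<inter> {x. n \<bullet> x = c}"
    using facet_of_polyhedron[OF P] by metis
  have "\<not> affine hull S \<subseteq> {x. n \<bullet> x = c}"
  proof
    assume "affine hull S \<subseteq> {x. n \<bullet> x = c}"
    then have "A \<subseteq> {x. n \<bullet> x = c}" using hull_subset[of A affine] A(3) by blast
    then show False using A nc by blast
  qed
  moreover have "n \<bullet> x0 = c" using x0 nc by blast
  ultimately have "{x. n \<bullet> x = c} \<in> null_sets (flat_lebesgue S)"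
    using flat_lebesgue_hyperplane[OF S _ \<open>x0 \<in> affine hull S\<close>] by blast
  then show ?thesis
    by (rule complete2[rotated]) (use nc in blast)
qed simp

lemma aff_dim_eq_imp_affine_hull_eq:
  fixes S T :: "'a::euclidean_space set"
  assumes "S \<subseteq> T" "S \<noteq> {}" "aff_dim S = aff_dim T"
  shows "affine hull S = affine hull T"
  using assms by (intro affine_dim_equal) (auto simp: hull_mono)

locale bulk_surface_mesh = bulk_mesh \<T> \<Omega> for \<T> :: "'a::euclidean_space set set" and \<Omega> +
  fixes \<T>\<^sub>\<Gamma> :: "'a set set"
  assumes polytope: "polytope (closure \<Omega>)"
    and surface_partition: "simplicial_partition (int DIM('a) - 1) \<T>\<^sub>\<Gamma> (frontier \<Omega>)"
    and trace: "\<And>K\<^sub>\<Gamma>. K\<^sub>\<Gamma> \<in> \<T>\<^sub>\<Gamma> \<Longrightarrow> \<exists>K\<in>\<T>. closure K\<^sub>\<Gamma> = closure K \<inter> frontier \<Omega>"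
begin

lemma aff_dim_domain: "aff_dim (closure \<Omega>) = int DIM('a)"
  using domain by (simp add: aff_dim_open)

lemma frontier_eq_facets: "frontier \<Omega> = \<Union>{F. F facet_of closure \<Omega>}"
proof -
  have "rel_interior (closure \<Omega>) = \<Omega>"
    using interior_rel_interior[OF aff_dim_domain] interior_closure_domain by simp
  then have "rel_frontier (closure \<Omega>) = frontier \<Omega>"
    using domain by (simp add: rel_frontier_def frontier_def interior_open)
  then show ?thesis
    using rel_frontier_of_polyhedron[OF polytope_imp_polyhedron[OF polytope]] by simp
qed

lemma finite_facets: "finite {F. F facet_of closure \<Omega>}"
  by (rule finite_polytope_facets[OF polytope])

lemma facet_face: "F facet_of closure \<Omega> \<Longrightarrow> F face_of closure \<Omega>"
  and facet_nonempty: "F facet_of closure \<Omega> \<Longrightarrow> F \<noteq> {}"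
  and aff_dim_facet: "F facet_of closure \<Omega> \<Longrightarrow> aff_dim F = int DIM('a) - 1"
  using aff_dim_domain by (auto simp: facet_of_def)

lemma compact_facet: "F facet_of closure \<Omega> \<Longrightarrow> compact F"
  using facet_face polytope_imp_compact[OF polytope] face_of_imp_compact domain(4) convex_closure
  by metis

lemma facet_subset_imp_eq:
  assumes "F facet_of closure \<Omega>" "F' facet_of closure \<Omega>" "F \<subseteq> F'"
  shows "F = F'"
proof (rule ccontr)
  assume "F \<noteq> F'"
  have "F face_of F'"
    using face_of_subset[OF facet_face[OF assms(1)] assms(3)] facet_face[OF assms(2)] face_of_imp_subset
    by blast
  then have "aff_dim F < aff_dim F'"
    using face_of_aff_dim_lt \<open>F \<noteq> F'\<close> facet_face[OF assms(2)] face_of_imp_convex by blast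
  then show False using assms aff_dim_facet by simp
qed

text \<open>A face that meets the relative interior of a convex subset contains that subset. Hence
  the facet mentioned in \<open>surface_grad\<close> is determined by the point.\<close>

lemma rel_interior_facet_disjoint:
  assumes "F facet_of closure \<Omega>" "F' facet_of closure \<Omega>" "x \<in> rel_interior F" "x \<in> F'"
  shows "F = F'"
proof -
  have "F \<subseteq> F'"
    by (rule subset_of_face_of[OF facet_face[OF assms(2)]])
      (use assms facet_face face_of_imp_subset in blast)+
  then show ?thesis using assms facet_subset_imp_eq by blast
qed

lemma
  assumes "K \<in> \<T>\<^sub>\<Gamma>"
  shows surface_cell_simplex: "(int DIM('a) - 1) simplex closure K"
    and surface_cell_rel_interior: "K = rel_interior (closure K)"
    and surface_cell_nonempty: "K \<noteq> {}"
proof -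
  obtain S where S: "(int DIM('a) - 1) simplex S" "K = rel_interior S"
    using surface_partition assms by (auto simp: simplicial_partition_def)
  then have cl: "closure K = S" by (simp add: closure_rel_interior_simplex)
  then show "(int DIM('a) - 1) simplex closure K" "K = rel_interior (closure K)"
    using S by auto
  have "S \<noteq> {}" using aff_dim_simplex[OF S(1)] DIM_positive[where 'a='a] by auto
  then show "K \<noteq> {}" using S convex_simplex rel_interior_eq_empty by blast
qed

text \<open>A boundary cell cannot bend around an edge of the domain: a facet through one of its
  relatively interior points contains the whole closed cell. Equality of dimensions then identifies
  the affine hulls.\<close>

lemma surface_cell_facet:
  assumes K: "K \<in> \<T>\<^sub>\<Gamma>"
  obtains F where "F facet_of closure \<Omega>" "closure K \<subseteq> F" "affine hull (closure K) = affine hull F"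
    "K \<subseteq> rel_interior F"
proof -
  have sub: "closure K \<subseteq> frontier \<Omega>"
    using surface_partition K by (auto simp: simplicial_partition_def)
  obtain z where z: "z \<in> K" using surface_cell_nonempty[OF K] by blast
  then have "z \<in> frontier \<Omega>" using sub closure_subset by blast
  then obtain F where F: "F facet_of closure \<Omega>" "z \<in> F"
    by (auto simp: frontier_eq_facets)
  have "closure K \<subseteq> F"
  proof (rule subset_of_face_of[OF facet_face[OF F(1)]])
    show "closure K \<subseteq> closure \<Omega>" using sub by (auto simp: frontier_def)
    show "F \<inter> rel_interior (closure K) \<noteq> {}"
      using z F(2) surface_cell_rel_interior[OF K] by blast
  qed
  moreover have hull: "affine hull (closure K) = affine hull F"
    using aff_dim_simplex[OF surface_cell_simplex[OF K]] aff_dim_facet[OF F(1)] calculation z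
    by (intro aff_dim_eq_imp_affine_hull_eq) (auto intro: closure_subset[THEN subsetD])
  moreover have "K \<subseteq> rel_interior F"
    using rel_interior_mono[OF \<open>closure K \<subseteq> F\<close> hull] surface_cell_rel_interior[OF K] by blast
  ultimately show thesis using that F(1) by blast
qed

lemma surface_cell_face:
  assumes "K\<^sub>\<Gamma> \<in> \<T>\<^sub>\<Gamma>"
  obtains K where "K \<in> \<T>" "closure K\<^sub>\<Gamma> = closure K \<inter> frontier \<Omega>" "closure K\<^sub>\<Gamma> face_of closure K"
proof -
  obtain K where K: "K \<in> \<T>" "closure K\<^sub>\<Gamma> = closure K \<inter> frontier \<Omega>" using trace assms by blast
  obtain F where F: "F facet_of closure \<Omega>" "closure K\<^sub>\<Gamma> \<subseteq> F"
    using surface_cell_facet[OF assms] by metis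
  have "F \<subseteq> frontier \<Omega>" using F(1) by (auto simp: frontier_eq_facets)
  \<comment> \<open>Replacing the whole boundary by the single facet \<open>F\<close> turns the
    trace into the slice of a face by a convex cell, which is a face of that cell.\<close>
  then have eq: "closure K\<^sub>\<Gamma> = F \<inter> closure K" using K(2) F(2) by blast
  have "convex (closure K)" using cell_simplex[OF K(1)] convex_simplex by blast
  then have "F \<inter> closure K face_of closure \<Omega> \<inter> closure K"
    by (rule face_of_slice[OF facet_face[OF F(1)]])
  moreover have "closure \<Omega> \<inter> closure K = closure K" using K(1) domain_eq by blast
  ultimately show thesis using that K eq by simp
qed

text \<open>Conformity is inherited from the bulk: boundary cells are faces of bulk cells, and faces
  of two simplices that meet in a common face again meet in a common face.\<close>

lemma surface_conforming: "conforming \<T>\<^sub>\<Gamma>"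
  unfolding conforming_def
proof (intro ballI)
  fix K\<^sub>\<Gamma> L\<^sub>\<Gamma> assume "K\<^sub>\<Gamma> \<in> \<T>\<^sub>\<Gamma>" "L\<^sub>\<Gamma> \<in> \<T>\<^sub>\<Gamma>"
  then obtain K L where K: "K \<in> \<T>" "closure K\<^sub>\<Gamma> face_of closure K"
    and L: "L \<in> \<T>" "closure L\<^sub>\<Gamma> face_of closure L"
    using surface_cell_face by metis
  show "closure K\<^sub>\<Gamma> \<inter> closure L\<^sub>\<Gamma> face_of closure K\<^sub>\<Gamma> \<and> closure K\<^sub>\<Gamma> \<inter> closure L\<^sub>\<Gamma> face_of closure L\<^sub>\<Gamma>"
    by (rule face_of_Int_subface[OF _ _ K(2) L(2)])
      (use conforming K(1) L(1) in \<open>auto simp: conforming_def\<close>)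
qed

sublocale surface: simplicial_mesh "int DIM('a) - 1" \<T>\<^sub>\<Gamma> "frontier \<Omega>"
  using surface_partition surface_conforming by unfold_locales

lemma interior_vertex_exists: "\<exists>p\<in>mesh_vertices \<T>. p \<notin> frontier \<Omega>"
proof (rule ccontr)
  assume "\<not> (\<exists>p\<in>mesh_vertices \<T>. p \<notin> frontier \<Omega>)"
  then have sub: "mesh_vertices \<T> \<subseteq> frontier \<Omega>" by blast
  have "frontier \<Omega> \<noteq> {}"
    using domain(2,3) by (metis frontier_eq_empty not_bounded_UNIV)
  then obtain K\<^sub>\<Gamma> where K\<^sub>\<Gamma>: "K\<^sub>\<Gamma> \<in> \<T>\<^sub>\<Gamma>" using surface.domain_eq by blast
  obtain K where K: "K \<in> \<T>" "closure K\<^sub>\<Gamma> = closure K \<inter> frontier \<Omega>"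
    using surface_cell_face[OF K\<^sub>\<Gamma>] by metis
  have "corners K \<subseteq> closure K\<^sub>\<Gamma>"
    using K sub corners_subset[OF K(1)] vertices_eq by blast
  then have "closure K \<subseteq> closure K\<^sub>\<Gamma>"
    unfolding cell_hull[OF K(1)]
    using surface_cell_simplex[OF K\<^sub>\<Gamma>] convex_simplex by (intro hull_minimal) auto
  then have "aff_dim (closure K) \<le> aff_dim (closure K\<^sub>\<Gamma>)" by (rule aff_dim_subset)
  then show False
    using aff_dim_simplex[OF cell_simplex[OF K(1)]] aff_dim_simplex[OF surface_cell_simplex[OF K\<^sub>\<Gamma>]]
    by simp
qed

section \<open>Integration and surface gradients on a single facet\<close>

definition facet_cells :: "'a set \<Rightarrow> 'a set set" where
  "facet_cells F = {K \<in> \<T>\<^sub>\<Gamma>. K \<subseteq> F}"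

lemma facet_cell:
  assumes F: "F facet_of closure \<Omega>" and K: "K \<in> facet_cells F"
  shows "K \<in> \<T>\<^sub>\<Gamma>" "closure K \<subseteq> F" "affine hull (closure K) = affine hull F" "K \<subseteq> rel_interior F"
proof -
  show K': "K \<in> \<T>\<^sub>\<Gamma>" using K by (simp add: facet_cells_def)
  obtain F' where F': "F' facet_of closure \<Omega>" "closure K \<subseteq> F'"
    "affine hull (closure K) = affine hull F'" "K \<subseteq> rel_interior F'"
    using surface_cell_facet[OF K'] by metis
  obtain z where z: "z \<in> K" using surface_cell_nonempty[OF K'] by blast
  have "F' = F"
    by (rule rel_interior_facet_disjoint[of _ _ z]) (use F F' z K in \<open>auto simp: facet_cells_def\<close>)
  then show "closure K \<subseteq> F" "affine hull (closure K) = affine hull F" "K \<subseteq> rel_interior F"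
    using F' by auto
qed

text \<open>An uncovered point of \<open>F\<close> lies in the closure of some boundary cell. If
  that cell belongs to another facet, the point is on the overlap of two facets; otherwise it is on
  the relative boundary of a cell. Both possibilities form finite unions of sets that are null by
  \<open>facet_null_set\<close>.\<close>

lemma facet_null_complement:
  assumes F: "F facet_of closure \<Omega>"
  shows "F - \<Union>(facet_cells F) \<in> null_sets (flat_lebesgue F)"
proof -
  interpret complete_measure "flat_lebesgue F" by (rule complete_flat_lebesgue[OF facet_nonempty[OF F]])
  define N where "N = (\<Union>F'\<in>{F'. F' facet_of closure \<Omega>} - {F}. F \<inter> F') \<union>
    (\<Union>K\<in>facet_cells F. \<Union>C\<in>{C. C facet_of closure K}. closure K \<inter> C)"
  have closed: "closed F'" if "F' facet_of closure \<Omega>" for F'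
    using compact_facet[OF that] compact_imp_closed by blast
  have "(\<Union>F'\<in>{F'. F' facet_of closure \<Omega>} - {F}. F \<inter> F') \<in> null_sets (flat_lebesgue F)"
  proof (rule null_sets.finite_UN)
    fix F' assume F': "F' \<in> {F'. F' facet_of closure \<Omega>} - {F}"
    show "F \<inter> F' \<in> null_sets (flat_lebesgue F)"
      by (rule facet_null_set[OF polytope_imp_polyhedron[OF polytope]])
        (use F F' facet_subset_imp_eq[of F F'] facet_face[OF F] face_of_imp_subset closed[of F'] closed[OF F]
          in \<open>auto intro: borel_closed\<close>)
  qed (use finite_facets in auto)
  moreover have "(\<Union>K\<in>facet_cells F. \<Union>C\<in>{C. C facet_of closure K}. closure K \<inter> C) \<in> null_sets (flat_lebesgue F)"
  proof (intro null_sets.finite_UN)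
    fix K C assume K: "K \<in> facet_cells F" and C: "C \<in> {C. C facet_of closure K}"
    have K': "K \<in> \<T>\<^sub>\<Gamma>" by (rule facet_cell[OF F K])
    have poly: "polyhedron (closure K)"
      using surface_cell_simplex[OF K'] simplex_imp_polyhedron by blast
    have "\<not> closure K \<subseteq> C"
    proof
      assume "closure K \<subseteq> C"
      then have "aff_dim (closure K) \<le> aff_dim C" by (rule aff_dim_subset)
      then show False using C by (auto simp: facet_of_def)
    qed
    moreover have "closed C"
      using C poly by (meson facet_of_def face_of_polyhedron_polyhedron mem_Collect_eq polyhedron_imp_closed)
    ultimately show "closure K \<inter> C \<in> null_sets (flat_lebesgue F)"
      using C by (intro facet_null_set[OF poly _ _ _ facet_cell(3)[OF F K]]) (auto intro: borel_closed)
  next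
    fix K assume "K \<in> facet_cells F"
    then have "polytope (closure K)"
      using surface_cell_simplex facet_cell(1)[OF F] simplex_imp_polytope by blast
    then show "finite {C. C facet_of closure K}" by (rule finite_polytope_facets)
  qed (use surface.finite_mesh in \<open>simp add: facet_cells_def\<close>)
  ultimately have "N \<in> null_sets (flat_lebesgue F)" unfolding N_def by (rule null_sets.Un)
  moreover have "F - \<Union>(facet_cells F) \<subseteq> N"
  proof
    fix x assume x: "x \<in> F - \<Union>(facet_cells F)"
    then have "x \<in> frontier \<Omega>" using F frontier_eq_facets by blast
    then obtain K where K: "K \<in> \<T>\<^sub>\<Gamma>" "x \<in> closure K" using surface.domain_eq by blast
    obtain F' where F': "F' facet_of closure \<Omega>" "closure K \<subseteq> F'"
      using surface_cell_facet[OF K(1)] by metis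
    show "x \<in> N"
    proof (cases "F' = F")
      case False
      then show ?thesis using F' K x unfolding N_def by blast
    next
      case True
      then have K': "K \<in> facet_cells F"
        using F'(2) K(1) closure_subset[of K] by (auto simp: facet_cells_def)
      then have "x \<notin> rel_interior (closure K)"
        using x surface_cell_rel_interior[OF K(1)] by blast
      then have "x \<in> rel_frontier (closure K)" using K(2) by (simp add: rel_frontier_def)
      then obtain C where "C facet_of closure K" "x \<in> C"
        using rel_frontier_of_polyhedron[OF simplex_imp_polyhedron[OF surface_cell_simplex[OF K(1)]]]
        by auto
      then show ?thesis using K' K(2) unfolding N_def by blast
    qed
  qed
  ultimately show ?thesis by (rule complete2[rotated])
qed

text \<open>The value is the orthogonal projection, onto the directions of the facet, of the slope
  of \<open>v\<close> on the cell. It has to be shown that this projection is a derivative within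
  the boundary and that no other tangential vector is.\<close>

lemma surface_grad_constant:
  assumes v: "v \<in> P1 \<T>\<^sub>\<Gamma>" and F: "F facet_of closure \<Omega>" and K: "K \<in> facet_cells F"
  obtains g where "\<And>x. x \<in> K \<Longrightarrow> surface_grad \<Omega> v x = g"
proof -
  note K' = facet_cell[OF F K]
  obtain a b where ab: "\<And>x. x \<in> closure K \<Longrightarrow> v x = a \<bullet> x + b"
    using surface.P1_affine_on_closure[OF v K'(1)] by blast
  let ?V = "{y - z | y z. y \<in> F \<and> z \<in> F}"
  \<comment> \<open>The normal part \<open>g'\<close> of the slope is invisible to differences of
    points of \<open>F\<close>, so only the tangential part \<open>g\<close> is seen along the
    facet.\<close>
  obtain g g' where g: "g \<in> span ?V" "\<And>w. w \<in> span ?V \<Longrightarrow> real_inner_class.orthogonal g' w" "a = g + g'"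
    by (rule orthogonal_subspace_decomp_exists[of ?V a]) blast
  have ag: "a \<bullet> (y - x) = (y - x) \<bullet> g" if "x \<in> F" "y \<in> F" for x y
  proof -
    have "y - x \<in> span ?V" using that by (intro span_base) auto
    then have "g' \<bullet> (y - x) = 0" using g(2) by (simp add: real_inner_class.orthogonal_def)
    then show ?thesis by (metis g(3) inner_add_left inner_commute add_0_right)
  qed
  obtain U where U: "open U" "rel_interior (closure K) = affine hull (closure K) \<inter> U"
    by (rule rel_interior_eq_affine_Int_open)
  then have U: "open U" "K = affine hull F \<inter> U"
    unfolding surface_cell_rel_interior[OF K'(1), symmetric] K'(3) .
  have "surface_grad \<Omega> v x = g" if x: "x \<in> K" for x
  proof -
    have xF: "x \<in> rel_interior F" "x \<in> F" using x K'(4) rel_interior_subset by auto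
    \<comment> \<open>Removing the other facets leaves a neighbourhood of \<open>x\<close> in which
      the boundary of the domain reduces to the cell \<open>K\<close>, where \<open>v\<close> is
      affine.\<close>
    define W where "W = U - \<Union>({F'. F' facet_of closure \<Omega>} - {F})"
    have "open W" unfolding W_def
      using finite_facets compact_facet compact_imp_closed U(1) by (intro open_Diff closed_Union) auto
    moreover have "x \<in> W"
      using x U(2) rel_interior_facet_disjoint[OF F _ xF(1)] unfolding W_def by blast
    ultimately obtain e where e: "e > 0" "ball x e \<subseteq> W" using open_contains_ball by blast
    have near: "y \<in> K" "y \<in> F" if "y \<in> frontier \<Omega>" "dist y x < e" for y
    proof -
      have "y \<in> W" using e(2) that(2) by (auto simp: dist_commute)
      then show "y \<in> F" using that(1) by (auto simp: W_def frontier_eq_facets)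
      then show "y \<in> K" using \<open>y \<in> W\<close> U(2) by (auto simp: W_def hull_inc)
    qed
    have x_frontier: "x \<in> frontier \<Omega>" using F xF(2) frontier_eq_facets by blast
    have deriv: "(v has_derivative (\<lambda>k. k \<bullet> g)) (at x within frontier \<Omega>)"
    proof (rule has_derivative_transform_within[OF _ e(1) x_frontier])
      show "((\<lambda>y. v x + (y - x) \<bullet> g) has_derivative (\<lambda>k. k \<bullet> g)) (at x within frontier \<Omega>)"
        by (auto intro!: derivative_eq_intros)
      fix y assume y: "y \<in> frontier \<Omega>" "dist y x < e"
      have "v y = a \<bullet> y + b" "v x = a \<bullet> x + b"
        using ab x near(1)[OF y] closure_subset by blast+
      then show "v x + (y - x) \<bullet> g = v y"
        using ag[OF xF(2) near(2)[OF y]] by (simp add: inner_diff_right)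
    qed
    show ?thesis unfolding surface_grad_def
    proof (rule the_equality)
      show "\<exists>F. F facet_of closure \<Omega> \<and> x \<in> rel_interior F \<and> g \<in> span {y - z | y z. y \<in> F \<and> z \<in> F} \<and>
          (v has_derivative (\<lambda>k. k \<bullet> g)) (at x within frontier \<Omega>)"
        using F xF g(1) deriv by blast
    next
      fix h assume "\<exists>F. F facet_of closure \<Omega> \<and> x \<in> rel_interior F \<and> h \<in> span {y - z | y z. y \<in> F \<and> z \<in> F} \<and>
          (v has_derivative (\<lambda>k. k \<bullet> h)) (at x within frontier \<Omega>)"
      then obtain F' where F': "F' facet_of closure \<Omega>" "x \<in> rel_interior F'"
        "h \<in> span {y - z | y z. y \<in> F' \<and> z \<in> F'}" and h: "(v has_derivative (\<lambda>k. k \<bullet> h)) (at x within frontier \<Omega>)"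
        by blast
      have "F' = F" by (rule rel_interior_facet_disjoint[OF F'(1) F F'(2) xF(2)])
      then have hg: "h - g \<in> span ?V" using F'(3) g(1) by (simp add: span_diff)
      have hull: "x + s *\<^sub>R (h - g) \<in> affine hull F" for s
      proof -
        have "?V \<subseteq> (\<lambda>y. - x + y) ` (affine hull F)"
        proof
          fix u assume "u \<in> ?V"
          then obtain y z where yz: "y \<in> F" "z \<in> F" "u = y - z" by blast
          have "1 *\<^sub>R x + 1 *\<^sub>R y + (-1) *\<^sub>R z \<in> affine hull F"
            by (rule mem_affine_3[OF affine_affine_hull]) (use yz xF(2) in \<open>auto intro: hull_inc\<close>)
          then show "u \<in> (\<lambda>y. - x + y) ` (affine hull F)"
            by (intro image_eqI[of _ _ "x + y - z"]) (auto simp: yz(3))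
        qed
        moreover have "subspace ((\<lambda>y. - x + y) ` (affine hull F))"
          using affine_diffs_subspace[OF affine_affine_hull, of x F] xF(2) by (simp add: hull_inc)
        ultimately have "span ?V \<subseteq> (\<lambda>y. - x + y) ` (affine hull F)" by (rule span_minimal)
        then have "s *\<^sub>R (h - g) \<in> (\<lambda>y. - x + y) ` (affine hull F)"
          using span_scale[OF hg] by blast
        then show ?thesis by auto
      qed
      obtain d where d: "d > 0" "ball x d \<inter> affine hull F \<subseteq> F"
        using xF(1) mem_rel_interior_ball by blast
      \<comment> \<open>Chosen so that the segment in direction \<open>h - g\<close> stays in the
        ball of radius \<open>d\<close>; the added 1 is needed because \<open>h - g\<close> may be
        0.\<close>
      define \<delta> where "\<delta> = d / (norm (h - g) + 1)"
      have pos: "0 < norm (h - g) + 1" by (rule add_nonneg_pos) auto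
      then have "\<delta> > 0" using d(1) by (simp add: \<delta>_def)
      moreover have "x + t *\<^sub>R (h - g) \<in> frontier \<Omega>" if "\<bar>t\<bar> < \<delta>" for t
      proof -
        have "\<bar>t\<bar> * norm (h - g) \<le> \<bar>t\<bar> * (norm (h - g) + 1)" by (intro mult_left_mono) auto
        also have "\<dots> < d" using that pos by (simp add: \<delta>_def pos_less_divide_eq)
        finally have "x + t *\<^sub>R (h - g) \<in> ball x d" by (simp add: dist_norm)
        then have "x + t *\<^sub>R (h - g) \<in> F" using d(2) hull by blast
        then show ?thesis using F frontier_eq_facets by blast
      qed
      ultimately show "h = g"
        by (intro has_derivative_within_affine_unique[OF h deriv])
    qed
  qed
  then show thesis using that by blast
qed

lemma facet_fmeasurable:
  assumes F: "F facet_of closure \<Omega>"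
  shows "F \<in> fmeasurable (flat_lebesgue F)"
  using compact_facet[OF F] facet_nonempty[OF F]
  by (intro fmeasurable_flat_lebesgue) (auto intro: borel_closed compact_imp_closed compact_imp_bounded)

lemma facet_cell_fmeasurable:
  assumes F: "F facet_of closure \<Omega>" and K: "K \<in> facet_cells F"
  shows "K \<in> fmeasurable (flat_lebesgue F)"
proof (rule fmeasurable_flat_lebesgue[OF facet_nonempty[OF F]])
  show "K \<in> sets borel"
    using borel_rel_interior surface_cell_rel_interior[OF facet_cell(1)[OF F K]] by metis
  show "bounded K"
    using compact_facet[OF F] compact_imp_bounded bounded_subset K by (auto simp: facet_cells_def)
qed

text \<open>The order of quantifiers matters: one family \<open>g\<close> serves all pairs of
  vertices, which is what turns the matrix into a Gram matrix.\<close>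

lemma surface_stiffness_entry:
  obtains g :: "'a set \<Rightarrow> 'a set \<Rightarrow> 'a \<Rightarrow> 'a" where "\<And>p q. boundary_integral \<Omega>
      (\<lambda>x. surface_grad \<Omega> (nodal_basis \<T>\<^sub>\<Gamma> p) x \<bullet> surface_grad \<Omega> (nodal_basis \<T>\<^sub>\<Gamma> q) x)
    = (\<Sum>F | F facet_of closure \<Omega>. \<Sum>K\<in>facet_cells F. measure (flat_lebesgue F) K * (g F K p \<bullet> g F K q))"
proof -
  have "\<exists>g. \<forall>x\<in>K. surface_grad \<Omega> (nodal_basis \<T>\<^sub>\<Gamma> p) x = g"
    if "F facet_of closure \<Omega>" "K \<in> facet_cells F" for F K p
    using surface_grad_constant[OF surface.nodal_basis_P1 that] by metis
  then obtain g where g: "\<And>F K p x. F facet_of closure \<Omega> \<Longrightarrow> K \<in> facet_cells F \<Longrightarrow> x \<in> K \<Longrightarrow>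
      surface_grad \<Omega> (nodal_basis \<T>\<^sub>\<Gamma> p) x = g F K p"
    by metis
  have "(LINT x:F|flat_lebesgue F. surface_grad \<Omega> (nodal_basis \<T>\<^sub>\<Gamma> p) x \<bullet> surface_grad \<Omega> (nodal_basis \<T>\<^sub>\<Gamma> q) x)
    = (\<Sum>K\<in>facet_cells F. measure (flat_lebesgue F) K * (g F K p \<bullet> g F K q))"
    if F: "F facet_of closure \<Omega>" for F p q
  proof (rule complete_measure.set_integral_piecewise_constant[OF complete_flat_lebesgue[OF facet_nonempty[OF F]]])
    show "finite (facet_cells F)" using surface.finite_mesh by (simp add: facet_cells_def)
    show "pairwise disjnt (facet_cells F)"
      using surface.cells_disjoint by (rule pairwise_subset) (auto simp: facet_cells_def)
    show "F - \<Union>(facet_cells F) \<in> null_sets (flat_lebesgue F)" by (rule facet_null_complement[OF F])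
    fix K assume K: "K \<in> facet_cells F"
    show "K \<in> fmeasurable (flat_lebesgue F)" by (rule facet_cell_fmeasurable[OF F K])
    show "K \<subseteq> F" using K by (simp add: facet_cells_def)
    show "surface_grad \<Omega> (nodal_basis \<T>\<^sub>\<Gamma> p) x \<bullet> surface_grad \<Omega> (nodal_basis \<T>\<^sub>\<Gamma> q) x = g F K p \<bullet> g F K q"
      if "x \<in> K" for x using g[OF F K that] by simp
  qed
  then show thesis by (intro that[of g]) (simp add: boundary_integral_def)
qed

lemma surface_mass_entry:
  assumes "p \<in> mesh_vertices \<T>\<^sub>\<Gamma>" "q \<in> mesh_vertices \<T>\<^sub>\<Gamma>"
  shows "p \<noteq> q \<Longrightarrow> boundary_integral \<Omega> (interpolant \<T>\<^sub>\<Gamma> (\<lambda>y. nodal_basis \<T>\<^sub>\<Gamma> p y * nodal_basis \<T>\<^sub>\<Gamma> q y)) = 0"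
    and "0 < boundary_integral \<Omega> (interpolant \<T>\<^sub>\<Gamma> (\<lambda>y. nodal_basis \<T>\<^sub>\<Gamma> p y * nodal_basis \<T>\<^sub>\<Gamma> p y))"
proof -
  show "p \<noteq> q \<Longrightarrow> boundary_integral \<Omega> (interpolant \<T>\<^sub>\<Gamma> (\<lambda>y. nodal_basis \<T>\<^sub>\<Gamma> p y * nodal_basis \<T>\<^sub>\<Gamma> q y)) = 0"
    by (simp add: surface.interpolant_nodal_product[OF assms] set_lebesgue_integral_def boundary_integral_def)
  let ?v = "nodal_basis \<T>\<^sub>\<Gamma> p"
  have cont: "continuous_on (frontier \<Omega>) ?v" by (rule surface.P1_continuous[OF surface.nodal_basis_P1])
  have vp: "?v p = 1" using surface.nodal_basis_vertex[OF assms(1)] by simp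
  have p: "p \<in> frontier \<Omega>" using assms(1) surface.vertices_subset by blast
  then obtain F where F: "F facet_of closure \<Omega>" "p \<in> F" by (auto simp: frontier_eq_facets)
  have sub: "F' \<subseteq> frontier \<Omega>" if "F' facet_of closure \<Omega>" for F' using that by (auto simp: frontier_eq_facets)
  have "\<exists>d>0. \<forall>y\<in>frontier \<Omega>. dist y p < d \<longrightarrow> dist (?v y) (?v p) < 1"
    using bspec[OF cont[unfolded continuous_on_iff] p, rule_format, of 1] by simp
  then obtain d where d: "d > 0" "\<And>y. y \<in> frontier \<Omega> \<Longrightarrow> dist y p < d \<Longrightarrow> dist (?v y) (?v p) < 1"
    by blast
  have "0 < (LINT x:F|flat_lebesgue F. ?v x)"
  proof (rule set_integral_pos)
    show "set_integrable (flat_lebesgue F) F ?v"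
      by (rule set_integrable_continuous_compact[OF compact_facet[OF F(1)] facet_fmeasurable[OF F(1)]
          continuous_on_subset[OF cont sub[OF F(1)]] borel_measurable_flat_lebesgue[OF facet_nonempty[OF F(1)]]])
    have "convex F" using facet_face[OF F(1)] face_of_imp_convex by blast
    then have "p \<in> closure (rel_interior F)"
      using convex_closure_rel_interior F(2) closure_subset by blast
    \<comment> \<open>The vertex itself may lie on the relative boundary of \<open>F\<close>. A
      relatively interior point \<open>y\<close> close to it has a whole flat ball inside
      \<open>F\<close> and within distance \<open>d\<close> of the vertex, and such balls have
      positive measure.\<close>
    then obtain y where y: "y \<in> rel_interior F" "dist y p < d" using d(1) closure_approachable by metis
    obtain e where e: "e > 0" "ball y e \<inter> affine hull F \<subseteq> F" using y(1) mem_rel_interior_ball by blast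
    let ?A = "ball p d \<inter> F"
    have "?A \<in> sets borel"
      using compact_facet[OF F(1)] by (intro sets.Int) (auto intro: borel_closed compact_imp_closed)
    then show "?A \<in> sets (flat_lebesgue F)" by (rule sets_flat_lebesgue[OF facet_nonempty[OF F(1)]])
    show "0 < emeasure (flat_lebesgue F) ?A"
    proof (rule flat_lebesgue_pos[OF facet_nonempty[OF F(1)] \<open>?A \<in> sets borel\<close>])
      show "y \<in> affine hull F" using y(1) rel_interior_subset hull_inc by (metis subsetD)
      show "0 < min e (d - dist y p)" using e y by simp
      show "ball y (min e (d - dist y p)) \<inter> affine hull F \<subseteq> ?A"
      proof
        fix w assume w: "w \<in> ball y (min e (d - dist y p)) \<inter> affine hull F"
        have "dist p w \<le> dist y p + dist y w" by (metis dist_commute dist_triangle)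
        then show "w \<in> ?A" using w e(2) by auto
      qed
    qed
    show "?A \<subseteq> F" by blast
    show "0 < ?v x" if "x \<in> ?A" for x
    proof -
      have "x \<in> frontier \<Omega>" "dist x p < d" using that sub[OF F(1)] by (auto simp: dist_commute)
      from d(2)[OF this] show ?thesis by (simp add: vp dist_real_def)
    qed
  qed (rule surface.nodal_basis_nonneg)
  moreover have "0 \<le> (LINT x:F'|flat_lebesgue F'. ?v x)" for F'
    unfolding set_lebesgue_integral_def
    by (intro Bochner_Integration.integral_nonneg) (simp add: surface.nodal_basis_nonneg)
  ultimately have "0 < boundary_integral \<Omega> ?v"
    unfolding boundary_integral_def using F(1) finite_facets
    by (intro sum_pos2[of _ F]) auto
  then show "0 < boundary_integral \<Omega> (interpolant \<T>\<^sub>\<Gamma> (\<lambda>y. nodal_basis \<T>\<^sub>\<Gamma> p y * nodal_basis \<T>\<^sub>\<Gamma> p y))"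
    by (simp add: surface.interpolant_nodal_product[OF assms(1,1)])
qed

end


section \<open>Gradient flow structure of the scheme\<close>

text \<open>Gives semidefiniteness of both stiffness matrices and, when the form vanishes with
  positive weights, the vanishing of every cell gradient.\<close>

lemma gram_quadratic_form:
  fixes G :: "'c \<Rightarrow> 'i \<Rightarrow> 'a::real_inner"
  assumes "\<And>i j. i \<in> J \<Longrightarrow> j \<in> J \<Longrightarrow> A i j = (\<Sum>c\<in>I. w c * (G c i \<bullet> G c j))"
  shows "(\<Sum>i\<in>J. \<Sum>j\<in>J. x i * x j * A i j) = (\<Sum>c\<in>I. w c * (norm (\<Sum>i\<in>J. x i *\<^sub>R G c i))\<^sup>2)"
proof -
  have "(\<Sum>i\<in>J. \<Sum>j\<in>J. x i * x j * A i j)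
      = (\<Sum>i\<in>J. \<Sum>j\<in>J. \<Sum>c\<in>I. w c * ((x i *\<^sub>R G c i) \<bullet> (x j *\<^sub>R G c j)))"
    using assms by (intro sum.cong) (auto simp: sum_distrib_left mult_ac)
  also have "\<dots> = (\<Sum>i\<in>J. \<Sum>c\<in>I. \<Sum>j\<in>J. w c * ((x i *\<^sub>R G c i) \<bullet> (x j *\<^sub>R G c j)))"
    by (intro sum.cong refl sum.swap)
  also have "\<dots> = (\<Sum>c\<in>I. \<Sum>i\<in>J. \<Sum>j\<in>J. w c * ((x i *\<^sub>R G c i) \<bullet> (x j *\<^sub>R G c j)))"
    by (rule sum.swap)
  also have "\<dots> = (\<Sum>c\<in>I. w c * (norm (\<Sum>i\<in>J. x i *\<^sub>R G c i))\<^sup>2)"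
    by (simp only: power2_norm_eq_inner inner_sum_left) (simp only: inner_sum_right sum_distrib_left)
  finally show ?thesis .
qed

lemma has_field_derivative_quadratic_form:
  fixes A :: "nat \<Rightarrow> nat \<Rightarrow> real"
  assumes "\<And>i j. i < n \<Longrightarrow> j < n \<Longrightarrow> A i j = A j i"
  shows "((\<lambda>t. \<Sum>i<n. \<Sum>j<n. (x i + t * y i) * (x j + t * y j) * A i j) has_field_derivative
    2 * (\<Sum>i<n. (\<Sum>j<n. A i j * x j) * y i)) (at 0)"
proof -
  have "((\<lambda>t. \<Sum>i<n. \<Sum>j<n. (x i + t * y i) * (x j + t * y j) * A i j) has_field_derivative
    (\<Sum>i<n. \<Sum>j<n. (x i * y j + y i * x j) * A i j)) (at 0)"
    by (intro DERIV_sum) (auto intro!: derivative_eq_intros simp: algebra_simps)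
  moreover have "(\<Sum>i<n. \<Sum>j<n. (x i * y j + y i * x j) * A i j)
      = (\<Sum>i<n. \<Sum>j<n. x i * y j * A i j) + (\<Sum>i<n. \<Sum>j<n. y i * x j * A i j)"
    by (simp add: sum.distrib algebra_simps)
  moreover have "(\<Sum>i<n. \<Sum>j<n. x i * y j * A i j) = (\<Sum>i<n. \<Sum>j<n. y i * x j * A i j)"
    by (subst sum.swap) (intro sum.cong refl, auto simp: assms mult_ac)
  moreover have "(\<Sum>i<n. \<Sum>j<n. y i * x j * A i j) = (\<Sum>i<n. (\<Sum>j<n. A i j * x j) * y i)"
    by (simp add: sum_distrib_left sum_distrib_right mult_ac)
  ultimately show ?thesis by simp
qed

text \<open>The scheme stripped of matrices: \<open>d\<close> and \<open>d\<^sub>\<Gamma>\<close>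
  are the diagonals of the lumped masses, and the hypothesis on \<open>SI\<close> says that it is a
  right inverse of the matrix S.\<close>

locale discrete_operators =
  fixes n k :: nat and L L\<^sub>\<Gamma> SI :: "nat \<Rightarrow> nat \<Rightarrow> real" and d d\<^sub>\<Gamma> :: "nat \<Rightarrow> real"
    and m m\<^sub>\<Gamma> \<tau> :: real
  assumes k: "k \<le> n"
    and d: "\<And>i. i < n \<Longrightarrow> 0 < d i" and d\<^sub>\<Gamma>: "\<And>i. i < k \<Longrightarrow> 0 < d\<^sub>\<Gamma> i"
    and L_sym: "\<And>i j. i < n \<Longrightarrow> j < n \<Longrightarrow> L i j = L j i"
    and L_psd: "\<And>x. 0 \<le> (\<Sum>i<n. \<Sum>j<n. x i * x j * L i j)"
    and L\<^sub>\<Gamma>_sym: "\<And>i j. i < k \<Longrightarrow> j < k \<Longrightarrow> L\<^sub>\<Gamma> i j = L\<^sub>\<Gamma> j i"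
    and L\<^sub>\<Gamma>_psd: "\<And>x. 0 \<le> (\<Sum>i<k. \<Sum>j<k. x i * x j * L\<^sub>\<Gamma> i j)"
    and SI: "\<And>w i. i < k \<Longrightarrow>
      (\<Sum>j<k. (m * L i j + m\<^sub>\<Gamma> * (d i / d\<^sub>\<Gamma> i * L\<^sub>\<Gamma> i j * (d j / d\<^sub>\<Gamma> j))) * (\<Sum>l<k. SI j l * w l)) = w i"
    and m: "m > 0" "m\<^sub>\<Gamma> > 0" "\<tau> > 0"
begin

text \<open>\<open>pot\<close> is the vector \<open>P\<close> as a linear function of \<open>R\<close>, \<open>pot\<^sub>\<Gamma>\<close> is the boundary potential \<open>\<theta>\<close>, and
  \<open>flow\<close> is the map \<open>q\<close>, extended by zero to the indices beyond \<open>n\<close>.\<close>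

definition pot_rhs :: "(nat \<Rightarrow> real) \<Rightarrow> nat \<Rightarrow> real" where
  "pot_rhs r j = - (m * (\<Sum>l\<in>{k..<n}. L j l * (r l / d l))) + m\<^sub>\<Gamma> * (\<Sum>l<k. d j / d\<^sub>\<Gamma> j * L\<^sub>\<Gamma> j l / d\<^sub>\<Gamma> l * r l)"

definition pot :: "(nat \<Rightarrow> real) \<Rightarrow> nat \<Rightarrow> real" where
  "pot r i = (if i < k then \<Sum>j<k. SI i j * pot_rhs r j else r i / d i)"

definition pot\<^sub>\<Gamma> :: "(nat \<Rightarrow> real) \<Rightarrow> nat \<Rightarrow> real" where
  "pot\<^sub>\<Gamma> r i = (r i - d i * pot r i) / d\<^sub>\<Gamma> i"

definition flow :: "(nat \<Rightarrow> real) \<Rightarrow> nat \<Rightarrow> real" where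
  "flow r i = (if i < n then \<tau> * m * (1 / d i * (\<Sum>j<n. L i j * pot r j)) else 0)"

lemma pot_rhs_linear: "pot_rhs (\<lambda>j. x j + s * y j) i = pot_rhs x i + s * pot_rhs y i"
  by (simp add: pot_rhs_def sum.distrib sum_distrib_left add_divide_distrib algebra_simps)

lemma pot_linear: "pot (\<lambda>j. x j + s * y j) i = pot x i + s * pot y i"
  by (simp add: pot_def pot_rhs_linear sum.distrib sum_distrib_left add_divide_distrib algebra_simps)

lemma flow_linear: "flow (\<lambda>j. x j + s * y j) i = flow x i + s * flow y i"
  by (simp add: flow_def pot_linear sum.distrib sum_distrib_left add_divide_distrib algebra_simps)

lemma flow_continuous: "continuous_on UNIV (\<lambda>r. flow r i)"
proof -
  have coord: "continuous_on UNIV (\<lambda>r::nat \<Rightarrow> real. r i)" for i by simp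
  have "continuous_on UNIV (\<lambda>r. pot_rhs r j)" if "j < k" for j
    unfolding pot_rhs_def
    by (intro continuous_intros coord) (use d k d\<^sub>\<Gamma> that in \<open>fastforce+\<close>)
  then have "continuous_on UNIV (\<lambda>r. pot r j)" if "j < n" for j
    using that d[OF that] by (cases "j < k") (auto simp: pot_def intro!: continuous_intros coord)
  then show ?thesis using d[of i] by (cases "i < n") (auto simp: flow_def intro!: continuous_intros)
qed

lemma split_sum: "(\<Sum>i<n. f i) = (\<Sum>i<k. f i) + (\<Sum>i\<in>{k..<n}. f i)" for f :: "nat \<Rightarrow> real"
  using k by (simp add: lessThan_atLeast0 sum.atLeastLessThan_concat)

lemma flow_boundary:
  assumes i: "i < k"
  shows "m * (\<Sum>j<n. L i j * pot r j) = m\<^sub>\<Gamma> * (d i / d\<^sub>\<Gamma> i * (\<Sum>j<k. L\<^sub>\<Gamma> i j * pot\<^sub>\<Gamma> r j))"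
proof -
  define e where "e j = d j / d\<^sub>\<Gamma> j" for j
  have "(\<Sum>j<k. (m * L i j + m\<^sub>\<Gamma> * (e i * L\<^sub>\<Gamma> i j * e j)) * pot r j) = pot_rhs r i"
    using SI[OF i, of "pot_rhs r"] by (simp add: pot_def e_def)
  \<comment> \<open>\<open>Y\<close> and \<open>X\<close> are the boundary and interior
    contributions to \<open>L P\<close> at \<open>i\<close>; \<open>Z\<close> and \<open>W\<close>
    are the contributions of \<open>R\<close> and of \<open>M P\<close> to
    \<open>L\<^sub>\<Gamma>\<close> applied to the boundary potential, which is therefore
    \<open>Z - W\<close>. The row of S then rearranges to the claimed balance.\<close>
  moreover define X where "X = (\<Sum>l\<in>{k..<n}. L i l * (r l / d l))"
  moreover define Y where "Y = (\<Sum>j<k. L i j * pot r j)"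
  moreover define Z where "Z = (\<Sum>l<k. L\<^sub>\<Gamma> i l * (r l / d\<^sub>\<Gamma> l))"
  moreover define W where "W = (\<Sum>j<k. L\<^sub>\<Gamma> i j * (e j * pot r j))"
  ultimately have "m * Y + m\<^sub>\<Gamma> * e i * W = pot_rhs r i"
    by (simp add: sum.distrib sum_distrib_left algebra_simps)
  moreover have "pot_rhs r i = - (m * X) + m\<^sub>\<Gamma> * e i * Z"
    by (simp add: pot_rhs_def e_def sum_distrib_left X_def Z_def mult_ac)
  ultimately have "m * (Y + X) = m\<^sub>\<Gamma> * (e i * (Z - W))"
    by (simp add: algebra_simps)
  moreover have "(\<Sum>l\<in>{k..<n}. L i l * pot r l) = X"
    unfolding X_def by (intro sum.cong) (auto simp: pot_def)
  moreover have "(\<Sum>j<k. L\<^sub>\<Gamma> i j * pot\<^sub>\<Gamma> r j) = Z - W"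
    by (simp add: pot\<^sub>\<Gamma>_def e_def Z_def W_def sum_subtractf[symmetric] diff_divide_distrib algebra_simps)
  ultimately show ?thesis
    by (simp add: split_sum e_def Y_def)
qed

text \<open>On the boundary \<open>x\<close> splits as mass times \<open>pot\<close> plus surface
  mass times \<open>pot\<^sub>\<Gamma>\<close>; by \<open>flow_boundary\<close> the flow seen by the
  second part can be rewritten with the surface stiffness. In the interior only the first part is
  present. The bilinear form with two arguments yields symmetry as well as semidefiniteness.\<close>

lemma flow_inner:
  "(\<Sum>i<n. x i * flow y i) = \<tau> * m * (\<Sum>i<n. \<Sum>j<n. pot x i * pot y j * L i j)
    + \<tau> * m\<^sub>\<Gamma> * (\<Sum>i<k. \<Sum>j<k. pot\<^sub>\<Gamma> x i * pot\<^sub>\<Gamma> y j * L\<^sub>\<Gamma> i j)"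
proof -
  define u where "u i = (\<Sum>j<n. L i j * pot y j)" for i
  define u\<^sub>\<Gamma> where "u\<^sub>\<Gamma> i = (\<Sum>j<k. L\<^sub>\<Gamma> i j * pot\<^sub>\<Gamma> y j)" for i
  have boundary: "x i * flow y i = \<tau> * m * (pot x i * u i) + \<tau> * m\<^sub>\<Gamma> * (pot\<^sub>\<Gamma> x i * u\<^sub>\<Gamma> i)" if i: "i < k" for i
  proof -
    have x: "x i = d i * pot x i + d\<^sub>\<Gamma> i * pot\<^sub>\<Gamma> x i" using d\<^sub>\<Gamma>[OF i] by (simp add: pot\<^sub>\<Gamma>_def)
    have pos: "d i > 0" "d\<^sub>\<Gamma> i > 0" "i < n" using d d\<^sub>\<Gamma> i k by auto
    have bulk: "d i * flow y i = \<tau> * m * u i" using pos by (simp add: flow_def u_def)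
    then have "flow y i = \<tau> / d i * (m * u i)" using pos by (simp add: field_simps)
    moreover have "m * u i = m\<^sub>\<Gamma> * (d i / d\<^sub>\<Gamma> i * u\<^sub>\<Gamma> i)"
      using flow_boundary[OF i] by (simp add: u_def u\<^sub>\<Gamma>_def)
    ultimately have boundary: "d\<^sub>\<Gamma> i * flow y i = \<tau> * m\<^sub>\<Gamma> * u\<^sub>\<Gamma> i"
      using pos by simp
    have "x i * flow y i = pot x i * (d i * flow y i) + pot\<^sub>\<Gamma> x i * (d\<^sub>\<Gamma> i * flow y i)"
      by (subst x) (simp add: algebra_simps)
    also have "\<dots> = \<tau> * m * (pot x i * u i) + \<tau> * m\<^sub>\<Gamma> * (pot\<^sub>\<Gamma> x i * u\<^sub>\<Gamma> i)"
      unfolding bulk boundary by (simp add: mult_ac)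
    finally show ?thesis .
  qed
  have interior: "x i * flow y i = \<tau> * m * (pot x i * u i)" if "i \<in> {k..<n}" for i
    using that d[of i] by (simp add: flow_def u_def pot_def)
  have "(\<Sum>i<n. x i * flow y i) = \<tau> * m * (\<Sum>i<n. pot x i * u i) + \<tau> * m\<^sub>\<Gamma> * (\<Sum>i<k. pot\<^sub>\<Gamma> x i * u\<^sub>\<Gamma> i)"
    unfolding split_sum using boundary interior by (simp add: sum.distrib sum_distrib_left distrib_left)
  then show ?thesis
    by (simp add: u_def u\<^sub>\<Gamma>_def sum_distrib_left mult_ac)
qed

lemma flow_sym: "(\<Sum>i<n. x i * flow y i) = (\<Sum>i<n. y i * flow x i)"
proof -
  have "(\<Sum>i<n. \<Sum>j<n. pot x i * pot y j * L i j) = (\<Sum>i<n. \<Sum>j<n. pot y i * pot x j * L i j)"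
    by (subst sum.swap) (intro sum.cong refl, auto simp: L_sym mult_ac)
  moreover have "(\<Sum>i<k. \<Sum>j<k. pot\<^sub>\<Gamma> x i * pot\<^sub>\<Gamma> y j * L\<^sub>\<Gamma> i j) = (\<Sum>i<k. \<Sum>j<k. pot\<^sub>\<Gamma> y i * pot\<^sub>\<Gamma> x j * L\<^sub>\<Gamma> i j)"
    by (subst sum.swap) (intro sum.cong refl, auto simp: L\<^sub>\<Gamma>_sym mult_ac)
  ultimately show ?thesis unfolding flow_inner by simp
qed

lemma flow_psd: "0 \<le> (\<Sum>i<n. x i * flow x i)"
  unfolding flow_inner using m L_psd L\<^sub>\<Gamma>_psd by simp

lemma scheme_solvable:
  fixes fp gp Fp Gp :: "real \<Rightarrow> real" and f g b :: "nat \<Rightarrow> real"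
  assumes deriv: "\<And>s. (Fp has_field_derivative fp s) (at s)" "\<And>s. (Gp has_field_derivative gp s) (at s)"
    and nonneg: "\<And>s. 0 \<le> Fp s" "\<And>s. 0 \<le> Gp s" and \<kappa>: "\<kappa> \<ge> 0"
  defines "R \<equiv> \<lambda>x i. (\<Sum>j<n. L i j * x j) + d i * (fp (x i) + f i)
    + (if i < k then \<kappa> * (\<Sum>j<k. L\<^sub>\<Gamma> i j * x j) + d\<^sub>\<Gamma> i * (gp (x i) + g i) else 0)"
  shows "\<exists>x. \<forall>i<n. x i + flow (R x) i = b i"
proof -
  define E where "E x = (\<Sum>i<n. \<Sum>j<n. x i * x j * L i j) / 2 + (\<Sum>i<n. d i * (Fp (x i) + f i * x i))
    + (\<kappa> * (\<Sum>i<k. \<Sum>j<k. x i * x j * L\<^sub>\<Gamma> i j) / 2 + (\<Sum>i<k. d\<^sub>\<Gamma> i * (Gp (x i) + g i * x i)))" for x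
  \<comment> \<open>The linear part of \<open>E\<close>. Everything else in \<open>E\<close> is
    nonnegative: the quadratic forms by semidefiniteness, the potentials by \<open>nonneg\<close>
    with positive masses.\<close>
  define l where "l i = d i * f i + (if i < k then d\<^sub>\<Gamma> i * g i else 0)" for i
  have restrict: "(\<Sum>i<n. if i < k then h i else 0) = (\<Sum>i<k. h i)" for h :: "nat \<Rightarrow> real"
    unfolding split_sum by simp
  have below: "0 + (\<Sum>i<n. l i * x i) \<le> E x" for x
  proof -
    have "(\<Sum>i<n. l i * x i) = (\<Sum>i<n. d i * (f i * x i)) + (\<Sum>i<n. if i < k then d\<^sub>\<Gamma> i * (g i * x i) else 0)"
      unfolding sum.distrib[symmetric] by (intro sum.cong) (auto simp: l_def algebra_simps)
    moreover have "(\<Sum>i<n. d i * (f i * x i)) \<le> (\<Sum>i<n. d i * (Fp (x i) + f i * x i))"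
      using d nonneg(1) by (intro sum_mono mult_left_mono) (auto simp: less_imp_le)
    moreover have "(\<Sum>i<k. d\<^sub>\<Gamma> i * (g i * x i)) \<le> (\<Sum>i<k. d\<^sub>\<Gamma> i * (Gp (x i) + g i * x i))"
      using d\<^sub>\<Gamma> nonneg(2) by (intro sum_mono mult_left_mono) (auto simp: less_imp_le)
    moreover have "0 \<le> \<kappa> * (\<Sum>i<k. \<Sum>j<k. x i * x j * L\<^sub>\<Gamma> i j)" using \<kappa> L\<^sub>\<Gamma>_psd by simp
    ultimately show ?thesis using L_psd[of x] unfolding E_def restrict by linarith
  qed
  have cont: "continuous_on UNIV E"
  proof -
    have coord: "continuous_on UNIV (\<lambda>r::nat \<Rightarrow> real. r i)" for i by simp
    have "continuous_on UNIV Fp" "continuous_on UNIV Gp"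
      using deriv by (meson DERIV_isCont continuous_at_imp_continuous_on)+
    from this[THEN continuous_on_compose2, OF coord subset_UNIV]
    have "continuous_on UNIV (\<lambda>r::nat \<Rightarrow> real. Fp (r i))" "continuous_on UNIV (\<lambda>r::nat \<Rightarrow> real. Gp (r i))" for i .
    then show ?thesis unfolding E_def by (intro continuous_intros coord) auto
  qed
  have E_deriv: "((\<lambda>t. E (\<lambda>i. x i + t * y i)) has_field_derivative (\<Sum>i<n. R x i * y i)) (at 0)" for x y
  proof -
    have comp: "((\<lambda>t. c * (H (u + t * v) + a * (u + t * v))) has_field_derivative c * (h u + a) * v) (at 0)"
      if "\<And>s. (H has_field_derivative h s) (at s)" for H h :: "real \<Rightarrow> real" and u v c a
      using that[of u]
      by (auto intro!: derivative_eq_intros DERIV_chain2[where f = H] simp: algebra_simps)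
    have "((\<lambda>t. E (\<lambda>i. x i + t * y i)) has_field_derivative
        2 * (\<Sum>i<n. (\<Sum>j<n. L i j * x j) * y i) / 2 + (\<Sum>i<n. d i * (fp (x i) + f i) * y i)
        + (\<kappa> * (2 * (\<Sum>i<k. (\<Sum>j<k. L\<^sub>\<Gamma> i j * x j) * y i)) / 2 + (\<Sum>i<k. d\<^sub>\<Gamma> i * (gp (x i) + g i) * y i))) (at 0)"
      unfolding E_def
      by (intro DERIV_add DERIV_cdivide DERIV_cmult DERIV_sum comp deriv
          has_field_derivative_quadratic_form) (auto simp: L_sym L\<^sub>\<Gamma>_sym)
    moreover have "(\<Sum>i<n. R x i * y i) = (\<Sum>i<n. (\<Sum>j<n. L i j * x j) * y i) + (\<Sum>i<n. d i * (fp (x i) + f i) * y i)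
        + (\<Sum>i<n. if i < k then \<kappa> * ((\<Sum>j<k. L\<^sub>\<Gamma> i j * x j) * y i) + d\<^sub>\<Gamma> i * (gp (x i) + g i) * y i else 0)"
      unfolding sum.distrib[symmetric] R_def by (intro sum.cong) (auto simp: algebra_simps)
    ultimately show ?thesis
      unfolding restrict by (simp add: sum.distrib sum_distrib_left[symmetric])
  qed
  show ?thesis
    by (rule psd_gradient_equation_solvable[of flow n E 0 l R b, OF flow_linear flow_continuous
        flow_sym flow_psd _ cont below E_deriv]) (simp add: flow_def)
qed

end


section \<open>Matrices\<close>

notation Matrix.vec_index (infixl \<open>$v\<close> 100)

lemma mult_mat_vec_index_sum:
  fixes A :: "real mat"
  assumes "A \<in> carrier_mat r c" "v \<in> carrier_vec c" "i < r"
  shows "(A *\<^sub>v v) $v i = (\<Sum>j<c. A $$ (i, j) * v $v j)"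
  using assms by (auto simp: scalar_prod_def lessThan_atLeast0 intro!: sum.cong)

lemma mult_mat_index_sum:
  fixes A :: "real mat"
  assumes "A \<in> carrier_mat r c" "B \<in> carrier_mat c s" "i < r" "j < s"
  shows "(A * B) $$ (i, j) = (\<Sum>l<c. A $$ (i, l) * B $$ (l, j))"
  using assms by (auto simp: scalar_prod_def lessThan_atLeast0 intro!: sum.cong)

definition diag :: "nat \<Rightarrow> (nat \<Rightarrow> real) \<Rightarrow> real mat" where
  "diag n d = mat n n (\<lambda>(i, j). if i = j then d i else 0)"

lemma diag_carrier [simp]: "diag n d \<in> carrier_mat n n" "dim_row (diag n d) = n" "dim_col (diag n d) = n"
  by (auto simp: diag_def)

lemma diag_mult_vec: "v \<in> carrier_vec n \<Longrightarrow> diag n d *\<^sub>v v = vec n (\<lambda>i. d i * v $v i)"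
proof (rule eq_vecI)
  fix i assume v: "v \<in> carrier_vec n" and "i < dim_vec (vec n (\<lambda>i. d i * v $v i))"
  then have i: "i < n" by simp
  have "(diag n d *\<^sub>v v) $v i = (\<Sum>j<n. if j = i then d i * v $v i else 0)"
    unfolding mult_mat_vec_index_sum[OF diag_carrier(1) v i]
    by (rule sum.cong) (use i in \<open>auto simp: diag_def\<close>)
  then show "(diag n d *\<^sub>v v) $v i = vec n (\<lambda>i. d i * v $v i) $v i" using i by simp
qed simp

lemma diag_mult_mat:
  assumes A: "A \<in> carrier_mat n c"
  shows "diag n d * A = mat n c (\<lambda>(i, j). d i * A $$ (i, j))"
proof (rule eq_matI)
  fix i j assume "i < dim_row (mat n c (\<lambda>(i, j). d i * A $$ (i, j)))" "j < dim_col (mat n c (\<lambda>(i, j). d i * A $$ (i, j)))"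
  then have ij: "i < n" "j < c" by simp_all
  have "(diag n d * A) $$ (i, j) = (\<Sum>l<n. if l = i then d i * A $$ (i, j) else 0)"
    unfolding mult_mat_index_sum[OF diag_carrier(1) A ij]
    by (rule sum.cong) (use ij in \<open>auto simp: diag_def\<close>)
  then show "(diag n d * A) $$ (i, j) = mat n c (\<lambda>(i, j). d i * A $$ (i, j)) $$ (i, j)" using ij by simp
qed (use A in auto)

lemma mat_mult_diag:
  assumes A: "A \<in> carrier_mat r n"
  shows "A * diag n d = mat r n (\<lambda>(i, j). A $$ (i, j) * d j)"
proof (rule eq_matI)
  fix i j assume "i < dim_row (mat r n (\<lambda>(i, j). A $$ (i, j) * d j))" "j < dim_col (mat r n (\<lambda>(i, j). A $$ (i, j) * d j))"
  then have ij: "i < r" "j < n" by simp_all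
  have "(A * diag n d) $$ (i, j) = (\<Sum>l<n. if l = j then A $$ (i, j) * d j else 0)"
    unfolding mult_mat_index_sum[OF A diag_carrier(1) ij]
    by (rule sum.cong) (use ij in \<open>auto simp: diag_def\<close>)
  then show "(A * diag n d) $$ (i, j) = mat r n (\<lambda>(i, j). A $$ (i, j) * d j) $$ (i, j)" using ij by simp
qed (use A in auto)

text \<open>Injectivity forces a nonzero determinant, hence a unit of the matrix ring, and then
  \<open>mat_inverse\<close> does not return \<open>None\<close>.\<close>

lemma minv_inverse:
  assumes A: "A \<in> carrier_mat n n"
    and inj: "\<And>v. v \<in> carrier_vec n \<Longrightarrow> A *\<^sub>v v = 0\<^sub>v n \<Longrightarrow> v = 0\<^sub>v n"
  shows "minv A \<in> carrier_mat n n" "A * minv A = 1\<^sub>m n"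
proof -
  have "Determinant.det A \<noteq> 0" using det_0_iff_vec_prod_zero_field[OF A] inj by blast
  then have "A \<in> Units (ring_mat TYPE(real) n ())" by (rule det_non_zero_imp_unit[OF A])
  then obtain B where "mat_inverse A = Some B" using mat_inverse(1)[OF A, where b = "()"] by (cases "mat_inverse A") auto
  then show "minv A \<in> carrier_mat n n" "A * minv A = 1\<^sub>m n" using mat_inverse(2)[OF A] by auto
qed

lemma minv_diag:
  assumes d: "\<And>i. i < n \<Longrightarrow> d i \<noteq> 0"
  shows "minv (diag n d) = diag n (\<lambda>i. 1 / d i)"
proof -
  have inj: "v = 0\<^sub>v n" if v: "v \<in> carrier_vec n" "diag n d *\<^sub>v v = 0\<^sub>v n" for v
  proof (rule eq_vecI)
    fix i assume "i < dim_vec (0\<^sub>v n :: real Matrix.vec)"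
    then have i: "i < n" by simp
    have "d i * v $v i = (diag n d *\<^sub>v v) $v i" using i by (simp add: diag_mult_vec[OF v(1)])
    then show "v $v i = 0\<^sub>v n $v i" using d[OF i] i by (simp add: v(2))
  qed (use v in simp)
  note inv = minv_inverse[OF diag_carrier(1) inj]
  show ?thesis
  proof (rule eq_matI)
    fix i j assume "i < dim_row (diag n (\<lambda>i. 1 / d i))" "j < dim_col (diag n (\<lambda>i. 1 / d i))"
    then have ij: "i < n" "j < n" by simp_all
    have "d i * minv (diag n d) $$ (i, j) = (diag n d * minv (diag n d)) $$ (i, j)"
      using ij by (simp add: diag_mult_mat[OF inv(1)])
    also have "\<dots> = (if i = j then 1 else 0)" using ij by (simp add: inv(2))
    finally show "minv (diag n d) $$ (i, j) = diag n (\<lambda>i. 1 / d i) $$ (i, j)"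
      using ij d[of i] by (auto simp: diag_def field_simps split: if_splits)
  qed (use inv(1) in auto)
qed

lemma block_carrier [simp]: "block A r1 r2 c1 c2 \<in> carrier_mat (r2 - r1) (c2 - c1)"
    "dim_row (block A r1 r2 c1 c2) = r2 - r1" "dim_col (block A r1 r2 c1 c2) = c2 - c1"
  by (simp_all add: block_def)

lemma block_index [simp]:
  "i < r2 - r1 \<Longrightarrow> j < c2 - c1 \<Longrightarrow> block A r1 r2 c1 c2 $$ (i, j) = A $$ (r1 + i, c1 + j)"
  by (simp add: block_def)

lemma block_diag:
  "k \<le> n \<Longrightarrow> block (diag n d) 0 k 0 k = diag k d"
  "k \<le> n \<Longrightarrow> block (diag n d) k n k n = diag (n - k) (\<lambda>i. d (k + i))"
  by (rule eq_matI; auto simp: block_def diag_def)+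

lemma block_diag_mult_vec:
  assumes "v \<in> carrier_vec n" "r2 \<le> n" "i < r2 - r1"
  shows "(block (diag n d) r1 r2 0 n *\<^sub>v v) $v i = d (r1 + i) * v $v (r1 + i)"
proof -
  have "(block (diag n d) r1 r2 0 n *\<^sub>v v) $v i
      = (\<Sum>j<n. if j = r1 + i then d (r1 + i) * v $v (r1 + i) else 0)"
    unfolding mult_mat_vec_index_sum[OF block_carrier(1)[of _ r1 r2 0 n, simplified diff_zero] assms(1,3)]
    by (rule sum.cong) (use assms in \<open>auto simp: diag_def\<close>)
  then show ?thesis using assms by simp
qed

lemma sum_shift_lessThan: "(\<Sum>j<n - k. f (k + j)) = (\<Sum>l\<in>{k..<n}. f l)" if "k \<le> n" for k n :: nat
  using sum.shift_bounds_nat_ivl[of f 0 k "n - k"] that by (simp add: lessThan_atLeast0 add.commute)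

section \<open>The scheme in matrix form\<close>

locale discrete_scheme =
  fixes n k :: nat and L L\<^sub>\<Gamma> :: "real mat" and d d\<^sub>\<Gamma> :: "nat \<Rightarrow> real" and m m\<^sub>\<Gamma> \<tau> :: real
  assumes k: "k \<le> n"
    and d: "\<And>i. i < n \<Longrightarrow> 0 < d i" and d\<^sub>\<Gamma>: "\<And>i. i < k \<Longrightarrow> 0 < d\<^sub>\<Gamma> i"
    and L: "L \<in> carrier_mat n n" and L\<^sub>\<Gamma>: "L\<^sub>\<Gamma> \<in> carrier_mat k k"
    and L_sym: "\<And>i j. i < n \<Longrightarrow> j < n \<Longrightarrow> L $$ (i, j) = L $$ (j, i)"
    and L_psd: "\<And>x. 0 \<le> (\<Sum>i<n. \<Sum>j<n. x i * x j * L $$ (i, j))"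
    and L_boundary_definite: "\<And>x i. (\<Sum>i<k. \<Sum>j<k. x i * x j * L $$ (i, j)) \<le> 0 \<Longrightarrow> i < k \<Longrightarrow> x i = 0"
    and L\<^sub>\<Gamma>_sym: "\<And>i j. i < k \<Longrightarrow> j < k \<Longrightarrow> L\<^sub>\<Gamma> $$ (i, j) = L\<^sub>\<Gamma> $$ (j, i)"
    and L\<^sub>\<Gamma>_psd: "\<And>x. 0 \<le> (\<Sum>i<k. \<Sum>j<k. x i * x j * L\<^sub>\<Gamma> $$ (i, j))"
    and m: "m > 0" "m\<^sub>\<Gamma> > 0" "\<tau> > 0"
begin

abbreviation "M \<equiv> diag n d"
abbreviation "M\<^sub>\<Gamma> \<equiv> diag k d\<^sub>\<Gamma>"
abbreviation "S \<equiv> S_matrix L M L\<^sub>\<Gamma> M\<^sub>\<Gamma> m m\<^sub>\<Gamma>"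

lemma minv_mass: "minv M = diag n (\<lambda>i. 1 / d i)" "minv M\<^sub>\<Gamma> = diag k (\<lambda>i. 1 / d\<^sub>\<Gamma> i)"
  "minv (block M k n k n) = diag (n - k) (\<lambda>i. 1 / d (k + i))"
proof -
  show "minv M = diag n (\<lambda>i. 1 / d i)" by (rule minv_diag) (use d in force)
  show "minv M\<^sub>\<Gamma> = diag k (\<lambda>i. 1 / d\<^sub>\<Gamma> i)" by (rule minv_diag) (use d\<^sub>\<Gamma> in force)
  have "d (k + i) \<noteq> 0" if "i < n - k" for i
  proof -
    have "0 < d (k + i)" using that by (intro d) simp
    then show ?thesis by simp
  qed
  then show "minv (block M k n k n) = diag (n - k) (\<lambda>i. 1 / d (k + i))"
    unfolding block_diag(2)[OF k] by (rule minv_diag)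
qed

lemma coupling_matrix:
  "block M 0 k 0 k * minv M\<^sub>\<Gamma> * L\<^sub>\<Gamma> * minv M\<^sub>\<Gamma> = mat k k (\<lambda>(i, j). d i / d\<^sub>\<Gamma> i * L\<^sub>\<Gamma> $$ (i, j) / d\<^sub>\<Gamma> j)"
proof -
  have "diag k d * diag k (\<lambda>i. 1 / d\<^sub>\<Gamma> i) = diag k (\<lambda>i. d i / d\<^sub>\<Gamma> i)"
    unfolding diag_mult_mat[OF diag_carrier(1)] by (rule eq_matI) (auto simp: diag_def)
  moreover have "diag k (\<lambda>i. d i / d\<^sub>\<Gamma> i) * L\<^sub>\<Gamma> = mat k k (\<lambda>(i, j). d i / d\<^sub>\<Gamma> i * L\<^sub>\<Gamma> $$ (i, j))"
    by (rule diag_mult_mat[OF L\<^sub>\<Gamma>])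
  moreover have "mat k k (\<lambda>(i, j). d i / d\<^sub>\<Gamma> i * L\<^sub>\<Gamma> $$ (i, j)) * diag k (\<lambda>i. 1 / d\<^sub>\<Gamma> i)
      = mat k k (\<lambda>(i, j). d i / d\<^sub>\<Gamma> i * L\<^sub>\<Gamma> $$ (i, j) / d\<^sub>\<Gamma> j)"
    unfolding mat_mult_diag[OF mat_carrier] by (rule eq_matI) auto
  ultimately show ?thesis unfolding minv_mass block_diag(1)[OF k] by simp
qed

lemma S_carrier: "S \<in> carrier_mat k k"
  and S_index: "i < k \<Longrightarrow> j < k \<Longrightarrow>
    S $$ (i, j) = m * L $$ (i, j) + m\<^sub>\<Gamma> * (d i / d\<^sub>\<Gamma> i * L\<^sub>\<Gamma> $$ (i, j) * (d j / d\<^sub>\<Gamma> j))"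
proof -
  have S: "S = m \<cdot>\<^sub>m block L 0 k 0 k + m\<^sub>\<Gamma> \<cdot>\<^sub>m mat k k (\<lambda>(i, j). d i / d\<^sub>\<Gamma> i * L\<^sub>\<Gamma> $$ (i, j) / d\<^sub>\<Gamma> j * d j)"
    unfolding S_matrix_def Let_def diag_carrier(2) coupling_matrix
    unfolding block_diag(1)[OF k] mat_mult_diag[OF mat_carrier]
    by (rule arg_cong2[where f = "(+)"]) (auto intro!: eq_matI)
  show "S \<in> carrier_mat k k" unfolding S by simp
  show "S $$ (i, j) = m * L $$ (i, j) + m\<^sub>\<Gamma> * (d i / d\<^sub>\<Gamma> i * L\<^sub>\<Gamma> $$ (i, j) * (d j / d\<^sub>\<Gamma> j))"
    if "i < k" "j < k" using that unfolding S by simp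
qed

lemma S_injective:
  assumes v: "v \<in> carrier_vec k" "S *\<^sub>v v = 0\<^sub>v k"
  shows "v = 0\<^sub>v k"
proof -
  define x where "x i = v $v i" for i
  \<comment> \<open>Absorbing the mass factors into \<open>y\<close> exhibits the second summand of
    S as a congruence of \<open>L\<^sub>\<Gamma>\<close>, which is semidefinite; the definite
    boundary block of \<open>L\<close> decides.\<close>
  define y where "y i = d i / d\<^sub>\<Gamma> i * x i" for i
  have "0 = (\<Sum>i<k. x i * (S *\<^sub>v v) $v i)" by (simp add: v(2))
  also have "\<dots> = (\<Sum>i<k. \<Sum>j<k. m * (x i * x j * L $$ (i, j)) + m\<^sub>\<Gamma> * (y i * y j * L\<^sub>\<Gamma> $$ (i, j)))"
    by (intro sum.cong refl)
      (auto simp: mult_mat_vec_index_sum[OF S_carrier v(1)] S_index sum_distrib_left x_def y_def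
        algebra_simps intro!: sum.cong)
  also have "\<dots> = m * (\<Sum>i<k. \<Sum>j<k. x i * x j * L $$ (i, j)) + m\<^sub>\<Gamma> * (\<Sum>i<k. \<Sum>j<k. y i * y j * L\<^sub>\<Gamma> $$ (i, j))"
    by (simp add: sum.distrib sum_distrib_left)
  finally have "m * (\<Sum>i<k. \<Sum>j<k. x i * x j * L $$ (i, j)) = - (m\<^sub>\<Gamma> * (\<Sum>i<k. \<Sum>j<k. y i * y j * L\<^sub>\<Gamma> $$ (i, j)))"
    by linarith
  also have "\<dots> \<le> 0" using L\<^sub>\<Gamma>_psd[of y] m by simp
  finally have "(\<Sum>i<k. \<Sum>j<k. x i * x j * L $$ (i, j)) \<le> 0"
    using m(1) by (simp add: mult_le_0_iff)
  then have "x i = 0" if "i < k" for i using L_boundary_definite that by blast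
  then show ?thesis using v(1) by (intro eq_vecI) (auto simp: x_def)
qed

lemmas S_inverse = minv_inverse[OF S_carrier S_injective]

sublocale discrete_operators n k "\<lambda>i j. L $$ (i, j)" "\<lambda>i j. L\<^sub>\<Gamma> $$ (i, j)" "\<lambda>i j. minv S $$ (i, j)"
  d d\<^sub>\<Gamma> m m\<^sub>\<Gamma> \<tau>
proof
  fix w :: "nat \<Rightarrow> real" and i assume i: "i < k"
  have w: "vec k w \<in> carrier_vec k" by simp
  have inv: "minv S *\<^sub>v vec k w \<in> carrier_vec k" using S_inverse(1) by simp
  have "S *\<^sub>v (minv S *\<^sub>v vec k w) = vec k w"
    using assoc_mult_mat_vec[OF S_carrier S_inverse(1) w] S_inverse(2) by simp
  then have "(S *\<^sub>v (minv S *\<^sub>v vec k w)) $v i = w i" using i by simp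
  then show "(\<Sum>j<k. (m * L $$ (i, j) + m\<^sub>\<Gamma> * (d i / d\<^sub>\<Gamma> i * L\<^sub>\<Gamma> $$ (i, j) * (d j / d\<^sub>\<Gamma> j))) *
      (\<Sum>l<k. minv S $$ (j, l) * w l)) = w i"
    using i by (simp add: mult_mat_vec_index_sum[OF S_carrier inv i]
        mult_mat_vec_index_sum[OF S_inverse(1) w] S_index)
qed (use k d d\<^sub>\<Gamma> L_sym L_psd L\<^sub>\<Gamma>_sym L\<^sub>\<Gamma>_psd m in auto)

text \<open>Coordinate by coordinate, the vectors of the scheme are identified with
  \<open>R\<close>, \<open>pot_rhs\<close>, \<open>pot\<close> and \<open>flow\<close>, so that a
  solution of the scalar system is a solution of the matrix equation.\<close>

lemma scheme_has_solution:
  assumes deriv: "\<And>s. (Fp has_field_derivative deriv Fp s) (at s)" "\<And>s. (Gp has_field_derivative deriv Gp s) (at s)"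
    and nonneg: "\<And>s. 0 \<le> Fp s" "\<And>s. 0 \<le> Gp s" and \<kappa>: "\<kappa> \<ge> 0"
    and old: "\<Phi>old \<in> carrier_vec n"
  shows "\<exists>\<Phi>\<in>carrier_vec n. \<Phi> + (\<tau> * m) \<cdot>\<^sub>v ((minv M * L) *\<^sub>v
    P_vector L M L\<^sub>\<Gamma> M\<^sub>\<Gamma> m m\<^sub>\<Gamma> \<kappa> Fp Fm Gp Gm \<Phi>old \<Phi>) = \<Phi>old"
proof -
  define f where "f i = deriv Fm (\<Phi>old $v i)" for i
  define g where "g i = deriv Gm (\<Phi>old $v i)" for i
  define R where "R x i = (\<Sum>j<n. L $$ (i, j) * x j) + d i * (deriv Fp (x i) + f i)
    + (if i < k then \<kappa> * (\<Sum>j<k. L\<^sub>\<Gamma> $$ (i, j) * x j) + d\<^sub>\<Gamma> i * (deriv Gp (x i) + g i) else 0)" for x i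
  obtain x where x: "\<And>i. i < n \<Longrightarrow> x i + flow (R x) i = \<Phi>old $v i"
    using scheme_solvable[OF deriv nonneg \<kappa>, of f g "\<lambda>i. \<Phi>old $v i"] unfolding R_def by blast
  define \<Phi> where "\<Phi> = vec n x"
  have \<Phi>: "\<Phi> \<in> carrier_vec n" and \<Phi>_index: "\<And>i. i < n \<Longrightarrow> \<Phi> $v i = x i" by (auto simp: \<Phi>_def)
  let ?u = "map_vec (deriv Fp) \<Phi> + map_vec (deriv Fm) \<Phi>old"
  have u: "?u \<in> carrier_vec n" "\<And>i. i < n \<Longrightarrow> ?u $v i = deriv Fp (x i) + f i"
    using \<Phi> old by (auto simp: f_def \<Phi>_index)
  have first: "vec_first v k \<in> carrier_vec k" "\<And>i. i < k \<Longrightarrow> vec_first v k $v i = v $v i"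
    for v :: "real Matrix.vec"
    by (auto simp: vec_first_def)
  let ?Ri = "R_interior L M k Fp Fm \<Phi>old \<Phi>"
  let ?Rb = "R_boundary L M L\<^sub>\<Gamma> M\<^sub>\<Gamma> \<kappa> Fp Fm Gp Gm \<Phi>old \<Phi>"
  \<comment> \<open>A block with first column 0 has \<open>n - 0\<close> columns, which must be
    rewritten to \<open>n\<close> before it fits the vectors.\<close>
  note block_index_sum = mult_mat_vec_index_sum[OF block_carrier(1)[of _ _ _ 0 n, simplified diff_zero]]
  have Ri: "?Ri = vec (n - k) (\<lambda>i. R x (k + i))"
  proof (rule eq_vecI)
    show "dim_vec ?Ri = dim_vec (vec (n - k) (\<lambda>i. R x (k + i)))"
      by (simp add: R_interior_def Let_def block_def)
    fix i assume "i < dim_vec (vec (n - k) (\<lambda>i. R x (k + i)))"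
    then have i: "i < n - k" by simp
    have "(block L k n 0 n *\<^sub>v \<Phi>) $v i = (\<Sum>j<n. L $$ (k + i, j) * x j)"
      using i by (simp add: block_index_sum[OF \<Phi>] \<Phi>_index del: index_mult_mat_vec)
    moreover have "(block M k n 0 n *\<^sub>v ?u) $v i = d (k + i) * (deriv Fp (x (k + i)) + f (k + i))"
      using block_diag_mult_vec[OF u(1) _ i, of d] u(2)[of "k + i"] i by simp
    moreover have "dim_vec (block M k n 0 n *\<^sub>v ?u) = n - k" by (simp add: block_def)
    ultimately show "?Ri $v i = vec (n - k) (\<lambda>i. R x (k + i)) $v i"
      using i by (simp add: R_interior_def Let_def R_def del: index_mult_mat_vec)
  qed
  have Rb: "?Rb = vec k (R x)"
  proof (rule eq_vecI)
    show "dim_vec ?Rb = dim_vec (vec k (R x))"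
      by (simp add: R_boundary_def Let_def)
    fix i assume "i < dim_vec (vec k (R x))"
    then have i: "i < k" and i': "i < k - 0" by simp_all
    have "(block L 0 k 0 n *\<^sub>v \<Phi>) $v i = (\<Sum>j<n. L $$ (i, j) * x j)"
      using i by (simp add: block_index_sum[OF \<Phi>] \<Phi>_index del: index_mult_mat_vec)
    moreover have "(block M 0 k 0 n *\<^sub>v ?u) $v i = d i * (deriv Fp (x i) + f i)"
      using block_diag_mult_vec[OF u(1) k i', of d] u(2)[of i] i k by simp
    moreover have "(L\<^sub>\<Gamma> *\<^sub>v vec_first \<Phi> k) $v i = (\<Sum>j<k. L\<^sub>\<Gamma> $$ (i, j) * x j)"
      using k by (simp add: mult_mat_vec_index_sum[OF L\<^sub>\<Gamma> first(1) i] first(2) \<Phi>_index)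
    moreover have "(M\<^sub>\<Gamma> *\<^sub>v (map_vec (deriv Gp) (vec_first \<Phi> k) + map_vec (deriv Gm) (vec_first \<Phi>old k))) $v i
        = d\<^sub>\<Gamma> i * (deriv Gp (x i) + g i)"
      using i k by (subst diag_mult_vec) (auto simp: first g_def \<Phi>_index carrier_vecD[OF first(1)])
    moreover have "dim_vec (L\<^sub>\<Gamma> *\<^sub>v vec_first \<Phi> k) = k" using L\<^sub>\<Gamma> by simp
    ultimately show "?Rb $v i = vec k (R x) $v i"
      using i by (simp add: R_boundary_def Let_def R_def del: index_mult_mat_vec)
  qed
  let ?P = "P_vector L M L\<^sub>\<Gamma> M\<^sub>\<Gamma> m m\<^sub>\<Gamma> \<kappa> Fp Fm Gp Gm \<Phi>old \<Phi>"
  have Pi: "minv (block M k n k n) *\<^sub>v ?Ri = vec (n - k) (\<lambda>i. R x (k + i) / d (k + i))"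
    unfolding Ri minv_mass by (subst diag_mult_vec) auto
  let ?w = "- (m \<cdot>\<^sub>v (block L 0 k k n *\<^sub>v vec (n - k) (\<lambda>i. R x (k + i) / d (k + i))))
      + m\<^sub>\<Gamma> \<cdot>\<^sub>v (mat k k (\<lambda>(i, j). d i / d\<^sub>\<Gamma> i * L\<^sub>\<Gamma> $$ (i, j) / d\<^sub>\<Gamma> j) *\<^sub>v vec k (R x))"
  have w: "?w = vec k (pot_rhs (R x))"
  proof (rule eq_vecI)
    fix i assume "i < dim_vec (vec k (pot_rhs (R x)))"
    then have i: "i < k" by simp
    have "(block L 0 k k n *\<^sub>v vec (n - k) (\<lambda>i. R x (k + i) / d (k + i))) $v i
        = (\<Sum>j<n - k. L $$ (i, k + j) * (R x (k + j) / d (k + j)))"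
      using i by (subst mult_mat_vec_index_sum[OF block_carrier(1)]) auto
    also have "\<dots> = (\<Sum>l\<in>{k..<n}. L $$ (i, l) * (R x l / d l))"
      by (rule sum_shift_lessThan[OF k])
    finally have 1: "(block L 0 k k n *\<^sub>v vec (n - k) (\<lambda>i. R x (k + i) / d (k + i))) $v i
        = (\<Sum>l\<in>{k..<n}. L $$ (i, l) * (R x l / d l))" .
    have 2: "(mat k k (\<lambda>(i, j). d i / d\<^sub>\<Gamma> i * L\<^sub>\<Gamma> $$ (i, j) / d\<^sub>\<Gamma> j) *\<^sub>v vec k (R x)) $v i
        = (\<Sum>l<k. d i / d\<^sub>\<Gamma> i * L\<^sub>\<Gamma> $$ (i, l) / d\<^sub>\<Gamma> l * R x l)"
      using i by (subst mult_mat_vec_index_sum[OF mat_carrier]) auto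
    have 3: "dim_vec (block L 0 k k n *\<^sub>v vec (n - k) (\<lambda>i. R x (k + i) / d (k + i))) = k"
      by (simp add: block_def)
    show "?w $v i = vec k (pot_rhs (R x)) $v i"
      using i 1 2 3 by (simp add: pot_rhs_def del: index_mult_mat_vec)
  qed (simp add: block_def)
  have P: "?P = (minv S *\<^sub>v vec k (pot_rhs (R x))) @\<^sub>v vec (n - k) (\<lambda>i. R x (k + i) / d (k + i))"
    unfolding P_vector_def Let_def diag_carrier(2) Pi Rb coupling_matrix w ..
  have P_carrier: "?P \<in> carrier_vec n"
    unfolding P using S_inverse(1) k by (intro carrier_vecI) simp
  have P_index: "?P $v j = pot (R x) j" if "j < n" for j
    unfolding P using that S_inverse(1)
    by (cases "j < k") (auto simp: pot_def mult_mat_vec_index_sum[OF S_inverse(1)] simp del: index_mult_mat_vec)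
  have minv_L: "minv M * L = mat n n (\<lambda>(i, j). 1 / d i * L $$ (i, j))"
    unfolding minv_mass by (rule diag_mult_mat[OF L])
  have "\<Phi> + (\<tau> * m) \<cdot>\<^sub>v ((minv M * L) *\<^sub>v ?P) = \<Phi>old"
  proof (rule eq_vecI)
    fix i assume "i < dim_vec \<Phi>old"
    then have i: "i < n" using old by simp
    have "((minv M * L) *\<^sub>v ?P) $v i = 1 / d i * (\<Sum>j<n. L $$ (i, j) * pot (R x) j)"
      unfolding minv_L mult_mat_vec_index_sum[OF mat_carrier P_carrier i]
      using i by (simp add: P_index sum_distrib_left mult_ac)
    moreover have "dim_vec ((minv M * L) *\<^sub>v ?P) = n" by (simp add: minv_L)
    ultimately show "(\<Phi> + (\<tau> * m) \<cdot>\<^sub>v ((minv M * L) *\<^sub>v ?P)) $v i = \<Phi>old $v i"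
      using x[OF i] i by (simp add: \<Phi>_index flow_def del: index_mult_mat_vec)
  qed (use old in \<open>simp add: minv_L\<close>)
  then show ?thesis using \<Phi> by blast
qed

end


section \<open>Existence of discrete solutions\<close>

theorem lemma3p4:
  fixes \<Omega> :: "'a::euclidean_space set"
    and \<T> \<T>\<^sub>\<Gamma> :: "real \<Rightarrow> 'a set set"
    and h Tend \<tau> m m\<^sub>\<Gamma> \<kappa> :: real
    and N :: nat
    and F Fp Fm G Gp Gm :: "real \<Rightarrow> real"
    and p :: "nat \<Rightarrow> 'a"
    and \<Phi>old :: "real Matrix.vec"
  defines "M \<equiv> bulk_mass \<Omega> (\<T> h) p"
    and "L \<equiv> bulk_stiffness \<Omega> (\<T> h) p"
    and "M\<^sub>\<Gamma> \<equiv> surface_mass \<Omega> (\<T>\<^sub>\<Gamma> h) p"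
    and "L\<^sub>\<Gamma> \<equiv> surface_stiffness \<Omega> (\<T>\<^sub>\<Gamma> h) p"
  assumes dimension: "DIM('a) \<in> {2, 3}"
    and domain: "open \<Omega>" "\<Omega> \<noteq> {}" "bounded \<Omega>" "convex \<Omega>" "polytope (closure \<Omega>)"
    and constants: "m > 0" "m\<^sub>\<Gamma> > 0" "\<kappa> \<ge> 0"
    and T: "N > 0" "Tend > 0" "\<tau> = Tend / real N"
    and S1: "quasiuniform \<T>"
      "\<And>h. h > 0 \<Longrightarrow> simplicial_partition (int DIM('a)) (\<T> h) (closure \<Omega>)"
      "\<And>h. h > 0 \<Longrightarrow> conforming (\<T> h)"
      "\<And>h K. h > 0 \<Longrightarrow> K \<in> \<T> h \<Longrightarrow> diameter K \<le> h"
    and S2: "quasiuniform \<T>\<^sub>\<Gamma>"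
      "\<And>h. h > 0 \<Longrightarrow> simplicial_partition (int DIM('a) - 1) (\<T>\<^sub>\<Gamma> h) (frontier \<Omega>)"
      "\<And>h K\<^sub>\<Gamma>. h > 0 \<Longrightarrow> K\<^sub>\<Gamma> \<in> \<T>\<^sub>\<Gamma> h \<Longrightarrow> \<exists>!K. K \<in> \<T> h \<and> closure K\<^sub>\<Gamma> = closure K \<inter> frontier \<Omega>"
      "\<And>h K\<^sub>\<Gamma>. h > 0 \<Longrightarrow> K\<^sub>\<Gamma> \<in> \<T>\<^sub>\<Gamma> h \<Longrightarrow> diameter K\<^sub>\<Gamma> \<le> h"
    and P1_smooth: "\<forall>f\<in>{F, Fp, Fm, G, Gp, Gm}. f C1_differentiable_on UNIV"
    and P1_bounded: "\<exists>c. \<forall>s. c \<le> F s" "\<exists>c. \<forall>s. c \<le> G s"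
    and P1_split: "\<forall>s. F s = Fp s + Fm s" "\<forall>s. G s = Gp s + Gm s"
    and P1_convex: "convex_on UNIV Fp" "convex_on UNIV Gp" "\<forall>s. 0 \<le> Fp s" "\<forall>s. 0 \<le> Gp s"
    and P1_concave: "concave_on UNIV Fm" "concave_on UNIV Gm"
    and h: "h > 0"
    and numbering: "bij_betw p {..<card (mesh_vertices (\<T> h))} (mesh_vertices (\<T> h))"
      "bij_betw p {..<card (mesh_vertices (\<T>\<^sub>\<Gamma> h))} (mesh_vertices (\<T>\<^sub>\<Gamma> h))"
      "mesh_vertices (\<T>\<^sub>\<Gamma> h) = mesh_vertices (\<T> h) \<inter> frontier \<Omega>"
    and old: "\<Phi>old \<in> carrier_vec (card (mesh_vertices (\<T> h)))"
  shows "\<exists>\<Phi> \<in> carrier_vec (card (mesh_vertices (\<T> h))).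
           \<Phi> + (\<tau> * m) \<cdot>\<^sub>v ((minv M * L) *\<^sub>v P_vector L M L\<^sub>\<Gamma> M\<^sub>\<Gamma> m m\<^sub>\<Gamma> \<kappa> Fp Fm Gp Gm \<Phi>old \<Phi>) = \<Phi>old"
proof -
  interpret bulk_surface_mesh "\<T> h" \<Omega> "\<T>\<^sub>\<Gamma> h"
  proof unfold_locales
    show "simplicial_partition (int DIM('a)) (\<T> h) (closure \<Omega>)" "conforming (\<T> h)"
      "simplicial_partition (int DIM('a) - 1) (\<T>\<^sub>\<Gamma> h) (frontier \<Omega>)"
      using S1 S2 h by auto
    show "\<exists>K\<in>\<T> h. closure K\<^sub>\<Gamma> = closure K \<inter> frontier \<Omega>" if "K\<^sub>\<Gamma> \<in> \<T>\<^sub>\<Gamma> h" for K\<^sub>\<Gamma>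
      using S2(3)[OF h that] by blast
  qed (use domain in auto)
  define n k where "n = card (mesh_vertices (\<T> h))" and "k = card (mesh_vertices (\<T>\<^sub>\<Gamma> h))"
  define \<phi> where "\<phi> i = nodal_basis (\<T> h) (p i)" for i
  have p: "inj_on p {..<n}" "p ` {..<n} = mesh_vertices (\<T> h)"
    and p\<^sub>\<Gamma>: "p ` {..<k} = mesh_vertices (\<T>\<^sub>\<Gamma> h)"
    using numbering(1,2) by (auto simp: bij_betw_def n_def k_def)
  have sub: "mesh_vertices (\<T>\<^sub>\<Gamma> h) \<subseteq> mesh_vertices (\<T> h)" using numbering(3) by blast
  have kn: "k \<le> n" unfolding n_def k_def by (rule card_mono[OF finite_vertices sub])
  have p_vertex: "p i \<in> mesh_vertices (\<T> h)" if "i < n" for i using p(2) that by blast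
  have p\<^sub>\<Gamma>_vertex: "p i \<in> mesh_vertices (\<T>\<^sub>\<Gamma> h)" if "i < k" for i using p\<^sub>\<Gamma> that by blast
  have p_eq: "p i = p j \<longleftrightarrow> i = j" if "i < n" "j < n" for i j
    using p(1) that by (auto dest: inj_onD)
  define d where "d i = (LINT x:\<Omega>|lebesgue. interpolant (\<T> h) (\<lambda>y. \<phi> i y * \<phi> i y) x)" for i
  define d\<^sub>\<Gamma> where "d\<^sub>\<Gamma> i = boundary_integral \<Omega> (interpolant (\<T>\<^sub>\<Gamma> h)
    (\<lambda>y. nodal_basis (\<T>\<^sub>\<Gamma> h) (p i) y * nodal_basis (\<T>\<^sub>\<Gamma> h) (p i) y))" for i
  have M: "M = diag n d"
    unfolding M_def bulk_mass_def Let_def diag_def n_def[symmetric]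
    by (rule eq_matI)
      (auto simp: d_def \<phi>_def p_eq intro!: bulk_mass_entry(1) p_vertex)
  have M\<^sub>\<Gamma>: "M\<^sub>\<Gamma> = diag k d\<^sub>\<Gamma>"
    unfolding M\<^sub>\<Gamma>_def surface_mass_def Let_def diag_def k_def[symmetric]
    using kn by (intro eq_matI)
      (auto simp: d\<^sub>\<Gamma>_def p_eq intro!: surface_mass_entry(1) p\<^sub>\<Gamma>_vertex)
  have L_entry: "L $$ (i, j) = (\<Sum>K\<in>\<T> h. measure lebesgue K * (slope K (p i) \<bullet> slope K (p j)))"
    if "i < n" "j < n" for i j
    using that unfolding L_def bulk_stiffness_def Let_def n_def[symmetric]
    by (simp add: bulk_stiffness_entry inner_commute)
  obtain g :: "'a set \<Rightarrow> 'a set \<Rightarrow> 'a \<Rightarrow> 'a" where g: "\<And>p q. boundary_integral \<Omega>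
      (\<lambda>x. surface_grad \<Omega> (nodal_basis (\<T>\<^sub>\<Gamma> h) p) x \<bullet> surface_grad \<Omega> (nodal_basis (\<T>\<^sub>\<Gamma> h) q) x)
    = (\<Sum>F | F facet_of closure \<Omega>. \<Sum>K\<in>facet_cells F. measure (flat_lebesgue F) K * (g F K p \<bullet> g F K q))"
    using surface_stiffness_entry by blast
  \<comment> \<open>Facets paired with their cells: flattening the double sum gives the single index
    set that \<open>gram_quadratic_form\<close> expects.\<close>
  define Z where "Z = (SIGMA F : {F. F facet_of closure \<Omega>}. facet_cells F)"
  have fin: "\<forall>F\<in>{F. F facet_of closure \<Omega>}. finite (facet_cells F)"
    using surface.finite_mesh by (simp add: facet_cells_def)
  have L\<^sub>\<Gamma>_entry: "L\<^sub>\<Gamma> $$ (i, j)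
      = (\<Sum>c\<in>Z. measure (flat_lebesgue (fst c)) (snd c) * (g (fst c) (snd c) (p i) \<bullet> g (fst c) (snd c) (p j)))"
    if "i < k" "j < k" for i j
    using that unfolding L\<^sub>\<Gamma>_def surface_stiffness_def Let_def k_def[symmetric] Z_def
    by (simp add: g sum.Sigma[OF finite_facets fin] case_prod_beta inner_commute)
  interpret discrete_scheme n k L L\<^sub>\<Gamma> d d\<^sub>\<Gamma> m m\<^sub>\<Gamma> \<tau>
  proof
    show "k \<le> n" by (rule kn)
    show "0 < d i" if "i < n" for i
      unfolding d_def \<phi>_def by (rule bulk_mass_entry(2)[OF p_vertex p_vertex]) (use that in auto)
    show "0 < d\<^sub>\<Gamma> i" if "i < k" for i
      unfolding d\<^sub>\<Gamma>_def by (rule surface_mass_entry(2)[OF p\<^sub>\<Gamma>_vertex p\<^sub>\<Gamma>_vertex]) (use that in auto)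
    show "L \<in> carrier_mat n n" "L\<^sub>\<Gamma> \<in> carrier_mat k k"
      by (simp_all add: L_def L\<^sub>\<Gamma>_def bulk_stiffness_def surface_stiffness_def Let_def n_def k_def)
    show "L $$ (i, j) = L $$ (j, i)" if "i < n" "j < n" for i j
      using that by (simp add: L_entry inner_commute)
    show "L\<^sub>\<Gamma> $$ (i, j) = L\<^sub>\<Gamma> $$ (j, i)" if "i < k" "j < k" for i j
      using that by (simp add: L\<^sub>\<Gamma>_entry inner_commute)
    show "0 \<le> (\<Sum>i<n. \<Sum>j<n. x i * x j * L $$ (i, j))" for x
      by (subst gram_quadratic_form[where I = "\<T> h" and w = "measure lebesgue" and G = "\<lambda>K i. slope K (p i)"])
        (auto simp: L_entry intro!: sum_nonneg)
    show "0 \<le> (\<Sum>i<k. \<Sum>j<k. x i * x j * L\<^sub>\<Gamma> $$ (i, j))" for x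
      by (subst gram_quadratic_form[where I = Z and w = "\<lambda>c. measure (flat_lebesgue (fst c)) (snd c)"
            and G = "\<lambda>c i. g (fst c) (snd c) (p i)"])
        (auto simp: L\<^sub>\<Gamma>_entry intro!: sum_nonneg)
    show "m > 0" "m\<^sub>\<Gamma> > 0" "\<tau> > 0" using constants T by auto
    fix x :: "nat \<Rightarrow> real" and i
    assume le: "(\<Sum>i<k. \<Sum>j<k. x i * x j * L $$ (i, j)) \<le> 0" and i: "i < k"
    have "(\<Sum>i<k. \<Sum>j<k. x i * x j * L $$ (i, j))
        = (\<Sum>K\<in>\<T> h. measure lebesgue K * (norm (\<Sum>i<k. x i *\<^sub>R slope K (p i)))\<^sup>2)"
      using kn by (intro gram_quadratic_form) (auto simp: L_entry)
    moreover have nonneg: "0 \<le> measure lebesgue K * (norm (\<Sum>i<k. x i *\<^sub>R slope K (p i)))\<^sup>2" for K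
      by simp
    moreover from this have "0 \<le> (\<Sum>K\<in>\<T> h. measure lebesgue K * (norm (\<Sum>i<k. x i *\<^sub>R slope K (p i)))\<^sup>2)"
      by (rule sum_nonneg)
    ultimately have "(\<Sum>K\<in>\<T> h. measure lebesgue K * (norm (\<Sum>i<k. x i *\<^sub>R slope K (p i)))\<^sup>2) = 0"
      using le by linarith
    then have "measure lebesgue K * (norm (\<Sum>i<k. x i *\<^sub>R slope K (p i)))\<^sup>2 = 0" if "K \<in> \<T> h" for K
      using that nonneg finite_mesh by (simp add: sum_nonneg_eq_0_iff)
    then have zero: "(\<Sum>i<k. x i *\<^sub>R slope K (p i)) = 0" if "K \<in> \<T> h" for K
      using measure_cell_pos[OF that] that by fastforce
    \<comment> \<open>The finite element function with boundary coefficients \<open>x\<close> has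
      zero gradient, so it is constant. Its value at the boundary vertex \<open>p i\<close> is
      \<open>x i\<close>, while at the interior vertex \<open>q\<close> all boundary hat functions
      vanish.\<close>
    obtain q where q: "q \<in> mesh_vertices (\<T> h)" "q \<notin> frontier \<Omega>" using interior_vertex_exists by blast
    have "(\<Sum>j<k. x j * nodal_basis (\<T> h) (p j) (p i)) = (\<Sum>j<k. x j * nodal_basis (\<T> h) (p j) q)"
      by (rule zero_energy_constant[OF zero])
        (use vertices_subset q(1) p_vertex i kn in \<open>auto simp del: closure_subset\<close>)
    moreover have "(\<Sum>j<k. x j * nodal_basis (\<T> h) (p j) (p i)) = (\<Sum>j<k. if j = i then x i else 0)"
      using i kn by (intro sum.cong refl) (auto simp: nodal_basis_vertex[OF p_vertex] p_eq)
    moreover have "(\<Sum>j<k. x j * nodal_basis (\<T> h) (p j) q) = 0"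
    proof (intro sum.neutral ballI)
      fix j assume "j \<in> {..<k}"
      then have "p j \<in> frontier \<Omega>" using p\<^sub>\<Gamma>_vertex numbering(3) by blast
      then show "x j * nodal_basis (\<T> h) (p j) q = 0" using q by (auto simp: nodal_basis_vertex)
    qed
    ultimately show "x i = 0" using i by simp
  qed
  have deriv: "(f has_field_derivative deriv f s) (at s)" if "f \<in> {Fp, Gp}" for f s
  proof -
    have "f C1_differentiable_on UNIV" using P1_smooth that by auto
    then have "f differentiable (at s)" by (auto simp: C1_differentiable_on_eq)
    then show ?thesis by (simp add: DERIV_deriv_iff_real_differentiable)
  qed
  show ?thesis
    unfolding M M\<^sub>\<Gamma> n_def[symmetric]
    by (rule scheme_has_solution)
      (use deriv P1_convex(3,4) constants(3) old in \<open>auto simp: n_def\<close>)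
qed

end
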